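(* Assume that the noise vector $\boldsymbol{\varepsilon}=(\varepsilon_1,\ldots,\varepsilon_m)$ satisfies conditions $\mathcal{C}_2(\gamma\boldsymbol{1},\boldsymbol{\rho},\boldsymbol{A})$ and $\mathcal{J}(\boldsymbol{R})$ (stated in the context). Suppose that $n_1\leq\cdots\leq n_m$ and that, for any $j\in\{1,\ldots,m\}$, as $n\to\infty$: $k_j=k_j(n)\to\infty$, $k_j/n_j\to0$, $n_1/n_j\to b_j\in(0,1]$, $k_1/k_j\to c_j\in(0,\infty)$ and $\sqrt{k_j}A_j(n_j/k_j)\to\lambda_j\in\mathbb{R}$. Let $\boldsymbol{\omega}\in\mathbb{R}^m$ be such that $\boldsymbol{\omega}^\top\boldsymbol{1}=1$. If the residuals $\widehat{\varepsilon}_{i,j}^{(n_j)}$ satisfy $$\max_{1\leq j\leq m}\sqrt{k_j}\max_{1\leq i\leq n_j}\frac{|\widehat{\varepsilon}_{i,j}^{(n_j)}-\varepsilon_{i,j}|}{1+|\varepsilon_{i,j}|}\stackrel{\mathbb{P}}{\longrightarrow}0,$$ then, with $k=\sum_{j=1}^mk_j$, the residual-based pooled estimator $\widehat{\gamma}_n(\boldsymbol{\omega})=\sum_{j=1}^m\omega_j\widehat{\gamma}_j(k_j)$ satisfies $$\sqrt{k}(\widehat{\gamma}_n(\boldsymbol{\omega})-\gamma)\stackrel{d}{\longrightarrow}\mathcal{N}(\boldsymbol{\omega}^\top\boldsymbol{B}_{\boldsymbol{c}},\boldsymbol{\omega}^\top\mathbf{V}_{\boldsymbol{c}}\boldsymbol{\omega}),$$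 where $\boldsymbol{B}_{\boldsymbol{c}}=\sqrt{\sum_{i=1}^mc_i^{-1}}\left(\sqrt{c_1}\frac{\lambda_1}{1-\rho_1},\ldots,\sqrt{c_m}\frac{\lambda_m}{1-\rho_m}\right)^\top$ and $\mathbf{V}_{\boldsymbol{c}}$ is the symmetric matrix with $[\mathbf{V}_{\boldsymbol{c}}]_{j,j}=(\sum_{i=1}^mc_i^{-1})\gamma^2c_j$ and $[\mathbf{V}_{\boldsymbol{c}}]_{j,\ell}=(\sum_{i=1}^mc_i^{-1})\gamma^2c_jR_{j,\ell}(c_\ell/c_j,b_\ell/b_j)$ for $j<\ell$. If $\widehat{\boldsymbol{\omega}}_n$ are random vectors with $\widehat{\boldsymbol{\omega}}_n^\top\boldsymbol{1}=1$ and $\widehat{\boldsymbol{\omega}}_n\stackrel{\mathbb{P}}{\longrightarrow}\boldsymbol{\omega}$, then $\sqrt{k}(\widehat{\gamma}_n(\widehat{\boldsymbol{\omega}}_n)-\widehat{\gamma}_n(\boldsymbol{\omega}))=\operatorname{o}_{\mathbb{P}}(1)$; in particular, $\widehat{\gamma}_n(\widehat{\boldsymbol{\omega}}_n)$ has the same $\sqrt{k}$-asymptotic behavior as $\widehat{\gamma}_n(\boldsymbol{\omega})$.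
   Context: Setting: $m$ is a fixed integer; $\boldsymbol{\varepsilon}_i=(\varepsilon_{i,1},\ldots,\varepsilon_{i,m})$, $i\geq1$, are unobserved independent copies of $\boldsymbol{\varepsilon}=(\varepsilon_1,\ldots,\varepsilon_m)$. They arise as the noise in a location-scale model $X_{i,j}=g_j(\boldsymbol{Z}_{i,j})+\sigma_j(\boldsymbol{Z}_{i,j})\varepsilon_{i,j}$, $1\leq j\leq m$, $1\leq i\leq n_j=n_j(n)$, with $g_j$ and $\sigma_j>0$ unknown measurable functions, the pairs $(X_{i,j},\boldsymbol{Z}_{i,j})$ part of a strictly stationary sequence, and $\varepsilon_j$ independent of the covariate $\boldsymbol{Z}_j$. Residuals $\widehat{\varepsilon}_{i,j}^{(n_j)}$ (random variables, $1\leq i\leq n_j$, $1\leq j\leq m$), obtained by estimating $g_j$ and $\sigma_j$ and filtering, serve as proxies of the $\varepsilon_{i,j}$; the only property required of them is the one displayed in the claim. $n=\sum_{j=1}^mn_j$, $n_j\to\infty$ as $n\to\infty$, and $\boldsymbol{1}$ is the vector of ones in $\mathbb{R}^m$. Each $\varepsilon_j$ has a continuous distribution function $F_j$, $\overline{F}_j=1-F_j$, and tail quantile function $U_j(t)=\inf\{x\in\mathbb{R}:1/\overline{F}_j(x)\geq t\}$. Condition $\mathcal{C}_2(\gamma\boldsymbol{1},\boldsymbol{\rho},\boldsymbol{A})$: $\gamma>0$ and, for every $j$, $\rho_j\leq0$, $A_j$ has constant sign and converges to $0$ at infinity, and for all $x>0$, $\lim_{t\to\infty}\frac{1}{A_j(t)}\left[\frac{U_j(tx)}{U_j(t)}-x^{\gamma}\right]=x^{\gamma}\frac{x^{\rho_j}-1}{\rho_j}$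 (read as $x^{\gamma}\log x$ if $\rho_j=0$). Condition $\mathcal{J}(\boldsymbol{R})$: with $\overline{C}_{j,\ell}(u,v)=\mathbb{P}(\overline{F}_j(\varepsilon_j)\leq u,\overline{F}_\ell(\varepsilon_\ell)\leq v)$, for any $j\neq\ell$ there is a function $R_{j,\ell}$ on $[0,\infty]^2\setminus\{(\infty,\infty)\}$ such that $\lim_{s\to\infty}s\,\overline{C}_{j,\ell}(x_j/s,x_\ell/s)=R_{j,\ell}(x_j,x_\ell)$ for all $(x_j,x_\ell)$ in this set. Residual-based Hill estimators: with $\widehat{\varepsilon}_{1:n_j,j}^{(n_j)}\leq\cdots\leq\widehat{\varepsilon}_{n_j:n_j,j}^{(n_j)}$ the ordered residuals in sample $j$, $\widehat{\gamma}_j(k_j)=k_j^{-1}\sum_{i=1}^{k_j}\log(\widehat{\varepsilon}_{n_j-i+1:n_j,j}^{(n_j)}/\widehat{\varepsilon}_{n_j-k_j:n_j,j}^{(n_j)})$. *)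

theory Defs
  imports "HOL-Probability.Probability"
begin

text \<open>A family \<open>x 1, \<dots>, x m\<close> is encoded as a function on \<^typ>\<open>nat\<close> of which only the values on
  \<open>{1..m}\<close> matter. A vector-valued random variable is turned into a measurable map into the product
  space \<open>PiM {1..m} (\<lambda>_. borel)\<close> by restricting its index to \<open>{1..m}\<close>.\<close>

definition rand_vec :: "nat \<Rightarrow> (nat \<Rightarrow> 'a \<Rightarrow> real) \<Rightarrow> 'a \<Rightarrow> (nat \<Rightarrow> real)" where
  "rand_vec m X = (\<lambda>\<omega>. \<lambda>j\<in>{1..m}. X j \<omega>)"

text \<open>The vectors \<open>e 1, e 2, \<dots>\<close> are independent copies of \<open>\<epsilon>\<close>; the component \<open>j\<close> of
  \<open>e i\<close> is \<open>e i j\<close>.\<close>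

definition independent_copies ::
  "'a measure \<Rightarrow> nat \<Rightarrow> (nat \<Rightarrow> 'a \<Rightarrow> real) \<Rightarrow> (nat \<Rightarrow> nat \<Rightarrow> 'a \<Rightarrow> real) \<Rightarrow> bool" where
  "independent_copies M m \<epsilon> e \<longleftrightarrow>
     prob_space.indep_vars M (\<lambda>_. PiM {1..m} (\<lambda>_. borel)) (\<lambda>i. rand_vec m (e i)) {1..} \<and>
     (\<forall>i\<ge>1. distr M (PiM {1..m} (\<lambda>_. borel)) (rand_vec m (e i))
           = distr M (PiM {1..m} (\<lambda>_. borel)) (rand_vec m \<epsilon>))"

definition dist_fun :: "'a measure \<Rightarrow> ('a \<Rightarrow> real) \<Rightarrow> real \<Rightarrow> real" where
  "dist_fun M X = cdf (distr M borel X)"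

definition survival :: "'a measure \<Rightarrow> ('a \<Rightarrow> real) \<Rightarrow> real \<Rightarrow> real" where
  "survival M X x = 1 - dist_fun M X x"

text \<open>The quotient is taken in \<^typ>\<open>ennreal\<close> so that \<open>1 / 0 = \<infinity>\<close>. The infimum is meaningful for
  \<open>t > 1\<close> (for \<open>t \<le> 1\<close> the set is all of \<open>\<real>\<close>); only the behaviour as \<open>t \<rightarrow> \<infinity>\<close> is used.\<close>

definition tail_quantile :: "'a measure \<Rightarrow> ('a \<Rightarrow> real) \<Rightarrow> real \<Rightarrow> real" where
  "tail_quantile M X t = Inf {x. 1 / ennreal (survival M X x) \<ge> ennreal t}"

text \<open>Condition \<open>C\<^sub>2(\<gamma>, \<rho>, A)\<close>, with a vector \<open>\<gamma>\<close> of tail indices. Constant sign is read as constancy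
  of \<^const>\<open>sgn\<close> on the positive half-line; the limit relation itself excludes \<open>A j = 0\<close>
  near infinity.\<close>

definition second_order_cond ::
  "'a measure \<Rightarrow> nat \<Rightarrow> (nat \<Rightarrow> 'a \<Rightarrow> real) \<Rightarrow> (nat \<Rightarrow> real) \<Rightarrow> (nat \<Rightarrow> real) \<Rightarrow> (nat \<Rightarrow> real \<Rightarrow> real) \<Rightarrow> bool"
where
  "second_order_cond M m \<epsilon> \<gamma> \<rho> A \<longleftrightarrow>
     (\<forall>j\<in>{1..m}.
        \<gamma> j > 0 \<and> \<rho> j \<le> 0 \<and>
        (\<exists>s. \<forall>t>0. sgn (A j t) = s) \<and>
        (A j \<longlongrightarrow> 0) at_top \<and>
        (\<forall>x>0. ((\<lambda>t. 1 / A j t *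
                   (tail_quantile M (\<epsilon> j) (t * x) / tail_quantile M (\<epsilon> j) t - x powr \<gamma> j))
                 \<longlongrightarrow> (if \<rho> j = 0 then x powr \<gamma> j * ln x
                       else x powr \<gamma> j * ((x powr \<rho> j - 1) / \<rho> j))) at_top))"

text \<open>The arguments range over \<open>[0, \<infinity>]\<close>, an infinite argument leaving the corresponding
  component unconstrained.\<close>

definition survival_copula ::
  "'a measure \<Rightarrow> ('a \<Rightarrow> real) \<Rightarrow> ('a \<Rightarrow> real) \<Rightarrow> ennreal \<Rightarrow> ennreal \<Rightarrow> real" where
  "survival_copula M X Y u v =
     measure M {\<omega> \<in> space M. ennreal (survival M X (X \<omega>)) \<le> u \<and> ennreal (survival M Y (Y \<omega>)) \<le> v}"

definition tail_dependence_cond ::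
  "'a measure \<Rightarrow> nat \<Rightarrow> (nat \<Rightarrow> 'a \<Rightarrow> real) \<Rightarrow> (nat \<Rightarrow> nat \<Rightarrow> ennreal \<Rightarrow> ennreal \<Rightarrow> real) \<Rightarrow> bool" where
  "tail_dependence_cond M m \<epsilon> R \<longleftrightarrow>
     (\<forall>j\<in>{1..m}. \<forall>l\<in>{1..m}. j \<noteq> l \<longrightarrow>
        (\<forall>x y. (x, y) \<noteq> (\<infinity>, \<infinity>) \<longrightarrow>
           ((\<lambda>s. s * survival_copula M (\<epsilon> j) (\<epsilon> l) (x / ennreal s) (y / ennreal s))
              \<longlongrightarrow> R j l x y) at_top))"

text \<open>The \<open>i\<close>-th smallest of \<open>x 1, \<dots>, x n\<close>, for \<open>1 \<le> i \<le> n\<close>.\<close>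

definition order_stat :: "(nat \<Rightarrow> real) \<Rightarrow> nat \<Rightarrow> nat \<Rightarrow> real" where
  "order_stat x n i = sort (map x [1..<Suc n]) ! (i - 1)"

definition hill :: "(nat \<Rightarrow> real) \<Rightarrow> nat \<Rightarrow> nat \<Rightarrow> real" where
  "hill x n k = (1 / real k) * (\<Sum>i=1..k. ln (order_stat x n (n - i + 1) / order_stat x n (n - k)))"

text \<open>The data \<open>x i j\<close> is the \<open>i\<close>-th observation in sample \<open>j\<close>, which has size \<open>N j\<close>.\<close>

definition pooled_hill ::
  "nat \<Rightarrow> (nat \<Rightarrow> nat \<Rightarrow> real) \<Rightarrow> (nat \<Rightarrow> nat) \<Rightarrow> (nat \<Rightarrow> nat) \<Rightarrow> (nat \<Rightarrow> real) \<Rightarrow> real" where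
  "pooled_hill m x N k w = (\<Sum>j=1..m. w j * hill (\<lambda>i. x i j) (N j) (k j))"

definition small_o_prob :: "'a measure \<Rightarrow> (nat \<Rightarrow> 'a \<Rightarrow> real) \<Rightarrow> bool" where
  "small_o_prob M X \<longleftrightarrow>
     (\<forall>\<delta>>0. (\<lambda>n. measure M {\<omega> \<in> space M. \<bar>X n \<omega>\<bar> > \<delta>}) \<longlonglongrightarrow> 0)"

definition vec_conv_in_prob ::
  "'a measure \<Rightarrow> nat \<Rightarrow> (nat \<Rightarrow> nat \<Rightarrow> 'a \<Rightarrow> real) \<Rightarrow> (nat \<Rightarrow> real) \<Rightarrow> bool" where
  "vec_conv_in_prob M m W w \<longleftrightarrow> small_o_prob M (\<lambda>n \<omega>. L2_set (\<lambda>j. W n j \<omega> - w j) {1..m})"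

definition conv_in_distr :: "'a measure \<Rightarrow> (nat \<Rightarrow> 'a \<Rightarrow> real) \<Rightarrow> real measure \<Rightarrow> bool" where
  "conv_in_distr M X L \<longleftrightarrow> weak_conv_m (\<lambda>n. distr M borel (X n)) L"

text \<open>The normal law with mean \<open>\<mu>\<close> and variance \<open>v \<ge> 0\<close>. Defined as an affine image so that
  \<open>v = 0\<close> gives the point mass at \<open>\<mu>\<close>, which \<^const>\<open>normal_density\<close> does not.\<close>

definition normal_law :: "real \<Rightarrow> real \<Rightarrow> real measure" where
  "normal_law \<mu> v = distr std_normal_distribution borel (\<lambda>z. \<mu> + sqrt v * z)"

definition bias_vec :: "nat \<Rightarrow> (nat \<Rightarrow> real) \<Rightarrow> (nat \<Rightarrow> real) \<Rightarrow> (nat \<Rightarrow> real) \<Rightarrow> nat \<Rightarrow> real" where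
  "bias_vec m c lam \<rho> j = sqrt (\<Sum>i=1..m. inverse (c i)) * (sqrt (c j) * (lam j / (1 - \<rho> j)))"

definition var_mat ::
  "nat \<Rightarrow> real \<Rightarrow> (nat \<Rightarrow> real) \<Rightarrow> (nat \<Rightarrow> real) \<Rightarrow> (nat \<Rightarrow> nat \<Rightarrow> ennreal \<Rightarrow> ennreal \<Rightarrow> real)
     \<Rightarrow> nat \<Rightarrow> nat \<Rightarrow> real" where
  "var_mat m \<gamma> b c R j l =
     (let upper = (\<lambda>p q. (\<Sum>i=1..m. inverse (c i)) * \<gamma>\<^sup>2 * c p *
                          R p q (ennreal (c q / c p)) (ennreal (b q / b p)))
      in if j = l then (\<Sum>i=1..m. inverse (c i)) * \<gamma>\<^sup>2 * c j
         else if j < l then upper j l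
         else upper l j)"

end

theory Submission
  imports Defs
begin

text \<open>Write \<open>Q\<^sub>j = - ln (survival (\<epsilon> j))\<close>, a standard exponential variable, so that \<open>\<epsilon> j\<close> is almost surely the
  tail quantile function at \<open>exp Q\<^sub>j\<close>, whose logarithm \<open>u\<close> is \<open>\<gamma> s + g s\<close> with small increments of \<open>g\<close>.
  With \<open>y = ln (n / k)\<close>, the Hill estimator is compared with its version for the deterministic
  threshold \<open>y\<close>: since the derivative of \<open>\<Sum>\<^sub>i max 0 (Q\<^sub>i - s)\<close> in \<open>s\<close> is minus the number of exceedances, the
  linear parts of the error combine to the centred sum of \<open>Q\<^sub>i - y - 1\<close> over the exceedances
  \<open>Q\<^sub>i \<ge> y\<close>, and \<open>g\<close> only contributes the deterministic bias, by uniform second-order regular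
  variation. The residuals enter through the monotone maps \<open>x \<mapsto> x \<plusminus> \<delta> (1 + |x|)\<close>, which commute
  with order statistics. The joint limit of the centred sums over the \<open>m\<close> samples follows from Lyapunov's
  theorem, row by row, and the homogeneity of \<open>R\<close> reduces the limiting covariances to a single value of \<open>R\<close>.

  Convergence in probability is convergence along a filter on pairs of an index and a sample point, which makes the
  calculus of limits available.\<close>

section \<open>Convergence in probability as a filter\<close>

text \<open>The samples are dependent through the rows \<open>e i\<close> and differ in size, so a
  representation of one ordered sample, say by spacings, says nothing about the joint law. Each Hill
  estimator is therefore brought to a sum over \<open>i\<close> of a function of the single
  observation, up to a remainder that converges to a constant in probability; independence of the
  rows then suffices. The summand \<open>1{Q >= y} * (Q - y - 1)\<close> is an excess minus an
  exceedance indicator. Subtracting the indicator is forced: moving the random threshold to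
  \<open>y\<close> costs, to first order, the fluctuation of the number of exceedances. Two samples
  share \<open>min (N j) (N l)\<close> rows and their levels differ by an amount converging to some
  \<open>d\<close>, so the covariances involve \<open>R\<close> at \<open>(1, exp d)\<close>;
  homogeneity, read off from the limit defining \<open>R\<close>, turns this into the value at the
  limiting ratios of the \<open>k\<close> and of the \<open>N\<close>. Random weights are handled by
  the fact that both weight vectors sum to 1, which leaves products of null and tight
  sequences.\<close>

definition eventually_prob :: "'a measure \<Rightarrow> real \<Rightarrow> (nat \<Rightarrow> 'a \<Rightarrow> bool) \<Rightarrow> bool" where
  "eventually_prob M \<eta> P \<longleftrightarrow>
     (\<forall>\<^sub>F n in sequentially. \<exists>G\<in>sets M. measure M G \<ge> 1 - \<eta> \<and> (\<forall>\<omega>\<in>G. P n \<omega>))"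

text \<open>Membership asks for a measurable good event of probability at least
  \<open>1 - \<eta>\<close> inside the set where the property holds, not for measurability of that
  set. Statements about thresholds, maxima or residuals can thus be combined freely, and
  measurability matters only on translation to probabilities.\<close>

definition prob_filter :: "'a measure \<Rightarrow> (nat \<times> 'a) filter" where
  "prob_filter M = Abs_filter (\<lambda>P. \<forall>\<eta>>0. eventually_prob M \<eta> (\<lambda>n \<omega>. P (n, \<omega>)))"

abbreviation prob_lim :: "'a measure \<Rightarrow> (nat \<Rightarrow> 'a \<Rightarrow> real) \<Rightarrow> real \<Rightarrow> bool" where
  "prob_lim M X c \<equiv> ((\<lambda>p. X (fst p) (snd p)) \<longlongrightarrow> c) (prob_filter M)"

text \<open>Tightness, or O_P(1). The bound may depend on \<open>\<eta>\<close>, so this is weaker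
  than boundedness along \<open>prob_filter\<close> and has its own small calculus.\<close>

definition prob_bounded :: "'a measure \<Rightarrow> (nat \<Rightarrow> 'a \<Rightarrow> real) \<Rightarrow> bool" where
  "prob_bounded M X \<longleftrightarrow> (\<forall>\<eta>>0. \<exists>B. eventually_prob M \<eta> (\<lambda>n \<omega>. \<bar>X n \<omega>\<bar> \<le> B))"

lemma eventually_prob_mono:
  assumes "eventually_prob M \<eta> P" "\<And>n \<omega>. P n \<omega> \<Longrightarrow> Q n \<omega>"
  shows "eventually_prob M \<eta> Q"
  using assms(1) unfolding eventually_prob_def by (rule eventually_mono) (use assms(2) in blast)

context prob_space
begin

text \<open>Two exceptional sets of size \<open>\<eta>/2\<close> cost \<open>\<eta>\<close>. Since
  the filter quantifies over all \<open>\<eta>\<close>, this closes it under conjunction.\<close>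

lemma eventually_prob_conj:
  assumes "eventually_prob M (\<eta>/2) P" "eventually_prob M (\<eta>/2) Q"
  shows "eventually_prob M \<eta> (\<lambda>n \<omega>. P n \<omega> \<and> Q n \<omega>)"
  using assms unfolding eventually_prob_def
proof eventually_elim
  case (elim n)
  then obtain G H where GH: "G \<in> events" "H \<in> events" "prob G \<ge> 1 - \<eta>/2" "prob H \<ge> 1 - \<eta>/2"
    "\<forall>\<omega>\<in>G. P n \<omega>" "\<forall>\<omega>\<in>H. Q n \<omega>" by blast
  have "prob (G \<union> H) + prob (G \<inter> H) = prob G + prob H"
    using measure_Un3[OF fmeasurable_eq_sets[THEN equalityD2, THEN subsetD] fmeasurable_eq_sets[THEN equalityD2, THEN subsetD], OF GH(1,2)]
    by simp
  then have "prob (G \<inter> H) \<ge> 1 - \<eta>" using GH(3,4) prob_le_1[of "G \<union> H"] by argo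
  with GH show ?case by (intro bexI[of _ "G \<inter> H"]) simp_all
qed

lemma eventually_prob_filter:
  "eventually P (prob_filter M) \<longleftrightarrow> (\<forall>\<eta>>0. eventually_prob M \<eta> (\<lambda>n \<omega>. P (n, \<omega>)))"
  unfolding prob_filter_def
proof (subst eventually_Abs_filter, rule is_filter.intro, goal_cases)
  case 1
  then show ?case by (auto intro!: bexI[of _ "space M"] always_eventually simp: prob_space eventually_prob_def)
next
  case (2 P Q)
  then show ?case by (simp add: eventually_prob_conj)
next
  case (3 P Q)
  show ?case
  proof (intro allI impI)
    fix \<eta> :: real assume "\<eta> > 0"
    with 3(2) have "eventually_prob M \<eta> (\<lambda>n \<omega>. P (n, \<omega>))" by simp
    then show "eventually_prob M \<eta> (\<lambda>n \<omega>. Q (n, \<omega>))"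
      by (rule eventually_prob_mono) (use 3(1) in simp)
  qed
next
  case 4
  show ?case by (rule refl)
qed

lemma eventually_prob_filterI:
  assumes "\<forall>\<^sub>F n in sequentially. \<forall>\<omega>\<in>space M. P n \<omega>"
  shows "eventually (\<lambda>p. P (fst p) (snd p)) (prob_filter M)"
  unfolding eventually_prob_filter eventually_prob_def fst_conv snd_conv
proof (intro allI impI)
  fix \<eta> :: real assume "\<eta> > 0"
  show "\<forall>\<^sub>F n in sequentially. \<exists>G\<in>events. prob G \<ge> 1 - \<eta> \<and> (\<forall>\<omega>\<in>G. P n \<omega>)"
    using assms by eventually_elim (use \<open>\<eta> > 0\<close> in \<open>auto intro!: bexI[of _ "space M"] simp: prob_space\<close>)
qed

lemma eventually_prob_filter_sequentially:
  assumes "\<forall>\<^sub>F n in sequentially. P n"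
  shows "eventually (\<lambda>p. P (fst p)) (prob_filter M)"
  using assms by (intro eventually_prob_filterI[of "\<lambda>n _. P n"]) simp

lemma eventually_prob_filter_AE:
  assumes "\<forall>\<^sub>F n in sequentially. AE \<omega> in M. P n \<omega>"
  shows "eventually (\<lambda>p. P (fst p) (snd p)) (prob_filter M)"
  unfolding eventually_prob_filter eventually_prob_def fst_conv snd_conv
proof (intro allI impI)
  fix \<eta> :: real assume "\<eta> > 0"
  show "\<forall>\<^sub>F n in sequentially. \<exists>G\<in>events. prob G \<ge> 1 - \<eta> \<and> (\<forall>\<omega>\<in>G. P n \<omega>)"
    using assms
  proof eventually_elim
    case (elim n)
    then obtain N where N: "{\<omega> \<in> space M. \<not> P n \<omega>} \<subseteq> N" "N \<in> events" "emeasure M N = 0" by (elim AE_E) auto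
    then have "prob (space M - N) = 1" by (subst prob_compl) (auto simp: measure_def)
    with N \<open>\<eta> > 0\<close> show ?case by (intro bexI[of _ "space M - N"]) auto
  qed
qed

text \<open>The bridge between the filter and probabilities: once the exceptional event is
  measurable, its complement is the best choice of the good event.\<close>

lemma eventually_prob_filter_prob:
  assumes "\<forall>\<^sub>F n in sequentially. {\<omega> \<in> space M. \<not> P (n, \<omega>)} \<in> events"
  shows "eventually P (prob_filter M) \<longleftrightarrow> (\<lambda>n. prob {\<omega> \<in> space M. \<not> P (n, \<omega>)}) \<longlonglongrightarrow> 0"
proof
  assume P: "eventually P (prob_filter M)"
  show "(\<lambda>n. prob {\<omega> \<in> space M. \<not> P (n, \<omega>)}) \<longlonglongrightarrow> 0"
  proof (rule tendstoI)
    fix \<eta> :: real assume "\<eta> > 0"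
    with P have "\<forall>\<^sub>F n in sequentially. \<exists>G\<in>events. prob G \<ge> 1 - \<eta>/2 \<and> (\<forall>\<omega>\<in>G. P (n, \<omega>))"
      unfolding eventually_prob_filter eventually_prob_def by simp
    with assms show "\<forall>\<^sub>F n in sequentially. dist (prob {\<omega> \<in> space M. \<not> P (n, \<omega>)}) 0 < \<eta>"
    proof eventually_elim
      case (elim n)
      then obtain G where G: "G \<in> events" "prob G \<ge> 1 - \<eta>/2" "\<forall>\<omega>\<in>G. P (n, \<omega>)" by blast
      have "prob {\<omega> \<in> space M. \<not> P (n, \<omega>)} \<le> prob (space M - G)"
        using G by (intro finite_measure_mono) auto
      then show ?case using G \<open>\<eta> > 0\<close> by (simp add: prob_compl)
    qed
  qed
next
  assume L: "(\<lambda>n. prob {\<omega> \<in> space M. \<not> P (n, \<omega>)}) \<longlonglongrightarrow> 0"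
  show "eventually P (prob_filter M)" unfolding eventually_prob_filter eventually_prob_def
  proof (intro allI impI)
    fix \<eta> :: real assume "\<eta> > 0"
    from order_tendstoD(2)[OF L this] assms
    show "\<forall>\<^sub>F n in sequentially. \<exists>G\<in>events. prob G \<ge> 1 - \<eta> \<and> (\<forall>\<omega>\<in>G. P (n, \<omega>))"
    proof eventually_elim
      case (elim n)
      then show ?case
        by (intro bexI[of _ "space M - {\<omega> \<in> space M. \<not> P (n, \<omega>)}"]) (auto simp: prob_compl)
    qed
  qed
qed

lemma prob_filter_fst: "filterlim fst sequentially (prob_filter M)"
  unfolding filterlim_iff by (intro allI impI eventually_prob_filter_sequentially)

lemma prob_lim_sequence:
  assumes "X \<longlonglongrightarrow> c" shows "prob_lim M (\<lambda>n _. X n) c"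
  using filterlim_compose[OF assms prob_filter_fst] .

lemma prob_lim_iff_small_o_prob:
  assumes "\<forall>\<^sub>F n in sequentially. X n \<in> borel_measurable M"
  shows "prob_lim M X 0 \<longleftrightarrow> small_o_prob M X"
proof -
  have *: "eventually (\<lambda>p. \<bar>X (fst p) (snd p)\<bar> \<le> \<delta>) (prob_filter M) \<longleftrightarrow>
      (\<lambda>n. prob {\<omega> \<in> space M. \<bar>X n \<omega>\<bar> > \<delta>}) \<longlonglongrightarrow> 0" for \<delta>
  proof (subst eventually_prob_filter_prob)
    show "\<forall>\<^sub>F n in sequentially. {\<omega> \<in> space M. \<not> \<bar>X (fst (n, \<omega>)) (snd (n, \<omega>))\<bar> \<le> \<delta>} \<in> events"
      using assms by eventually_elim simp
  qed (simp add: not_le)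
  have "prob_lim M X 0 \<longleftrightarrow> (\<forall>\<delta>>0. eventually (\<lambda>p. \<bar>X (fst p) (snd p)\<bar> \<le> \<delta>) (prob_filter M))"
    unfolding tendsto_iff dist_real_def
  proof (safe, goal_cases)
    case (1 \<delta>)
    then have "eventually (\<lambda>p. \<bar>X (fst p) (snd p) - 0\<bar> < \<delta>) (prob_filter M)" by blast
    then show ?case by (rule eventually_mono) simp
  next
    case (2 \<delta>)
    \<comment> \<open>The definition of the limit asks for a strict inequality, while the complement
      of \<open>> \<delta>\<close> is \<open>\<le> \<delta>\<close>; halving bridges the
      two.\<close>
    from 2(1)[rule_format, of "\<delta>/2"] 2(2)
    have "eventually (\<lambda>p. \<bar>X (fst p) (snd p)\<bar> \<le> \<delta>/2) (prob_filter M)" by simp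
    then show ?case by (rule eventually_mono) (use \<open>\<delta> > 0\<close> in simp)
  qed
  then show ?thesis unfolding small_o_prob_def * .
qed

lemma Chebyshev_second_moment:
  assumes [measurable]: "X \<in> borel_measurable M" and "integrable M (\<lambda>\<omega>. (X \<omega>)\<^sup>2)" and "a > 0"
  shows "prob {\<omega> \<in> space M. \<bar>X \<omega>\<bar> > a} \<le> expectation (\<lambda>\<omega>. (X \<omega>)\<^sup>2) / a\<^sup>2"
proof -
  have "prob {\<omega> \<in> space M. \<bar>X \<omega>\<bar> > a} \<le> prob {\<omega> \<in> space M. (X \<omega>)\<^sup>2 \<ge> a\<^sup>2}"
    using \<open>a > 0\<close> by (intro finite_measure_mono) (auto simp: abs_le_square_iff[symmetric])
  also have "\<dots> \<le> expectation (\<lambda>\<omega>. (X \<omega>)\<^sup>2) / a\<^sup>2"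
    using assms by (intro integral_Markov_inequality_measure[where A="space M - {}"]) auto
  finally show ?thesis .
qed

lemma prob_lim_second_moment:
  assumes X: "\<forall>\<^sub>F n in sequentially. X n \<in> borel_measurable M \<and> integrable M (\<lambda>\<omega>. (X n \<omega>)\<^sup>2) \<and> expectation (\<lambda>\<omega>. (X n \<omega>)\<^sup>2) \<le> v n"
    and v: "v \<longlonglongrightarrow> 0"
  shows "prob_lim M X 0"
proof (subst prob_lim_iff_small_o_prob)
  show "\<forall>\<^sub>F n in sequentially. X n \<in> borel_measurable M" using X by (rule eventually_mono) simp
  show "small_o_prob M X" unfolding small_o_prob_def
  proof (intro allI impI)
    fix \<delta> :: real assume "\<delta> > 0"
    show "(\<lambda>n. prob {\<omega> \<in> space M. \<delta> < \<bar>X n \<omega>\<bar>}) \<longlonglongrightarrow> 0"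
    proof (rule tendsto_sandwich[of "\<lambda>_. 0"])
      show "\<forall>\<^sub>F n in sequentially. prob {\<omega> \<in> space M. \<delta> < \<bar>X n \<omega>\<bar>} \<le> v n / \<delta>\<^sup>2"
        using X
      proof eventually_elim
        case (elim n)
        have "expectation (\<lambda>\<omega>. (X n \<omega>)\<^sup>2) / \<delta>\<^sup>2 \<le> v n / \<delta>\<^sup>2" using elim by (simp add: divide_right_mono)
        moreover have "prob {\<omega> \<in> space M. \<delta> < \<bar>X n \<omega>\<bar>} \<le> expectation (\<lambda>\<omega>. (X n \<omega>)\<^sup>2) / \<delta>\<^sup>2"
          using elim \<open>\<delta> > 0\<close> by (intro Chebyshev_second_moment) simp_all
        ultimately show ?case by linarith
      qed
      show "(\<lambda>n. v n / \<delta>\<^sup>2) \<longlonglongrightarrow> 0" using tendsto_divide[OF v tendsto_const[of "\<delta>\<^sup>2"]] \<open>\<delta> > 0\<close> by simp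
    qed auto
  qed
qed

lemma prob_bounded_second_moment:
  assumes X: "\<forall>\<^sub>F n in sequentially. X n \<in> borel_measurable M \<and> integrable M (\<lambda>\<omega>. (X n \<omega>)\<^sup>2) \<and> expectation (\<lambda>\<omega>. (X n \<omega>)\<^sup>2) \<le> v"
  shows "prob_bounded M X"
  unfolding prob_bounded_def eventually_prob_def
proof (intro allI impI)
  fix \<eta> :: real assume "\<eta> > 0"
  \<comment> \<open>Solves \<open>(\<bar>v\<bar> + 1) / B\<^sup>2 = \<eta>\<close> for
    \<open>B\<close>; the \<open>+ 1\<close> keeps \<open>B\<close> positive for
    \<open>v = 0\<close>.\<close>
  define B where "B = sqrt ((\<bar>v\<bar> + 1) / \<eta>)"
  have *: "(\<bar>v\<bar> + 1) / \<eta> > 0" using \<open>\<eta> > 0\<close> by (intro divide_pos_pos) simp_all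
  have "B > 0" unfolding B_def using * by (rule real_sqrt_gt_zero)
  have B2: "B\<^sup>2 = (\<bar>v\<bar> + 1) / \<eta>" unfolding B_def using * by (intro real_sqrt_pow2) simp
  have "\<forall>\<^sub>F n in sequentially. \<exists>G\<in>events. prob G \<ge> 1 - \<eta> \<and> (\<forall>\<omega>\<in>G. \<bar>X n \<omega>\<bar> \<le> B)"
    using X
  proof eventually_elim
    case (elim n)
    then have [measurable]: "X n \<in> borel_measurable M" by simp
    have "prob {\<omega> \<in> space M. \<bar>X n \<omega>\<bar> > B} \<le> expectation (\<lambda>\<omega>. (X n \<omega>)\<^sup>2) / B\<^sup>2"
      using elim \<open>B > 0\<close> by (intro Chebyshev_second_moment) auto
    also have "\<dots> \<le> (\<bar>v\<bar> + 1) / B\<^sup>2" using elim by (intro divide_right_mono) auto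
    also have "\<dots> = \<eta>" unfolding B2 using \<open>\<eta> > 0\<close> by simp
    finally show ?case
      by (intro bexI[of _ "space M - {\<omega> \<in> space M. \<bar>X n \<omega>\<bar> > B}"]) (auto simp: prob_compl)
  qed
  then show "\<exists>B. \<forall>\<^sub>F n in sequentially. \<exists>G\<in>events. prob G \<ge> 1 - \<eta> \<and> (\<forall>\<omega>\<in>G. \<bar>X n \<omega>\<bar> \<le> B)" ..
qed

lemma prob_boundedE:
  assumes "prob_bounded M X" "\<eta> > 0"
  obtains B where "B > 0" "eventually_prob M \<eta> (\<lambda>n \<omega>. \<bar>X n \<omega>\<bar> \<le> B)"
proof -
  obtain B where "eventually_prob M \<eta> (\<lambda>n \<omega>. \<bar>X n \<omega>\<bar> \<le> B)"
    using assms unfolding prob_bounded_def by blast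
  then have "eventually_prob M \<eta> (\<lambda>n \<omega>. \<bar>X n \<omega>\<bar> \<le> \<bar>B\<bar> + 1)"
    by (rule eventually_prob_mono) simp
  then show ?thesis by (rule that[rotated]) simp
qed

lemma prob_bounded_add:
  assumes "prob_bounded M X" "prob_bounded M Y"
  shows "prob_bounded M (\<lambda>n \<omega>. X n \<omega> + Y n \<omega>)"
  unfolding prob_bounded_def
proof (intro allI impI)
  fix \<eta> :: real assume "\<eta> > 0"
  then have "\<eta> / 2 > 0" by simp
  obtain B where B: "eventually_prob M (\<eta>/2) (\<lambda>n \<omega>. \<bar>X n \<omega>\<bar> \<le> B)"
    using assms(1) \<open>\<eta> / 2 > 0\<close> by (rule prob_boundedE)
  obtain C where C: "eventually_prob M (\<eta>/2) (\<lambda>n \<omega>. \<bar>Y n \<omega>\<bar> \<le> C)"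
    using assms(2) \<open>\<eta> / 2 > 0\<close> by (rule prob_boundedE)
  have "eventually_prob M \<eta> (\<lambda>n \<omega>. \<bar>X n \<omega> + Y n \<omega>\<bar> \<le> B + C)"
    by (rule eventually_prob_mono[OF eventually_prob_conj[OF B C]]) (auto intro: order_trans[OF abs_triangle_ineq add_mono])
  then show "\<exists>B. eventually_prob M \<eta> (\<lambda>n \<omega>. \<bar>X n \<omega> + Y n \<omega>\<bar> \<le> B)" ..
qed

lemma prob_bounded_cmult:
  assumes "prob_bounded M X"
  shows "prob_bounded M (\<lambda>n \<omega>. a * X n \<omega>)"
  unfolding prob_bounded_def
proof (intro allI impI)
  fix \<eta> :: real assume "\<eta> > 0"
  with assms obtain B where "eventually_prob M \<eta> (\<lambda>n \<omega>. \<bar>X n \<omega>\<bar> \<le> B)"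
    by (rule prob_boundedE)
  then have "eventually_prob M \<eta> (\<lambda>n \<omega>. \<bar>a * X n \<omega>\<bar> \<le> \<bar>a\<bar> * B)"
    by (rule eventually_prob_mono) (simp add: abs_mult mult_left_mono)
  then show "\<exists>B. eventually_prob M \<eta> (\<lambda>n \<omega>. \<bar>a * X n \<omega>\<bar> \<le> B)" ..
qed

lemma prob_lim_imp_bounded:
  assumes "prob_lim M X c"
  shows "prob_bounded M X"
  unfolding prob_bounded_def
proof (intro allI impI)
  fix \<eta> :: real assume "\<eta> > 0"
  have "eventually (\<lambda>p. \<bar>X (fst p) (snd p)\<bar> \<le> \<bar>c\<bar> + 1) (prob_filter M)"
    using tendstoD[OF assms, of 1] by (auto elim!: eventually_mono simp: dist_real_def)
  with \<open>\<eta> > 0\<close> show "\<exists>B. eventually_prob M \<eta> (\<lambda>n \<omega>. \<bar>X n \<omega>\<bar> \<le> B)"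
    unfolding eventually_prob_filter by auto
qed

text \<open>o_P(1) times O_P(1). The bound on \<open>Y\<close> is known only after
  \<open>\<eta>\<close> is chosen, so the filter has to be unpacked: half of \<open>\<eta>\<close>
  pays for the bound, half for the smallness of \<open>X\<close>.\<close>

lemma prob_lim_zero_mult_bounded:
  assumes X: "prob_lim M X 0" and Y: "prob_bounded M Y"
  shows "prob_lim M (\<lambda>n \<omega>. X n \<omega> * Y n \<omega>) 0"
proof (rule tendstoI)
  fix \<delta> :: real assume "\<delta> > 0"
  show "eventually (\<lambda>p. dist (X (fst p) (snd p) * Y (fst p) (snd p)) 0 < \<delta>) (prob_filter M)"
    unfolding eventually_prob_filter
  proof (intro allI impI)
    fix \<eta> :: real assume "\<eta> > 0"
    then have "\<eta> / 2 > 0" by simp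
    obtain B where "B > 0" and B: "eventually_prob M (\<eta>/2) (\<lambda>n \<omega>. \<bar>Y n \<omega>\<bar> \<le> B)"
      using Y \<open>\<eta> / 2 > 0\<close> by (rule prob_boundedE)
    have "eventually (\<lambda>p. \<bar>X (fst p) (snd p)\<bar> < \<delta> / B) (prob_filter M)"
      using tendstoD[OF X, of "\<delta> / B"] \<open>\<delta> > 0\<close> \<open>B > 0\<close> by simp
    then have "eventually_prob M (\<eta>/2) (\<lambda>n \<omega>. \<bar>X n \<omega>\<bar> < \<delta> / B)"
      unfolding eventually_prob_filter using \<open>\<eta> > 0\<close> by simp
    from eventually_prob_conj[OF B this]
    show "eventually_prob M \<eta> (\<lambda>n \<omega>. dist (X (fst (n, \<omega>)) (snd (n, \<omega>)) * Y (fst (n, \<omega>)) (snd (n, \<omega>))) 0 < \<delta>)"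
    proof (rule eventually_prob_mono)
      fix n \<omega> assume "\<bar>Y n \<omega>\<bar> \<le> B \<and> \<bar>X n \<omega>\<bar> < \<delta> / B"
      then have "\<bar>X n \<omega>\<bar> * \<bar>Y n \<omega>\<bar> \<le> \<bar>X n \<omega>\<bar> * B" "\<bar>X n \<omega>\<bar> * B < \<delta>"
        using \<open>B > 0\<close> by (auto intro: mult_left_mono simp: pos_less_divide_eq)
      then show "dist (X (fst (n, \<omega>)) (snd (n, \<omega>)) * Y (fst (n, \<omega>)) (snd (n, \<omega>))) 0 < \<delta>"
        by (simp add: abs_mult)
    qed
  qed
qed

end

section \<open>A triangular central limit theorem\<close>

lemma norm_iexp_diff_le: "norm (iexp a - iexp b) \<le> \<bar>a - b\<bar>"
proof -
  have "iexp a - iexp b = iexp b * (iexp (a - b) - 1)"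
    by (simp add: algebra_simps exp_add[symmetric])
  moreover have "norm (iexp (a - b) - 1) \<le> \<bar>a - b\<bar>"
    using iexp_approx1[of "a - b" 0] by simp
  ultimately show ?thesis by (simp add: norm_mult)
qed

text \<open>The upper half inverts \<open>1 + x + q \<le> exp x\<close> with
  \<open>q = x\<^sup>2 / 2\<close>, using
  \<open>(1 + x + q) * (1 - x + q) = 1 + q\<^sup>2 \<ge> 1\<close>.\<close>

lemma exp_minus_approx:
  fixes x :: real
  assumes "x \<ge> 0"
  shows "\<bar>exp (- x) - (1 - x)\<bar> \<le> x\<^sup>2 / 2"
proof -
  define q where "q = x\<^sup>2 / 2"
  have "(1 + x + q) * (1 - x + q) = 1 + q\<^sup>2" unfolding q_def by (simp add: power2_eq_square algebra_simps)
  moreover have "0 < 1 + x + q" using assms unfolding q_def by (simp add: add_pos_nonneg)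
  ultimately have "1 / (1 + x + q) \<le> 1 - x + q" by (simp add: pos_divide_le_eq mult.commute)
  moreover have "exp (- x) \<le> 1 / (1 + x + q)"
    using exp_lower_Taylor_quadratic[OF assms] \<open>0 < 1 + x + q\<close>
    unfolding q_def by (simp add: exp_minus inverse_eq_divide frac_le)
  moreover have "1 - x \<le> exp (- x)" using exp_ge_add_one_self[of "- x"] by simp
  ultimately show ?thesis unfolding q_def by auto
qed

context prob_space
begin

text \<open>A factor by factor comparison with the Gaussian of the same variance:
  \<open>lyap\<close> pays for the Taylor remainder of the characteristic function and
  \<open>negl\<close> for replacing \<open>1 - t\<^sup>2 * s / 2\<close> by an exponential. Stopping
  at characteristic functions leaves the case \<open>v = 0\<close> unexceptional and lets
  perturbations be added before the continuity theorem is used.\<close>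

theorem Lyapunov_CLT_char:
  fixes \<xi> :: "nat \<Rightarrow> 'i \<Rightarrow> 'a \<Rightarrow> real"
  assumes indep: "\<And>n. indep_vars (\<lambda>_. borel) (\<xi> n) (I n)"
    and fin: "\<And>n. finite (I n)"
    and int2: "\<And>n i. i \<in> I n \<Longrightarrow> integrable M (\<lambda>\<omega>. (\<xi> n i \<omega>)\<^sup>2)"
    and int3: "\<And>n i. i \<in> I n \<Longrightarrow> integrable M (\<lambda>\<omega>. \<bar>\<xi> n i \<omega>\<bar> ^ 3)"
    and mean: "\<And>n i. i \<in> I n \<Longrightarrow> expectation (\<xi> n i) = 0"
    and var: "(\<lambda>n. \<Sum>i\<in>I n. expectation (\<lambda>\<omega>. (\<xi> n i \<omega>)\<^sup>2)) \<longlonglongrightarrow> v"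
    and negl: "(\<lambda>n. \<Sum>i\<in>I n. (expectation (\<lambda>\<omega>. (\<xi> n i \<omega>)\<^sup>2))\<^sup>2) \<longlonglongrightarrow> 0"
    and lyap: "(\<lambda>n. \<Sum>i\<in>I n. expectation (\<lambda>\<omega>. \<bar>\<xi> n i \<omega>\<bar> ^ 3)) \<longlonglongrightarrow> 0"
  shows "(\<lambda>n. char (distr M borel (\<lambda>\<omega>. \<Sum>i\<in>I n. \<xi> n i \<omega>)) t) \<longlonglongrightarrow> of_real (exp (- (t\<^sup>2 * v / 2)))"
proof -
  define s where "s n i = expectation (\<lambda>\<omega>. (\<xi> n i \<omega>)\<^sup>2)" for n i
  define h where "h n i = expectation (\<lambda>\<omega>. \<bar>\<xi> n i \<omega>\<bar> ^ 3)" for n i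
  define \<phi> where "\<phi> n i = char (distr M borel (\<xi> n i)) t" for n i
  have rv: "\<xi> n i \<in> borel_measurable M" if "i \<in> I n" for n i
    using indep[of n] that unfolding indep_vars_def2 by blast
  have s_nonneg: "s n i \<ge> 0" for n i unfolding s_def by simp
  have approx: "norm (\<phi> n i - of_real (exp (- (t\<^sup>2 * s n i / 2)))) \<le> \<bar>t\<bar> ^ 3 / 6 * h n i + t ^ 4 / 8 * (s n i)\<^sup>2"
    if i: "i \<in> I n" for n i
  proof -
    have int1: "integrable M (\<xi> n i)"
      by (rule square_integrable_imp_integrable[OF rv[OF i] int2[OF i]])
    have "norm (\<phi> n i - (1 - t\<^sup>2 * s n i / 2)) \<le>
        (t\<^sup>2 / 6) * expectation (\<lambda>x. min (6 * (\<xi> n i x)\<^sup>2) (\<bar>t\<bar> * \<bar>\<xi> n i x\<bar>^3))"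
      unfolding \<phi>_def
      by (rule char_approx3'[OF rv[OF i] int1 int2[OF i] mean[OF i] _ refl]) (simp add: s_def mean[OF i])
    \<comment> \<open>The minimum is bounded by its cubic branch alone; this is where the third
      moment comes in.\<close>
    also have "\<dots> \<le> (t\<^sup>2 / 6) * expectation (\<lambda>x. \<bar>t\<bar> * \<bar>\<xi> n i x\<bar>^3)"
      by (intro mult_left_mono integral_mono integrable_min integrable_mult_right int2[OF i] int3[OF i]) auto
    also have "\<dots> = \<bar>t\<bar> ^ 3 / 6 * h n i"
      by (simp add: h_def power3_eq_cube power2_eq_square)
    finally have 1: "norm (\<phi> n i - of_real (1 - t\<^sup>2 * s n i / 2)) \<le> \<bar>t\<bar> ^ 3 / 6 * h n i" by simp
    have "\<bar>exp (- (t\<^sup>2 * s n i / 2)) - (1 - t\<^sup>2 * s n i / 2)\<bar> \<le> (t\<^sup>2 * s n i / 2)\<^sup>2 / 2"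
      using s_nonneg by (intro exp_minus_approx) auto
    also have "\<dots> = t ^ 4 / 8 * (s n i)\<^sup>2" by (simp add: power2_eq_square eval_nat_numeral)
    finally have "norm (complex_of_real (1 - t\<^sup>2 * s n i / 2) - of_real (exp (- (t\<^sup>2 * s n i / 2)))) \<le> t ^ 4 / 8 * (s n i)\<^sup>2"
      unfolding of_real_diff[symmetric] norm_of_real by (simp add: abs_minus_commute)
    with 1 show ?thesis by (rule norm_diff_triangle_le)
  qed
  have "norm (char (distr M borel (\<lambda>\<omega>. \<Sum>i\<in>I n. \<xi> n i \<omega>)) t - of_real (exp (- (t\<^sup>2 * (\<Sum>i\<in>I n. s n i) / 2))))
      \<le> \<bar>t\<bar> ^ 3 / 6 * (\<Sum>i\<in>I n. h n i) + t ^ 4 / 8 * (\<Sum>i\<in>I n. (s n i)\<^sup>2)" (is "?L n \<le> ?B n") for n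
  proof -
    have "char (distr M borel (\<lambda>\<omega>. \<Sum>i\<in>I n. \<xi> n i \<omega>)) t = (\<Prod>i\<in>I n. \<phi> n i)"
      unfolding \<phi>_def by (rule char_distr_sum[OF indep])
    moreover have "complex_of_real (exp (- (t\<^sup>2 * (\<Sum>i\<in>I n. s n i) / 2))) = (\<Prod>i\<in>I n. of_real (exp (- (t\<^sup>2 * s n i / 2))))"
      unfolding of_real_prod[symmetric] exp_sum[OF fin, symmetric]
      by (simp add: sum_negf sum_divide_distrib sum_distrib_left)
    moreover have "norm (\<phi> n i) \<le> 1" if "i \<in> I n" for i
      unfolding \<phi>_def using that
      by (intro real_distribution.cmod_char_le_1 real_distribution_distr rv)
    moreover have "norm (complex_of_real (exp (- (t\<^sup>2 * s n i / 2)))) \<le> 1" for i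
      using s_nonneg by (simp del: of_real_exp)
    \<comment> \<open>For factors in the closed unit disc, the difference of two products is at most
      the sum of the differences of the factors.\<close>
    ultimately have "norm (char (distr M borel (\<lambda>\<omega>. \<Sum>i\<in>I n. \<xi> n i \<omega>)) t - of_real (exp (- (t\<^sup>2 * (\<Sum>i\<in>I n. s n i) / 2))))
      \<le> (\<Sum>i\<in>I n. norm (\<phi> n i - of_real (exp (- (t\<^sup>2 * s n i / 2)))))"
      by (simp only: norm_prod_diff)
    also have "\<dots> \<le> (\<Sum>i\<in>I n. \<bar>t\<bar> ^ 3 / 6 * h n i + t ^ 4 / 8 * (s n i)\<^sup>2)"
      by (intro sum_mono approx)
    finally show ?thesis by (simp add: sum.distrib sum_distrib_left)
  qed
  then have "\<forall>\<^sub>F n in sequentially. ?L n \<le> ?B n" by (rule always_eventually[OF allI])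
  moreover have "?B \<longlonglongrightarrow> \<bar>t\<bar> ^ 3 / 6 * 0 + t ^ 4 / 8 * 0"
    using negl lyap unfolding h_def s_def by (intro tendsto_intros)
  then have "?B \<longlonglongrightarrow> 0" by simp
  ultimately have "(\<lambda>n. char (distr M borel (\<lambda>\<omega>. \<Sum>i\<in>I n. \<xi> n i \<omega>)) t - of_real (exp (- (t\<^sup>2 * (\<Sum>i\<in>I n. s n i) / 2)))) \<longlonglongrightarrow> 0"
    by (rule Lim_null_comparison)
  moreover have "(\<lambda>n. complex_of_real (exp (- (t\<^sup>2 * (\<Sum>i\<in>I n. s n i) / 2)))) \<longlonglongrightarrow> of_real (exp (- (t\<^sup>2 * v / 2)))"
    using var unfolding s_def by (intro tendsto_intros) auto
  ultimately show ?thesis by (rule Lim_transform[rotated])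
qed

lemma real_distribution_normal_law: "real_distribution (normal_law \<mu> v)"
proof -
  interpret N: real_distribution std_normal_distribution by (rule real_dist_normal_dist)
  show ?thesis unfolding normal_law_def by (intro N.real_distribution_distr) simp
qed

lemma char_normal_law:
  assumes "v \<ge> 0"
  shows "char (normal_law \<mu> v) t = iexp (t * \<mu>) * of_real (exp (- (t\<^sup>2 * v / 2)))"
proof -
  have "char (normal_law \<mu> v) t = (CLINT z|std_normal_distribution. iexp (t * \<mu>) * iexp (t * sqrt v * z))"
    unfolding char_def normal_law_def
    by (subst integral_distr) (auto simp: exp_add[symmetric] algebra_simps)
  also have "\<dots> = iexp (t * \<mu>) * char std_normal_distribution (t * sqrt v)"
    unfolding char_def by simp
  also have "\<dots> = iexp (t * \<mu>) * of_real (exp (- (t\<^sup>2 * v / 2)))"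
    using assms by (simp add: char_std_normal_distribution power_mult_distrib)
  finally show ?thesis .
qed

text \<open>The characteristic functions of asymptotically equivalent sequences share their limits,
  so Slutsky's lemma is absorbed into the continuity theorem.\<close>

lemma weak_conv_normal_lawI:
  assumes X [measurable]: "\<And>n. X n \<in> borel_measurable M"
    and S [measurable]: "\<And>n. S n \<in> borel_measurable M"
    and char_S: "\<And>t. (\<lambda>n. char (distr M borel (S n)) t) \<longlonglongrightarrow> of_real (exp (- (t\<^sup>2 * v / 2)))"
    and diff: "prob_lim M (\<lambda>n \<omega>. X n \<omega> - S n \<omega>) \<mu>"
    and "v \<ge> 0"
  shows "conv_in_distr M X (normal_law \<mu> v)"
  unfolding conv_in_distr_def
proof (rule levy_continuity)
  show "real_distribution (distr M borel (X n))" for n by (simp add: real_distribution_distr)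
  show "real_distribution (normal_law \<mu> v)" by (rule real_distribution_normal_law)
  fix t :: real
  define D where "D n \<omega> = X n \<omega> - (\<mu> + S n \<omega>)" for n \<omega>
  have [measurable]: "D n \<in> borel_measurable M" for n unfolding D_def by measurable
  have D0: "prob_lim M D 0"
    unfolding D_def using tendsto_diff[OF diff tendsto_const[of \<mu>]] by (simp add: algebra_simps)
  \<comment> \<open>Where \<open>\<bar>D\<bar> > \<delta>\<close>, two numbers of modulus 1 differ
    by at most 2; elsewhere the Lipschitz bound for \<open>iexp\<close> gives
    \<open>\<bar>t\<bar> * \<delta>\<close>.\<close>
  have est: "norm (char (distr M borel (X n)) t - iexp (t * \<mu>) * char (distr M borel (S n)) t)
      \<le> \<bar>t\<bar> * \<delta> + 2 * prob {\<omega> \<in> space M. \<bar>D n \<omega>\<bar> > \<delta>}" if "\<delta> > 0" for \<delta> n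
  proof -
    have ind: "integrable M (\<lambda>\<omega>. 2 * indicat_real {\<omega> \<in> space M. \<bar>D n \<omega>\<bar> > \<delta>} \<omega>)"
      by (intro integrable_mult_right integrable_real_indicator) (auto simp: less_top[symmetric])
    have "char (distr M borel (X n)) t - iexp (t * \<mu>) * char (distr M borel (S n)) t
        = (CLINT \<omega>|M. iexp (t * X n \<omega>)) - (CLINT \<omega>|M. iexp (t * (\<mu> + S n \<omega>)))"
      unfolding char_def
      by (simp add: integral_distr distrib_left exp_add flip: integral_mult_right_zero)
    also have "\<dots> = (CLINT \<omega>|M. iexp (t * X n \<omega>) - iexp (t * (\<mu> + S n \<omega>)))"
      by (subst Bochner_Integration.integral_diff) (auto intro!: integrable_iexp simp del: of_real_mult of_real_add)
    also have "norm \<dots> \<le> (LINT \<omega>|M. norm (iexp (t * X n \<omega>) - iexp (t * (\<mu> + S n \<omega>))))"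
      by (rule integral_norm_bound)
    also have "\<dots> \<le> (LINT \<omega>|M. \<bar>t\<bar> * \<delta> + 2 * indicat_real {\<omega> \<in> space M. \<bar>D n \<omega>\<bar> > \<delta>} \<omega>)"
    proof (rule integral_mono)
      show "integrable M (\<lambda>\<omega>. norm (iexp (t * X n \<omega>) - iexp (t * (\<mu> + S n \<omega>))))"
        by (intro integrable_norm Bochner_Integration.integrable_diff integrable_iexp) auto
      fix \<omega> assume \<omega>: "\<omega> \<in> space M"
      show "norm (iexp (t * X n \<omega>) - iexp (t * (\<mu> + S n \<omega>))) \<le> \<bar>t\<bar> * \<delta> + 2 * indicat_real {\<omega> \<in> space M. \<bar>D n \<omega>\<bar> > \<delta>} \<omega>"
      proof (cases "\<bar>D n \<omega>\<bar> > \<delta>")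
        case True
        have "norm (iexp (t * X n \<omega>) - iexp (t * (\<mu> + S n \<omega>))) \<le> 1 + 1"
          by (rule order_trans[OF norm_triangle_ineq4]) simp
        also have "\<dots> \<le> \<bar>t\<bar> * \<delta> + 2 * indicat_real {\<omega> \<in> space M. \<bar>D n \<omega>\<bar> > \<delta>} \<omega>"
          using True \<omega> \<open>\<delta> > 0\<close> by simp
        finally show ?thesis .
      next
        case False
        have "norm (iexp (t * X n \<omega>) - iexp (t * (\<mu> + S n \<omega>))) \<le> \<bar>t * X n \<omega> - t * (\<mu> + S n \<omega>)\<bar>"
          by (rule norm_iexp_diff_le)
        also have "\<dots> = \<bar>t\<bar> * \<bar>D n \<omega>\<bar>" unfolding D_def right_diff_distrib[symmetric] abs_mult ..
        also have "\<dots> \<le> \<bar>t\<bar> * \<delta>" using False by (intro mult_left_mono) auto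
        finally show ?thesis using False by simp
      qed
    qed (intro Bochner_Integration.integrable_add integrable_const ind)
    also have "\<dots> = \<bar>t\<bar> * \<delta> + 2 * prob {\<omega> \<in> space M. \<bar>D n \<omega>\<bar> > \<delta>}"
      by (subst Bochner_Integration.integral_add[OF integrable_const ind]) (simp add: prob_space)
    finally show ?thesis .
  qed
  have "(\<lambda>n. char (distr M borel (X n)) t - iexp (t * \<mu>) * char (distr M borel (S n)) t) \<longlonglongrightarrow> 0"
  proof (rule tendstoI)
    fix \<eta> :: real assume "\<eta> > 0"
    \<comment> \<open>The \<open>+ 1\<close> covers \<open>t = 0\<close>. Half of
      \<open>\<eta>\<close> goes to the Lipschitz part; a probability below
      \<open>\<eta> / 4\<close>, counted twice, stays strictly below the other half.\<close>
    define \<delta> where "\<delta> = \<eta> / (2 * (\<bar>t\<bar> + 1))"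
    have "\<delta> > 0" unfolding \<delta>_def using \<open>\<eta> > 0\<close> by (intro divide_pos_pos) auto
    have "\<bar>t\<bar> * \<delta> \<le> (\<bar>t\<bar> + 1) * \<delta>" using \<open>\<delta> > 0\<close> by simp
    also have "\<dots> = \<eta> / 2" unfolding \<delta>_def by (simp add: field_simps add_nonneg_eq_0_iff)
    finally have t: "\<bar>t\<bar> * \<delta> \<le> \<eta> / 2" .
    have "small_o_prob M D" using D0 by (subst (asm) prob_lim_iff_small_o_prob) auto
    then have "(\<lambda>n. prob {\<omega> \<in> space M. \<bar>D n \<omega>\<bar> > \<delta>}) \<longlonglongrightarrow> 0"
      using \<open>\<delta> > 0\<close> unfolding small_o_prob_def by blast
    then have "\<forall>\<^sub>F n in sequentially. prob {\<omega> \<in> space M. \<bar>D n \<omega>\<bar> > \<delta>} < \<eta> / 4"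
      using \<open>\<eta> > 0\<close> by (intro order_tendstoD) auto
    then show "\<forall>\<^sub>F n in sequentially. dist (char (distr M borel (X n)) t - iexp (t * \<mu>) * char (distr M borel (S n)) t) 0 < \<eta>"
    proof eventually_elim
      case (elim n)
      with est[OF \<open>\<delta> > 0\<close>, of n] t show ?case by (simp add: dist_norm)
    qed
  qed
  moreover have "(\<lambda>n. iexp (t * \<mu>) * char (distr M borel (S n)) t) \<longlonglongrightarrow> char (normal_law \<mu> v) t"
    unfolding char_normal_law[OF \<open>v \<ge> 0\<close>] by (intro tendsto_mult tendsto_const char_S)
  ultimately show "(\<lambda>n. char (distr M borel (X n)) t) \<longlonglongrightarrow> char (normal_law \<mu> v) t"
    by (rule Lim_transform[rotated])
qed

end

section \<open>Second-order regular variation\<close>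

text \<open>Dominated convergence for indicators: pointwise convergence, with no uniformity, still
  makes the bad set small in measure. This plays the part of Egorov's theorem for a continuous
  parameter.\<close>

lemma LBINT_indicator_at_top_zero:
  fixes B :: "real \<Rightarrow> real set"
  assumes [measurable]: "\<And>s. B s \<in> sets borel"
    and "\<And>s. B s \<subseteq> {a..b}"
    and "\<And>v. \<forall>\<^sub>F s in at_top. v \<notin> B s"
  shows "((\<lambda>s. measure lborel (B s)) \<longlongrightarrow> 0) at_top"
proof -
  have "((\<lambda>s. LINT v|lborel. indicat_real (B s) v) \<longlongrightarrow> (LINT v|(lborel :: real measure). 0)) at_top"
  proof (rule integral_dominated_convergence_at_top[where w = "indicat_real {a..b}"
        and s = "\<lambda>s v. indicat_real (B s) v" and f = "\<lambda>_. 0"])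
    show "\<forall>\<^sub>F s in at_top. AE v in lborel. norm (indicat_real (B s) v) \<le> indicat_real {a..b} v"
    proof (intro always_eventually allI AE_I2)
      show "norm (indicat_real (B s) v) \<le> indicat_real {a..b} v" for s v
        using assms(2)[of s] by (cases "v \<in> B s") auto
    qed
    show "AE v in lborel. ((\<lambda>s. indicat_real (B s) v) \<longlongrightarrow> 0) at_top"
    proof (rule AE_I2, rule tendsto_eventually)
      show "\<forall>\<^sub>F s in at_top. indicat_real (B s) v = 0" for v
        using assms(3)[of v] by eventually_elim simp
    qed
  qed (simp_all add: integrable_real_indicator emeasure_lborel_Icc_eq)
  then show ?thesis by simp
qed

text \<open>Writing an increment over \<open>u\<close> as the difference of the increments over \<open>u + w\<close> from \<open>s\<close> and
  over \<open>w\<close> from \<open>s + u\<close>, both are controlled for a common \<open>w\<close> outside two sets of small measure.\<close>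

lemma increments_uniform_limit:
  fixes g \<alpha> H :: "real \<Rightarrow> real"
  assumes [measurable]: "g \<in> borel_measurable borel"
    and H: "continuous_on UNIV H" "\<And>u w. H (u + w) = H u + exp (\<rho> * u) * H w"
    and lim: "\<And>u. ((\<lambda>s. (g (s + u) - g s) / \<alpha> s) \<longlongrightarrow> H u) at_top"
    and nonzero: "\<forall>\<^sub>F s in at_top. \<alpha> s \<noteq> 0"
    and reg: "uniform_limit {-1..1} (\<lambda>s u. \<alpha> (s + u) / \<alpha> s) (\<lambda>u. exp (\<rho> * u)) at_top"
  shows "uniform_limit {-1..1} (\<lambda>s u. (g (s + u) - g s) / \<alpha> s) H at_top"
proof (rule uniform_limitI)
  fix \<eta> :: real assume "\<eta> > 0"
  have [measurable]: "H \<in> borel_measurable borel" using H(1) by (rule borel_measurable_continuous_onI)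
  have "compact (H ` {0..1})"
    by (intro compact_continuous_image continuous_on_subset[OF H(1)]) auto
  then obtain h where h: "\<And>w. w \<in> {0..1} \<Longrightarrow> \<bar>H w\<bar> \<le> h"
    using compact_imp_bounded bounded_iff by (metis image_eqI real_norm_def)
  have "h \<ge> 0" using h[of 0] by simp
  \<comment> \<open>Collects the final estimate: 1 from the first increment,
    \<open>exp \<bar>\<rho>\<bar> + 1\<close> from the size of the factor \<open>a\<close>, and
    \<open>h\<close> from the error in \<open>a\<close>. The cap \<open>\<epsilon> \<le> 1\<close>
    is what bounds \<open>\<bar>a\<bar>\<close> by
    \<open>exp \<bar>\<rho>\<bar> + 1\<close>.\<close>
  define K where "K = 2 + exp \<bar>\<rho>\<bar> + h"
  have "K > 0" unfolding K_def using \<open>h \<ge> 0\<close> by (simp add: add_pos_nonneg)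
  define \<epsilon> where "\<epsilon> = min 1 (\<eta> / (2 * K))"
  have "\<epsilon> > 0" "\<epsilon> \<le> 1" unfolding \<epsilon>_def using \<open>\<eta> > 0\<close> \<open>K > 0\<close> by auto
  have "\<epsilon> * K < \<eta>"
  proof -
    have "\<epsilon> * K \<le> \<eta> / (2 * K) * K" unfolding \<epsilon>_def using \<open>K > 0\<close> by (intro mult_right_mono) auto
    then show ?thesis using \<open>K > 0\<close> \<open>\<eta> > 0\<close> by simp
  qed
  define \<phi> where "\<phi> s v = (g (s + v) - g s) / \<alpha> s" for s v
  \<comment> \<open>The window contains both \<open>w\<close> in \<open>{0..1}\<close> and every
    \<open>u + w\<close> with \<open>u\<close> in \<open>{-1..1}\<close>.\<close>
  define B where "B s = {v \<in> {-1..2}. \<bar>\<phi> s v - H v\<bar> \<ge> \<epsilon>}" for s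
  have Bm [measurable]: "B s \<in> sets borel" for s unfolding B_def \<phi>_def by measurable
  have "((\<lambda>s. measure lborel (B s)) \<longlongrightarrow> 0) at_top"
  proof (rule LBINT_indicator_at_top_zero)
    show "B s \<subseteq> {-1..2}" for s unfolding B_def by auto
    show "\<forall>\<^sub>F s in at_top. v \<notin> B s" for v
      using tendstoD[OF lim[of v] \<open>\<epsilon> > 0\<close>] unfolding B_def \<phi>_def
      by eventually_elim (auto simp: dist_real_def)
  qed simp
  \<comment> \<open>Two sets of measure below 1/3 cannot cover the unit interval from which
    \<open>w\<close> is drawn.\<close>
  then have "\<forall>\<^sub>F s in at_top. measure lborel (B s) < 1/3" by (rule order_tendstoD) simp
  moreover have "\<forall>\<^sub>F s in at_top. \<forall>u\<in>{-1..1}. \<bar>\<alpha> (s + u) / \<alpha> s - exp (\<rho> * u)\<bar> < \<epsilon>"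
    using uniform_limitD[OF reg \<open>\<epsilon> > 0\<close>] by (simp add: dist_real_def)
  ultimately have "\<forall>\<^sub>F s in at_top. measure lborel (B s) < 1/3 \<and> \<alpha> s \<noteq> 0 \<and>
      (\<forall>u\<in>{-1..1}. \<bar>\<alpha> (s + u) / \<alpha> s - exp (\<rho> * u)\<bar> < \<epsilon>)"
    using nonzero by eventually_elim blast
  then obtain s0 where s0: "\<And>s. s \<ge> s0 \<Longrightarrow> measure lborel (B s) < 1/3 \<and> \<alpha> s \<noteq> 0 \<and>
      (\<forall>u\<in>{-1..1}. \<bar>\<alpha> (s + u) / \<alpha> s - exp (\<rho> * u)\<bar> < \<epsilon>)"
    unfolding eventually_at_top_linorder by blast
  \<comment> \<open>One unit beyond \<open>s0\<close>, so that \<open>s + u\<close> is also at least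
    \<open>s0\<close> and both bad sets are small.\<close>
  have "\<bar>\<phi> s u - H u\<bar> < \<eta>" if s: "s \<ge> s0 + 1" and u: "u \<in> {-1..1}" for s u
  proof -
    have fin: "B t \<in> fmeasurable lborel" for t
    proof (rule fmeasurableI2)
      show "{-1..2} \<in> fmeasurable (lborel :: real measure)" by (auto simp: fmeasurable_def)
      show "B t \<subseteq> {-1..2}" unfolding B_def by blast
    qed simp
    have shift: "(\<lambda>w. u + w) -` B s \<in> fmeasurable lborel" "measure lborel ((\<lambda>w. u + w) -` B s) = measure lborel (B s)"
    proof -
      have e: "emeasure lborel (B s) = emeasure lborel ((\<lambda>w. u + w) -` B s)"
        by (subst lborel_distr_plus[of u, symmetric]) (simp add: emeasure_distr)
      then show "measure lborel ((\<lambda>w. u + w) -` B s) = measure lborel (B s)" by (simp add: measure_def)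
      show "(\<lambda>w. u + w) -` B s \<in> fmeasurable lborel"
        using fin[of s] e measurable_sets_borel[of "\<lambda>w. u + w" borel "B s"] by (simp add: fmeasurable_def)
    qed
    have "measure lborel ((\<lambda>w. u + w) -` B s \<union> B (s + u)) \<le> measure lborel (B s) + measure lborel (B (s + u))"
      using measure_Un_le[of "(\<lambda>w. u + w) -` B s" lborel "B (s + u)"] shift fin by (auto simp: fmeasurable_def)
    also have "\<dots> < 1" using s0[of s] s0[of "s + u"] s u by auto
    finally have "\<not> {0..1} \<subseteq> (\<lambda>w. u + w) -` B s \<union> B (s + u)"
      using measure_mono_fmeasurable[of "{0..1::real}" "(\<lambda>w. u + w) -` B s \<union> B (s + u)" lborel]
        shift(1) fin by (auto intro: fmeasurable.Un)
    then obtain w where w: "w \<in> {0..1}" "u + w \<notin> B s" "w \<notin> B (s + u)" unfolding vimage_def by blast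
    define a where "a = \<alpha> (s + u) / \<alpha> s"
    have nz: "\<alpha> s \<noteq> 0" "\<alpha> (s + u) \<noteq> 0" using s0[of s] s0[of "s + u"] s u by auto
    have 1: "\<bar>\<phi> s (u + w) - H (u + w)\<bar> < \<epsilon>" "\<bar>\<phi> (s + u) w - H w\<bar> < \<epsilon>"
      using w u unfolding B_def by auto
    have a: "\<bar>a - exp (\<rho> * u)\<bar> < \<epsilon>" unfolding a_def using s0[of s] s u by auto
    have "\<bar>\<rho> * u\<bar> \<le> \<bar>\<rho>\<bar> * 1" unfolding abs_mult using u by (intro mult_left_mono) auto
    then have "exp (\<rho> * u) \<le> exp \<bar>\<rho>\<bar>" using abs_ge_self[of "\<rho> * u"] by simp
    with a have a': "\<bar>a\<bar> \<le> exp \<bar>\<rho>\<bar> + 1"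
      using abs_triangle_ineq[of "a - exp (\<rho> * u)" "exp (\<rho> * u)"] \<open>\<epsilon> \<le> 1\<close> unfolding abs_exp_cancel diff_add_cancel by linarith
    have "\<phi> s u = \<phi> s (u + w) - a * \<phi> (s + u) w"
      unfolding \<phi>_def a_def using nz by (simp add: field_simps add.assoc)
    then have "\<phi> s u - H u = (\<phi> s (u + w) - H (u + w)) - a * (\<phi> (s + u) w - H w) - (a - exp (\<rho> * u)) * H w"
      unfolding H(2) by (simp add: algebra_simps)
    then have "\<bar>\<phi> s u - H u\<bar> \<le> \<bar>\<phi> s (u + w) - H (u + w)\<bar> + \<bar>a\<bar> * \<bar>\<phi> (s + u) w - H w\<bar> + \<bar>a - exp (\<rho> * u)\<bar> * \<bar>H w\<bar>"
      unfolding abs_mult[symmetric] by linarith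
    also have "\<dots> \<le> \<epsilon> + (exp \<bar>\<rho>\<bar> + 1) * \<epsilon> + \<epsilon> * h"
      using 1 a a' h[OF w(1)] \<open>\<epsilon> > 0\<close> by (intro add_mono mult_mono) auto
    also have "\<dots> = \<epsilon> * K" unfolding K_def by (simp add: algebra_simps)
    also have "\<dots> < \<eta>" by fact
    finally show ?thesis .
  qed
  then show "\<forall>\<^sub>F s in at_top. \<forall>u\<in>{-1..1}. dist ((g (s + u) - g s) / \<alpha> s) (H u) < \<eta>"
    unfolding eventually_at_top_linorder \<phi>_def dist_real_def by blast
qed

text \<open>The integral of \<open>exp (\<rho> * v)\<close> over \<open>v\<close> from 0 to
  \<open>u\<close>. With \<open>x = exp u\<close> it is the familiar
  \<open>(x powr \<rho> - 1) / \<rho>\<close>, and \<open>ln x\<close> for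
  \<open>\<rho> = 0\<close>.\<close>

definition second_order_limit :: "real \<Rightarrow> real \<Rightarrow> real" where
  "second_order_limit \<rho> u = (if \<rho> = 0 then u else (exp (\<rho> * u) - 1) / \<rho>)"

text \<open>The integral is split at \<open>u\<close>. This cocycle identity is what
  \<open>increments_uniform_limit\<close> asks of its limit function.\<close>

lemma second_order_limit_add:
  "second_order_limit \<rho> (u + w) = second_order_limit \<rho> u + exp (\<rho> * u) * second_order_limit \<rho> w"
  by (simp add: second_order_limit_def field_simps exp_add)

lemma second_order_limit_0 [simp]: "second_order_limit \<rho> 0 = 0"
  by (simp add: second_order_limit_def)

lemma second_order_limit_1_neq_0: "second_order_limit \<rho> 1 \<noteq> 0"
  by (simp add: second_order_limit_def)

lemma continuous_on_second_order_limit: "continuous_on X (second_order_limit \<rho>)"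
proof (cases "\<rho> = 0")
  case True
  then show ?thesis by (simp add: second_order_limit_def continuous_on_id)
next
  case False
  then show ?thesis unfolding second_order_limit_def by (auto intro!: continuous_intros)
qed

lemma bounded_second_order_limit: "bounded (second_order_limit \<rho> ` {-1..1})"
  by (intro compact_imp_bounded compact_continuous_image continuous_on_second_order_limit) auto

text \<open>The auxiliary function \<open>A\<close> need not be measurable; it is replaced by a multiple \<open>\<alpha>\<close> of the unit
  increments of \<open>g\<close>, whose regular variation is the case \<open>\<rho> = 0\<close> of the preceding lemma for \<open>ln |\<alpha>|\<close>.\<close>

lemma second_order_increments:
  fixes g A :: "real \<Rightarrow> real"
  assumes [measurable]: "g \<in> borel_measurable borel"
    and lim: "\<And>u. ((\<lambda>s. (g (s + u) - g s) / A s) \<longlongrightarrow> second_order_limit \<rho> u) at_top"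
    and sgn: "\<forall>\<^sub>F s in at_top. sgn (A s) = c"
  shows second_order_uniform_limit:
      "uniform_limit {-1..1} (\<lambda>s u. (g (s + u) - g s) / A s) (second_order_limit \<rho>) at_top"
    and second_order_Potter_bound:
      "\<rho> \<le> 0 \<Longrightarrow> \<exists>C s0. \<forall>s\<ge>s0. \<forall>x\<ge>0. \<bar>g (s + x) - g s\<bar> \<le> C * \<bar>A s\<bar> * exp (x / 4)"
proof -
  let ?H = "second_order_limit \<rho>"
  \<comment> \<open>Normalised by the limit of the unit increment, so that
    \<open>\<alpha> / A\<close> tends to 1.\<close>
  define \<alpha> where "\<alpha> s = (g (s + 1) - g s) / ?H 1" for s
  have [measurable]: "\<alpha> \<in> borel_measurable borel" unfolding \<alpha>_def by measurable
  have shift: "filterlim (\<lambda>s. s + u) at_top at_top" for u :: real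
    by (rule filterlim_tendsto_add_at_top[OF tendsto_const filterlim_ident, of u, simplified add.commute])
  have ratio: "((\<lambda>s. \<alpha> s / A s) \<longlongrightarrow> 1) at_top"
    using tendsto_divide[OF lim[of 1] tendsto_const second_order_limit_1_neq_0[of \<rho>]] second_order_limit_1_neq_0[of \<rho>]
    unfolding \<alpha>_def by (simp add: mult.commute)
  have A0: "\<forall>\<^sub>F s in at_top. A s \<noteq> 0 \<and> \<alpha> s \<noteq> 0 \<and> sgn (\<alpha> s) = c \<and> \<bar>\<alpha> s\<bar> \<le> 2 * \<bar>A s\<bar>"
  proof -
    have "\<forall>\<^sub>F s in at_top. 1/2 < \<alpha> s / A s" "\<forall>\<^sub>F s in at_top. \<alpha> s / A s < 2"
      by (rule order_tendstoD[OF ratio], simp)+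
    then show ?thesis using sgn
  proof eventually_elim
    case (elim s)
    then have "A s \<noteq> 0" by auto
    then show ?case using elim by (cases "A s > 0") (auto simp: field_simps sgn_if split: if_splits)
  qed
  qed
  have lim\<alpha>: "((\<lambda>s. (g (s + u) - g s) / \<alpha> s) \<longlongrightarrow> ?H u) at_top" for u
  proof (rule Lim_transform_eventually)
    show "((\<lambda>s. ((g (s + u) - g s) / A s) / (\<alpha> s / A s)) \<longlongrightarrow> ?H u) at_top"
      using tendsto_divide[OF lim[of u] ratio] by simp
    show "\<forall>\<^sub>F s in at_top. ((g (s + u) - g s) / A s) / (\<alpha> s / A s) = (g (s + u) - g s) / \<alpha> s"
      using A0 by eventually_elim simp
  qed
  \<comment> \<open>The unit increment from \<open>s + u\<close> is the increment over
    \<open>u + 1\<close> minus the one over \<open>u\<close>, both from \<open>s\<close>; the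
    cocycle identity evaluates the limit.\<close>
  have reg: "((\<lambda>s. \<alpha> (s + u) / \<alpha> s) \<longlongrightarrow> exp (\<rho> * u)) at_top" for u
  proof -
    have "((\<lambda>s. ((g (s + (u + 1)) - g s) / \<alpha> s - (g (s + u) - g s) / \<alpha> s) / ?H 1) \<longlongrightarrow> (?H (u + 1) - ?H u) / ?H 1) at_top"
      using second_order_limit_1_neq_0 by (intro tendsto_divide tendsto_diff lim\<alpha> tendsto_const)
    moreover have "(?H (u + 1) - ?H u) / ?H 1 = exp (\<rho> * u)"
      using second_order_limit_1_neq_0[of \<rho>] by (simp add: second_order_limit_add)
    moreover have "((g (s + (u + 1)) - g s) / \<alpha> s - (g (s + u) - g s) / \<alpha> s) / ?H 1 = \<alpha> (s + u) / \<alpha> s" for s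
      unfolding \<alpha>_def[of "s + u"] by (simp add: diff_divide_distrib[symmetric] add.assoc mult.commute)
    ultimately show ?thesis by simp
  qed
  define l where "l s = ln \<bar>\<alpha> s\<bar>" for s
  have [measurable]: "l \<in> borel_measurable borel" unfolding l_def by measurable
  have "((\<lambda>s. (l (s + u) - l s) / 1) \<longlongrightarrow> \<rho> * u) at_top" for u
  proof (rule Lim_transform_eventually)
    show "((\<lambda>s. ln \<bar>\<alpha> (s + u) / \<alpha> s\<bar>) \<longlongrightarrow> \<rho> * u) at_top"
      using tendsto_ln[OF tendsto_rabs[OF reg[of u]]] by simp
    show "\<forall>\<^sub>F s in at_top. ln \<bar>\<alpha> (s + u) / \<alpha> s\<bar> = (l (s + u) - l s) / 1"
      using A0 eventually_compose_filterlim[OF A0 shift[of u]]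
      by eventually_elim (simp add: l_def ln_div abs_divide)
  qed
  then have unif_l: "uniform_limit {-1..1} (\<lambda>s u. (l (s + u) - l s) / 1) (\<lambda>u. \<rho> * u) at_top"
    by (intro increments_uniform_limit[where \<rho> = 0])
      (auto intro!: continuous_intros uniform_limitI simp: algebra_simps)
  have "uniform_limit {-1..1} (\<lambda>s u. exp ((l (s + u) - l s) / 1)) (\<lambda>u. exp (\<rho> * u)) at_top"
  proof (rule uniform_limit_compose_uniformly_continuous_on[OF unif_l])
    \<comment> \<open>The limit \<open>\<rho> * u\<close> is at most
      \<open>\<bar>\<rho>\<bar>\<close> in absolute value, and an error below 1 keeps the increments
      of \<open>l\<close> in this compact interval, where \<open>exp\<close> is uniformly
      continuous.\<close>
    show "uniformly_continuous_on {- \<bar>\<rho>\<bar> - 1..\<bar>\<rho>\<bar> + 1} (exp :: real \<Rightarrow> real)"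
      by (intro compact_uniformly_continuous continuous_intros) auto
    show "\<forall>\<^sub>F s in at_top. \<forall>u\<in>{-1..1}. (l (s + u) - l s) / 1 \<in> {- \<bar>\<rho>\<bar> - 1..\<bar>\<rho>\<bar> + 1}"
      using uniform_limitD[OF unif_l zero_less_one]
    proof eventually_elim
      case (elim s)
      show ?case
      proof
        fix u :: real assume u: "u \<in> {-1..1}"
        have "\<bar>\<rho> * u\<bar> \<le> \<bar>\<rho>\<bar> * 1" unfolding abs_mult using u by (intro mult_left_mono) auto
        moreover have "\<bar>l (s + u) - l s - \<rho> * u\<bar> < 1" using elim u by (simp add: dist_real_def)
        ultimately show "(l (s + u) - l s) / 1 \<in> {- \<bar>\<rho>\<bar> - 1..\<bar>\<rho>\<bar> + 1}"
          unfolding atLeastAtMost_iff div_by_1 mult_1_right by (intro conjI; linarith)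
      qed
    qed
  qed simp
  \<comment> \<open>The constant sign of \<open>\<alpha>\<close> beyond \<open>s0\<close> removes
    the absolute values hidden in \<open>l\<close>.\<close>
  moreover have "\<forall>\<^sub>F s in at_top. \<forall>u\<in>{-1..1}. exp ((l (s + u) - l s) / 1) = \<alpha> (s + u) / \<alpha> s"
  proof -
    obtain s0 where s0: "\<And>s. s \<ge> s0 \<Longrightarrow> \<alpha> s \<noteq> 0 \<and> sgn (\<alpha> s) = c"
      using A0 unfolding eventually_at_top_linorder by blast
    have "exp ((l (s + u) - l s) / 1) = \<alpha> (s + u) / \<alpha> s" if "s \<ge> s0 + 1" "u \<in> {-1..1}" for s u
    proof -
      have *: "\<alpha> s \<noteq> 0" "\<alpha> (s + u) \<noteq> 0" "sgn (\<alpha> s) = sgn (\<alpha> (s + u))"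
        using s0[of s] s0[of "s + u"] that by auto
      then have "exp ((l (s + u) - l s) / 1) = \<bar>\<alpha> (s + u)\<bar> / \<bar>\<alpha> s\<bar>" by (simp add: l_def exp_diff)
      also have "\<dots> = \<alpha> (s + u) / \<alpha> s" using * by (auto simp: sgn_if split: if_splits)
      finally show ?thesis .
    qed
    then show ?thesis unfolding eventually_at_top_linorder by blast
  qed
  ultimately have "uniform_limit {-1..1} (\<lambda>s u. \<alpha> (s + u) / \<alpha> s) (\<lambda>u. exp (\<rho> * u)) at_top"
    by (subst (asm) uniform_limit_cong) auto
  then have unif: "uniform_limit {-1..1} (\<lambda>s u. (g (s + u) - g s) / \<alpha> s) ?H at_top"
    using A0 lim\<alpha> by (intro increments_uniform_limit[where \<rho> = \<rho>])
      (auto intro!: continuous_on_second_order_limit simp: second_order_limit_add elim: eventually_mono)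
  show "uniform_limit {-1..1} (\<lambda>s u. (g (s + u) - g s) / A s) ?H at_top"
  proof -
    have r: "uniform_limit {-1..1::real} (\<lambda>s u. \<alpha> s / A s) (\<lambda>u. 1) at_top"
      by (rule uniform_limitI) (use tendstoD[OF ratio] in simp)
    have "uniform_limit {-1..1} (\<lambda>s u. (g (s + u) - g s) / \<alpha> s * (\<alpha> s / A s)) (\<lambda>u. ?H u * 1) at_top"
      by (rule uniform_lim_mult[OF unif r bounded_second_order_limit]) (auto simp: bounded_iff)
    moreover have "\<forall>\<^sub>F s in at_top. \<forall>u\<in>{-1..1}. (g (s + u) - g s) / \<alpha> s * (\<alpha> s / A s) = (g (s + u) - g s) / A s"
      using A0 by eventually_elim simp
    ultimately show ?thesis by (subst (asm) uniform_limit_cong) auto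
  qed
  assume "\<rho> \<le> 0"
  obtain h where h: "\<And>u. u \<in> {-1..1} \<Longrightarrow> \<bar>?H u\<bar> \<le> h"
    using bounded_second_order_limit unfolding bounded_iff by (metis image_eqI real_norm_def)
  have "h \<ge> 0" using h[of 0] by simp
  define C where "C = h + 1"
  have "C > 0" unfolding C_def using \<open>h \<ge> 0\<close> by simp
  \<comment> \<open>The limit is \<open>exp \<rho> \<le> 1\<close>, so there is room above 1; the
    value \<open>9/8\<close> is fitted to the exponent \<open>1/4\<close> in the induction
    below.\<close>
  have "\<forall>\<^sub>F s in at_top. \<alpha> (s + 1) / \<alpha> s < 9/8"
    using \<open>\<rho> \<le> 0\<close> by (intro order_tendstoD(2)[OF reg]) (rule le_less_trans[of _ 1], auto)
  moreover have "\<forall>\<^sub>F s in at_top. -1 < \<alpha> (s + 1) / \<alpha> s"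
    by (intro order_tendstoD(1)[OF reg]) (rule less_trans[of _ 0], auto)
  moreover have "\<forall>\<^sub>F s in at_top. \<forall>u\<in>{-1..1}. dist ((g (s + u) - g s) / \<alpha> s) (?H u) < 1"
    using uniform_limitD[OF unif zero_less_one] .
  ultimately have "\<forall>\<^sub>F s in at_top. \<bar>\<alpha> s\<bar> \<le> 2 * \<bar>A s\<bar> \<and> \<bar>\<alpha> (s + 1)\<bar> \<le> 9/8 * \<bar>\<alpha> s\<bar> \<and>
      (\<forall>u\<in>{0..1}. \<bar>g (s + u) - g s\<bar> \<le> C * \<bar>\<alpha> s\<bar>)"
    using A0
  proof eventually_elim
    case (elim s)
    have "\<bar>\<alpha> (s + 1) / \<alpha> s\<bar> \<le> 9/8" using elim by auto
    then have "\<bar>\<alpha> (s + 1)\<bar> \<le> 9/8 * \<bar>\<alpha> s\<bar>" using elim by (simp add: abs_divide pos_divide_le_eq)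
    moreover have "\<bar>g (s + u) - g s\<bar> \<le> C * \<bar>\<alpha> s\<bar>" if "u \<in> {0..1}" for u
    proof -
      have "u \<in> {-1..1}" using that by simp
      with elim h[of u] have "\<bar>(g (s + u) - g s) / \<alpha> s\<bar> \<le> C" unfolding C_def dist_real_def by fastforce
      then show ?thesis using elim by (simp add: abs_divide pos_divide_le_eq)
    qed
    ultimately show ?case using elim by blast
  qed
  then obtain s0 where s0: "\<And>s. s \<ge> s0 \<Longrightarrow> \<bar>\<alpha> s\<bar> \<le> 2 * \<bar>A s\<bar>"
    "\<And>s. s \<ge> s0 \<Longrightarrow> \<bar>\<alpha> (s + 1)\<bar> \<le> 9/8 * \<bar>\<alpha> s\<bar>"
    "\<And>s u. s \<ge> s0 \<Longrightarrow> u \<in> {0..1} \<Longrightarrow> \<bar>g (s + u) - g s\<bar> \<le> C * \<bar>\<alpha> s\<bar>"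
    unfolding eventually_at_top_linorder by blast
  have e: "1 \<le> exp (x / 4)" if "x \<ge> 0" for x :: real using that by simp
  \<comment> \<open>Induction on unit steps. With prefactor 8 a step costs
    \<open>8 * (9/8) + 1 * 1 = 8 * (1 + 1/4)\<close>, and \<open>1 + 1/4 \<le> exp (1/4)\<close>
    absorbs it. The rate \<open>1/4\<close> leaves the square of the bound integrable under the
    standard exponential law.\<close>
  have "\<bar>g (s + (real n + u)) - g s\<bar> \<le> 8 * C * \<bar>\<alpha> s\<bar> * exp ((real n + u) / 4)"
    if "s \<ge> s0" "u \<in> {0..1}" for s n u
    using that
  proof (induction n arbitrary: s)
    case 0
    have "\<bar>g (s + u) - g s\<bar> \<le> C * \<bar>\<alpha> s\<bar> * 1" using s0(3)[OF 0] by simp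
    also have "\<dots> \<le> 8 * C * \<bar>\<alpha> s\<bar> * exp (u / 4)"
      using \<open>C > 0\<close> e[of u] 0 by (intro mult_mono) auto
    finally show ?case by simp
  next
    case (Suc n)
    define E where "E = exp ((real n + u) / 4)"
    have "E \<ge> 1" unfolding E_def using Suc by (intro e) auto
    have "\<bar>g (s + (real (Suc n) + u)) - g s\<bar> \<le> \<bar>g (s + 1 + (real n + u)) - g (s + 1)\<bar> + \<bar>g (s + 1) - g s\<bar>"
      by (simp add: algebra_simps)
    also have "\<dots> \<le> 8 * C * \<bar>\<alpha> (s + 1)\<bar> * E + C * \<bar>\<alpha> s\<bar>"
      unfolding E_def using Suc by (intro add_mono s0(3) Suc.IH) auto
    also have "\<dots> \<le> 8 * C * (9/8 * \<bar>\<alpha> s\<bar>) * E + C * \<bar>\<alpha> s\<bar> * E"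
    proof (rule add_mono)
      show "8 * C * \<bar>\<alpha> (s + 1)\<bar> * E \<le> 8 * C * (9/8 * \<bar>\<alpha> s\<bar>) * E"
        using \<open>C > 0\<close> \<open>E \<ge> 1\<close> s0(2)[OF Suc(2)] by (intro mult_right_mono mult_left_mono) auto
      show "C * \<bar>\<alpha> s\<bar> \<le> C * \<bar>\<alpha> s\<bar> * E"
        using \<open>C > 0\<close> mult_left_mono[OF \<open>E \<ge> 1\<close>, of "C * \<bar>\<alpha> s\<bar>"] by simp
    qed
    also have "\<dots> = 8 * C * \<bar>\<alpha> s\<bar> * ((1 + 1/4) * E)" by simp
    also have "\<dots> \<le> 8 * C * \<bar>\<alpha> s\<bar> * (exp (1/4) * E)"
      using \<open>C > 0\<close> \<open>E \<ge> 1\<close> by (intro mult_left_mono mult_right_mono exp_ge_add_one_self) auto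
    also have "exp (1/4) * E = exp ((real (Suc n) + u) / 4)"
      unfolding E_def by (simp add: exp_add[symmetric] field_simps)
    finally show ?case .
  qed
  note bound = this
  have "\<bar>g (s + x) - g s\<bar> \<le> 16 * C * \<bar>A s\<bar> * exp (x / 4)" if s: "s \<ge> s0" and x: "x \<ge> 0" for s x
  proof -
    \<comment> \<open>Integer and fractional part of \<open>x\<close>. The final 16 is the 8 of the
      induction times the 2 from
      \<open>\<bar>\<alpha> s\<bar> \<le> 2 * \<bar>A s\<bar>\<close>.\<close>
    define n where "n = nat \<lfloor>x\<rfloor>"
    have "x = real n + (x - real n)" "x - real n \<in> {0..1}" unfolding n_def using x by auto linarith
    then have "\<bar>g (s + x) - g s\<bar> \<le> 8 * C * \<bar>\<alpha> s\<bar> * exp (x / 4)" using bound[OF s, of "x - real n" n] by simp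
    also have "\<dots> \<le> 8 * C * (2 * \<bar>A s\<bar>) * exp (x / 4)"
      using \<open>C > 0\<close> s0(1)[OF s] by (intro mult_right_mono mult_left_mono) auto
    finally show ?thesis by simp
  qed
  then show "\<exists>C s0. \<forall>s\<ge>s0. \<forall>x\<ge>0. \<bar>g (s + x) - g s\<bar> \<le> C * \<bar>A s\<bar> * exp (x / 4)" by blast
qed

section \<open>Quantiles and the exponential transform\<close>

text \<open>Measures the error of linearising the logarithm relative to \<open>a\<close>: it is
  \<open>y\<close> times the quotient \<open>y / a\<close>, hence negligible when \<open>y\<close>
  tends to 0 and the quotient converges.\<close>

lemma abs_ln_one_plus_div_bound:
  fixes y a :: real
  assumes "\<bar>y\<bar> \<le> 1/2"
  shows "\<bar>ln (1 + y) / a - y / a\<bar> \<le> 2 * \<bar>y\<bar> * \<bar>y / a\<bar>"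
proof -
  have "\<bar>ln (1 + y) / a - y / a\<bar> = \<bar>ln (1 + y) - y\<bar> / \<bar>a\<bar>" by (simp add: diff_divide_distrib[symmetric] abs_divide)
  also have "\<dots> \<le> 2 * y\<^sup>2 / \<bar>a\<bar>"
    using abs_ln_one_plus_x_minus_x_bound[OF assms] by (intro divide_right_mono) auto
  also have "\<dots> = 2 * \<bar>y\<bar> * \<bar>y / a\<bar>" by (simp add: power2_eq_square abs_divide)
  finally show ?thesis .
qed

text \<open>Carries a variable with continuous distribution function to a standard exponential one.
  Where the survival function vanishes, \<open>ln 0 = 0\<close> gives the value 0, which concerns
  only an event of probability 0.\<close>

definition exp_transform :: "'a measure \<Rightarrow> ('a \<Rightarrow> real) \<Rightarrow> real \<Rightarrow> real" where
  "exp_transform M X x = - ln (survival M X x)"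

context prob_space
begin

context
  fixes X :: "'a \<Rightarrow> real"
  assumes X [measurable]: "X \<in> borel_measurable M"
    and cont: "continuous_on UNIV (dist_fun M X)"
begin

interpretation D: real_distribution "distr M borel X" by (rule real_distribution_distr) simp

lemma survival_antimono: "x \<le> y \<Longrightarrow> survival M X y \<le> survival M X x"
  unfolding survival_def dist_fun_def using D.cdf_nondecreasing[of x y] by simp

lemma survival_nonneg: "0 \<le> survival M X x" and survival_le_1: "survival M X x \<le> 1"
  unfolding survival_def dist_fun_def using D.cdf_bounded_prob[of x] D.cdf_nonneg[of x] by auto

lemma continuous_on_survival: "continuous_on A (survival M X)"
  unfolding survival_def using continuous_on_subset[OF cont] by (auto intro!: continuous_intros)

lemma borel_measurable_survival [measurable]: "survival M X \<in> borel_measurable borel"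
  by (intro borel_measurable_continuous_onI continuous_on_survival)

lemma borel_measurable_exp_transform [measurable]: "exp_transform M X \<in> borel_measurable borel"
  unfolding exp_transform_def by measurable

lemma survival_lim_at_bot: "(survival M X \<longlongrightarrow> 1) at_bot"
  unfolding survival_def dist_fun_def using tendsto_diff[OF tendsto_const D.cdf_lim_at_bot, of 1] by simp

lemma survival_lim_at_top: "(survival M X \<longlongrightarrow> 0) at_top"
  unfolding survival_def dist_fun_def using tendsto_diff[OF tendsto_const D.cdf_lim_at_top_prob, of 1] by simp

text \<open>A continuous distribution function has no atoms, so \<open>\<ge>\<close> may replace
  \<open>>\<close>.\<close>

lemma prob_gt_eq_survival: "prob {\<omega> \<in> space M. X \<omega> \<ge> x} = survival M X x"
proof -
  have "isCont (cdf (distr M borel X)) x"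
    using cont unfolding dist_fun_def by (simp add: continuous_on_eq_continuous_at)
  then have "measure (distr M borel X) {x} = 0" by (simp add: D.isCont_cdf)
  then have "prob {\<omega> \<in> space M. X \<omega> = x} = 0"
    by (simp add: measure_distr vimage_def Collect_conj_eq Int_commute)
  moreover have "dist_fun M X x = prob {\<omega> \<in> space M. X \<omega> \<le> x}"
    unfolding dist_fun_def cdf_def by (simp add: measure_distr vimage_def Collect_conj_eq Int_commute)
  moreover have "prob {\<omega> \<in> space M. X \<omega> \<le> x} = prob {\<omega> \<in> space M. X \<omega> < x} + prob {\<omega> \<in> space M. X \<omega> = x}"
    by (subst finite_measure_Union[symmetric]) (auto intro!: arg_cong[where f = prob])
  moreover have "prob {\<omega> \<in> space M. X \<omega> \<ge> x} = 1 - prob {\<omega> \<in> space M. X \<omega> < x}"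
    by (subst prob_compl[symmetric]) (auto intro!: arg_cong[where f = prob])
  ultimately show ?thesis unfolding survival_def by simp
qed

text \<open>By continuity the set under the infimum is closed, so the infimum is attained and the
  set is a half-line starting at the quantile. The choice \<open>t > 1\<close> puts
  \<open>1 / t\<close> strictly between the two limits of the survival function, which makes the set
  nonempty and bounded below.\<close>

lemma survival_le_iff_quantile:
  assumes "t > 1"
  shows "survival M X x \<le> 1 / t \<longleftrightarrow> tail_quantile M X t \<le> x"
    and "survival M X (tail_quantile M X t) = 1 / t"
proof -
  let ?S = "{x. survival M X x \<le> 1 / t}"
  have U: "tail_quantile M X t = Inf ?S"
  proof -
    have "ennreal t \<le> 1 / ennreal (survival M X x) \<longleftrightarrow> survival M X x \<le> 1 / t" for x
    proof (cases "survival M X x = 0")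
      case True
      then show ?thesis using assms by (simp add: divide_ennreal_def)
    next
      case False
      then have "survival M X x > 0" using survival_nonneg[of x] by simp
      then have "1 / ennreal (survival M X x) = ennreal (1 / survival M X x)"
        by (simp add: divide_ennreal flip: ennreal_1)
      with \<open>survival M X x > 0\<close> show ?thesis using assms by (simp add: field_simps)
    qed
    then show ?thesis unfolding tail_quantile_def by simp
  qed
  have "closed ?S" by (intro closed_Collect_le continuous_on_survival continuous_on_const)
  have "\<forall>\<^sub>F x in at_top. survival M X x < 1 / t"
    using survival_lim_at_top assms by (intro order_tendstoD) auto
  then have ne: "?S \<noteq> {}" unfolding eventually_at_top_linorder by (force intro: less_imp_le)
  have "\<forall>\<^sub>F x in at_bot. survival M X x > 1 / t"
    using survival_lim_at_bot assms by (intro order_tendstoD) auto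
  then obtain l where l: "\<And>x. x \<le> l \<Longrightarrow> survival M X x > 1 / t" unfolding eventually_at_bot_linorder by blast
  have bdd: "bdd_below ?S"
  proof (rule bdd_belowI)
    show "l \<le> x" if "x \<in> ?S" for x using l[of x] that by (cases "x \<le> l") auto
  qed
  have "Inf ?S \<in> ?S" using closed_contains_Inf[OF ne bdd \<open>closed ?S\<close>] .
  then show iff: "survival M X x \<le> 1 / t \<longleftrightarrow> tail_quantile M X t \<le> x" for x
    unfolding U using survival_antimono[of "Inf ?S" x] cInf_lower[OF _ bdd, of x] by auto
  have "survival M X (Inf ?S) \<ge> 1 / t"
  \<comment> \<open>If the survival function were strictly below \<open>1 / t\<close> at the
    infimum, left continuity would put smaller points into the set.\<close>
  proof (rule ccontr)
    assume less: "\<not> survival M X (Inf ?S) \<ge> 1 / t"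
    have "isCont (survival M X) (Inf ?S)"
      using continuous_on_survival[of UNIV] by (simp add: continuous_on_eq_continuous_at)
    then have "(survival M X \<longlongrightarrow> survival M X (Inf ?S)) (at_left (Inf ?S))"
      unfolding isCont_def by (rule filterlim_mono) (auto simp: at_within_le_at)
    then have "\<forall>\<^sub>F x in at_left (Inf ?S). survival M X x < 1 / t"
      using less by (intro order_tendstoD) auto
    moreover have "\<forall>\<^sub>F x in at_left (Inf ?S). x < Inf ?S" by (simp add: eventually_at_filter)
    ultimately have "\<forall>\<^sub>F x in at_left (Inf ?S). False"
    proof eventually_elim
      case (elim x)
      then show ?case using iff[of x] unfolding U by linarith
    qed
    then show False by (simp add: trivial_limit_at_left_real)
  qed
  with \<open>Inf ?S \<in> ?S\<close> show "survival M X (tail_quantile M X t) = 1 / t" unfolding U by auto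
qed

text \<open>Uniformity of the survival transform. The quantile equivalence handles
  \<open>\<le>\<close> for \<open>p\<close> inside the unit interval; the end points and the strict
  inequality follow by moving \<open>p\<close> by a small \<open>e\<close> and using
  monotonicity.\<close>

lemma prob_survival_le:
  assumes "0 \<le> p" "p \<le> 1"
  shows "prob {\<omega> \<in> space M. survival M X (X \<omega>) \<le> p} = p" "prob {\<omega> \<in> space M. survival M X (X \<omega>) < p} = p"
proof -
  have open_case: "prob {\<omega> \<in> space M. survival M X (X \<omega>) \<le> p} = p" if "0 < p" "p < 1" for p
    using survival_le_iff_quantile[of "1 / p"] that by (simp add: prob_gt_eq_survival)
  have ge: "p \<le> prob {\<omega> \<in> space M. survival M X (X \<omega>) < p}"
  proof (rule field_le_epsilon)
    fix e :: real assume "e > 0"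
    show "p \<le> prob {\<omega> \<in> space M. survival M X (X \<omega>) < p} + e"
    proof (cases "p \<le> e")
      case True
      then show ?thesis by (simp add: add.commute add_increasing2)
    next
      case False
      then have "p - e = prob {\<omega> \<in> space M. survival M X (X \<omega>) \<le> p - e}"
        using \<open>e > 0\<close> assms by (subst open_case) auto
      also have "\<dots> \<le> prob {\<omega> \<in> space M. survival M X (X \<omega>) < p}"
        using \<open>e > 0\<close> by (intro finite_measure_mono) auto
      finally show ?thesis by simp
    qed
  qed
  have le: "prob {\<omega> \<in> space M. survival M X (X \<omega>) \<le> p} \<le> p"
  proof (rule field_le_epsilon)
    fix e :: real assume "e > 0"
    show "prob {\<omega> \<in> space M. survival M X (X \<omega>) \<le> p} \<le> p + e"
    proof (cases "p + e \<ge> 1")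
      case True
      then show ?thesis using prob_le_1 order_trans by blast
    next
      case False
      have "prob {\<omega> \<in> space M. survival M X (X \<omega>) \<le> p} \<le> prob {\<omega> \<in> space M. survival M X (X \<omega>) \<le> p + e}"
        using \<open>e > 0\<close> by (intro finite_measure_mono) auto
      also have "\<dots> = p + e" using False \<open>e > 0\<close> assms by (intro open_case) auto
      finally show ?thesis .
    qed
  qed
  have "prob {\<omega> \<in> space M. survival M X (X \<omega>) < p} \<le> prob {\<omega> \<in> space M. survival M X (X \<omega>) \<le> p}"
    by (intro finite_measure_mono) auto
  with ge le show "prob {\<omega> \<in> space M. survival M X (X \<omega>) \<le> p} = p" "prob {\<omega> \<in> space M. survival M X (X \<omega>) < p} = p"
    by auto
qed

lemma AE_survival_neq:
  assumes "0 \<le> p" "p \<le> 1"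
  shows "AE \<omega> in M. survival M X (X \<omega>) \<noteq> p"
proof -
  have "prob {\<omega> \<in> space M. survival M X (X \<omega>) \<le> p} =
      prob {\<omega> \<in> space M. survival M X (X \<omega>) < p} + prob {\<omega> \<in> space M. survival M X (X \<omega>) = p}"
    by (subst finite_measure_Union[symmetric]) (auto intro!: arg_cong[where f = prob])
  then have "prob {\<omega> \<in> space M. survival M X (X \<omega>) = p} = 0"
    using prob_survival_le[OF assms] by simp
  then show ?thesis by (subst AE_iff_measurable[OF _ refl]) (auto simp: emeasure_eq_measure)
qed

lemma AE_survival_bounds: "AE \<omega> in M. 0 < survival M X (X \<omega>) \<and> survival M X (X \<omega>) < 1"
proof -
  have "AE \<omega> in M. survival M X (X \<omega>) \<noteq> 0" "AE \<omega> in M. survival M X (X \<omega>) \<noteq> 1"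
    by (rule AE_survival_neq, simp, simp)+
  then show ?thesis
  proof eventually_elim
    case (elim \<omega>)
    then show ?case using survival_nonneg[of "X \<omega>"] survival_le_1[of "X \<omega>"] by auto
  qed
qed

lemma AE_exp_transform_pos: "AE \<omega> in M. 0 < exp_transform M X (X \<omega>)"
  using AE_survival_bounds by eventually_elim (simp add: exp_transform_def)

lemma exp_transform_distributed:
  "distributed M lborel (\<lambda>\<omega>. exp_transform M X (X \<omega>)) (exponential_density 1)"
proof (rule exponential_distributedI)
  fix a :: real assume "a \<ge> 0"
  have "prob {\<omega> \<in> space M. exp_transform M X (X \<omega>) \<le> a} = prob {\<omega> \<in> space M. \<not> survival M X (X \<omega>) < exp (- a)}"
  proof (rule measure_eq_AE)
    show "AE \<omega> in M. \<omega> \<in> {\<omega> \<in> space M. exp_transform M X (X \<omega>) \<le> a} \<longleftrightarrow>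
        \<omega> \<in> {\<omega> \<in> space M. \<not> survival M X (X \<omega>) < exp (- a)}"
      using AE_survival_bounds
    proof eventually_elim
      case (elim \<omega>)
      then have "exp_transform M X (X \<omega>) \<le> a \<longleftrightarrow> \<not> survival M X (X \<omega>) < exp (- a)"
        unfolding exp_transform_def by (metis exp_less_cancel_iff exp_ln linorder_not_less minus_le_iff)
      then show ?case by simp
    qed
  qed auto
  also have "\<dots> = 1 - prob {\<omega> \<in> space M. survival M X (X \<omega>) < exp (- a)}"
    by (rule prob_neg) simp
  also have "\<dots> = 1 - exp (- a)" using \<open>a \<ge> 0\<close> by (subst prob_survival_le) auto
  finally show "emeasure M {\<omega> \<in> space M. exp_transform M X (X \<omega>) \<le> a} = 1 - ennreal (exp (- a * 1))"
    by (simp add: emeasure_eq_measure ennreal_minus flip: ennreal_1)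
qed auto

text \<open>The quantile at the level of \<open>X\<close> can differ from \<open>X\<close> only if
  the survival function is flat to the left of \<open>X\<close>, hence takes its value at
  \<open>X\<close> also at a rational point. Countably many rationals give countably many null
  events.\<close>

lemma AE_quantile_exp_transform: "AE \<omega> in M. X \<omega> = tail_quantile M X (exp (exp_transform M X (X \<omega>)))"
proof -
  have "AE \<omega> in M. \<forall>r\<in>\<rat>. survival M X (X \<omega>) \<noteq> survival M X r"
    using survival_nonneg survival_le_1
    by (subst AE_ball_countable) (auto intro!: AE_survival_neq countable_rat)
  with AE_survival_bounds show ?thesis
  proof eventually_elim
    case (elim \<omega>)
    define t where "t = exp (exp_transform M X (X \<omega>))"
    have t: "t = 1 / survival M X (X \<omega>)" "t > 1"
      unfolding t_def exp_transform_def using elim by (auto simp: exp_minus inverse_eq_divide)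
    then have "tail_quantile M X t \<le> X \<omega>" using survival_le_iff_quantile(1)[of t "X \<omega>"] by simp
    moreover have "\<not> tail_quantile M X t < X \<omega>"
    proof
      assume "tail_quantile M X t < X \<omega>"
      then obtain r where r: "r \<in> \<rat>" "tail_quantile M X t < r" "r < X \<omega>" using Rats_dense_in_real by blast
      then have "survival M X r \<le> survival M X (X \<omega>)" using survival_le_iff_quantile(1)[of t r] t by simp
      moreover have "survival M X (X \<omega>) \<le> survival M X r" using r by (intro survival_antimono) simp
      ultimately show False using elim r by fastforce
    qed
    ultimately show ?case unfolding t_def by simp
  qed
qed

lemma tail_quantile_mono:
  assumes "1 < s" "s \<le> t"
  shows "tail_quantile M X s \<le> tail_quantile M X t"
proof -
  have "survival M X (tail_quantile M X t) = 1 / t" using assms by (intro survival_le_iff_quantile) simp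
  also have "\<dots> \<le> 1 / s" using assms by (intro divide_left_mono) auto
  finally show ?thesis using survival_le_iff_quantile(1)[of s] assms by simp
qed

end

end

section \<open>Order statistics and the Hill estimator\<close>

lemma order_stat_altdef:
  "order_stat x n i = sort (map x [1..<Suc n]) ! (i - 1)" "length (sort (map x [1..<Suc n])) = n"
  by (simp_all add: order_stat_def del: upt_Suc)

lemma card_eq_sort:
  "card {l \<in> {1..n}. P (x l)} = card {p \<in> {..<n}. P (sort (map x [1..<Suc n]) ! p)}"
proof -
  have "card {l \<in> {1..n}. P (x l)} = length (filter P (map x [1..<Suc n]))"
    by (simp add: filter_map distinct_card[symmetric] comp_def conj_commute atLeastLessThanSuc_atLeastAtMost del: upt_Suc)
  also have "\<dots> = length (filter P (sort (map x [1..<Suc n])))"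
    by (metis mset_filter mset_sort size_mset)
  also have "\<dots> = card {p \<in> {..<n}. P (sort (map x [1..<Suc n]) ! p)}"
    by (simp add: length_filter_conv_card del: upt_Suc)
  finally show ?thesis .
qed

lemma sum_eq_sort:
  fixes h :: "real \<Rightarrow> 'b :: comm_monoid_add"
  shows "(\<Sum>l=1..n. h (x l)) = (\<Sum>p<n. h (sort (map x [1..<Suc n]) ! p))"
proof -
  have "(\<Sum>l=1..n. h (x l)) = sum_list (map h (map x [1..<Suc n]))"
    by (simp add: interv_sum_list_conv_sum_set_nat atLeastLessThanSuc_atLeastAtMost comp_def del: upt_Suc)
  also have "\<dots> = sum_list (map h (sort (map x [1..<Suc n])))"
    by (metis mset_map mset_sort sum_mset_sum_list)
  also have "\<dots> = (\<Sum>p<n. h (sort (map x [1..<Suc n]) ! p))"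
    by (simp add: sum_list_sum_nth atLeast0LessThan del: upt_Suc)
  finally show ?thesis .
qed

text \<open>A dictionary between order statistics and counts: it carries monotonicity and
  measurability of order statistics, and turns a crossing of the random threshold into a statement
  about a sum of indicators.\<close>

lemma order_stat_ge_iff:
  assumes "1 \<le> i" "i \<le> n"
  shows "s \<le> order_stat x n i \<longleftrightarrow> n - i + 1 \<le> card {l \<in> {1..n}. s \<le> x l}"
proof -
  define xs where "xs = sort (map x [1..<Suc n])"
  have len: "length xs = n" unfolding xs_def by (simp del: upt_Suc)
  have srt: "p \<le> q \<Longrightarrow> q < n \<Longrightarrow> xs ! p \<le> xs ! q" for p q
    unfolding xs_def by (rule sorted_nth_mono) (auto simp del: upt_Suc)
  have card: "card {l \<in> {1..n}. s \<le> x l} = card {p \<in> {..<n}. s \<le> xs ! p}"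
    unfolding xs_def by (rule card_eq_sort)
  show ?thesis unfolding card order_stat_def xs_def[symmetric]
  proof
    assume "s \<le> xs ! (i - 1)"
    then have "{i - 1..<n} \<subseteq> {p \<in> {..<n}. s \<le> xs ! p}" using srt by fastforce
    from card_mono[OF _ this] show "n - i + 1 \<le> card {p \<in> {..<n}. s \<le> xs ! p}" using assms by simp
  next
    assume le: "n - i + 1 \<le> card {p \<in> {..<n}. s \<le> xs ! p}"
    show "s \<le> xs ! (i - 1)"
    proof (rule ccontr)
      assume "\<not> s \<le> xs ! (i - 1)"
      have "p \<in> {i..<n}" if "p < n" "s \<le> xs ! p" for p
      proof -
        have "\<not> p \<le> i - 1" using srt[of p "i - 1"] that \<open>\<not> s \<le> xs ! (i - 1)\<close> assms by fastforce
        with that show ?thesis by simp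
      qed
      then have "{p \<in> {..<n}. s \<le> xs ! p} \<subseteq> {i..<n}" by blast
      from card_mono[OF _ this] le assms show False by simp
    qed
  qed
qed

lemma order_stat_mono:
  assumes "1 \<le> i" "i \<le> n" and "\<And>l. l \<in> {1..n} \<Longrightarrow> x l \<le> y l"
  shows "order_stat x n i \<le> order_stat y n i"
proof -
  have "n - i + 1 \<le> card {l \<in> {1..n}. order_stat x n i \<le> x l}"
    using order_stat_ge_iff[OF assms(1,2), of "order_stat x n i" x] by simp
  also have "\<dots> \<le> card {l \<in> {1..n}. order_stat x n i \<le> y l}"
    using assms(3) by (intro card_mono) force+
  finally show ?thesis using order_stat_ge_iff[OF assms(1,2)] by blast
qed

lemma order_stat_le:
  assumes "1 \<le> i" "i \<le> i'" "i' \<le> n"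
  shows "order_stat x n i \<le> order_stat x n i'"
  unfolding order_stat_altdef(1) using assms
  by (intro sorted_nth_mono) (auto simp del: upt_Suc)

text \<open>Monotonicity is asked on the sample values only, because the quantile transform is
  monotone only on the positive half-line.\<close>

lemma order_stat_map:
  assumes "1 \<le> i" "i \<le> n" "mono_on (x ` {1..n}) f"
  shows "order_stat (\<lambda>l. f (x l)) n i = f (order_stat x n i)"
proof -
  let ?xs = "map x [1..<Suc n]"
  have set: "set (sort ?xs) = x ` {1..n}" by (auto simp del: upt_Suc)
  have "sorted (map f (sort ?xs))"
    using assms(3) set by (intro sorted_map_mono) (simp_all del: upt_Suc)
  then have "map f (sort ?xs) = sort (map (\<lambda>l. f (x l)) [1..<Suc n])"
  proof (intro properties_for_sort[symmetric])
    show "mset (map f (sort (map x [1..<Suc n]))) = mset (map (\<lambda>l. f (x l)) [1..<Suc n])"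
      by (simp add: multiset.map_comp comp_def del: upt_Suc)
  qed
  then have "order_stat (\<lambda>l. f (x l)) n i = map f (sort (map x [1..<Suc n])) ! (i - 1)"
    unfolding order_stat_def by (simp only:)
  also have "\<dots> = f (order_stat x n i)"
    unfolding order_stat_def using assms by (intro nth_map) (simp add: order_stat_altdef(2) del: upt_Suc)
  finally show ?thesis .
qed

text \<open>Since \<open>h\<close> vanishes up to the order statistic, the lower observations can be
  added at no cost. Ties at the threshold contribute 0 wherever the sort places them.\<close>

lemma sum_top_order_stats:
  fixes h :: "real \<Rightarrow> real"
  assumes "k < n" and h: "\<And>v. v \<le> order_stat x n (n - k) \<Longrightarrow> h v = 0"
  shows "(\<Sum>i=1..k. h (order_stat x n (n - i + 1))) = (\<Sum>l=1..n. h (x l))"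
proof -
  define xs where "xs = sort (map x [1..<Suc n])"
  have "(\<Sum>l=1..n. h (x l)) = (\<Sum>p<n. h (xs ! p))" unfolding xs_def by (rule sum_eq_sort)
  also have "\<dots> = (\<Sum>p=n-k..<n. h (xs ! p))"
  proof (rule sum.mono_neutral_right)
    show "\<forall>p\<in>{..<n} - {n - k..<n}. h (xs ! p) = 0"
    proof
      fix p assume "p \<in> {..<n} - {n - k..<n}"
      then have "xs ! p \<le> order_stat x n (n - k)"
        unfolding order_stat_def xs_def[symmetric] using assms
        by (intro sorted_nth_mono) (auto simp: xs_def simp del: upt_Suc)
      then show "h (xs ! p) = 0" by (rule h)
    qed
  qed auto
  \<comment> \<open>Lists are indexed from 0, so the \<open>i\<close>-th largest observation sits at
    position \<open>n - i\<close>.\<close>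
  also have "\<dots> = (\<Sum>i=1..k. h (xs ! (n - i)))"
    using assms by (intro sum.reindex_bij_witness[where i = "\<lambda>i. n - i" and j = "\<lambda>p. n - p"]) auto
  also have "\<dots> = (\<Sum>i=1..k. h (order_stat x n (n - i + 1)))"
    by (intro sum.cong) (simp_all add: order_stat_def xs_def)
  finally show ?thesis ..
qed

text \<open>Otherwise the smallest sample value above the order statistic would be reached by more
  than \<open>k\<close> observations and so lie at or below it. Together with
  \<open>card_ge_order_stat\<close>, this separates the counts of \<open>>\<close> and
  \<open>\<ge>\<close> by \<open>k\<close> even in the presence of ties.\<close>

lemma card_gt_order_stat_le:
  assumes "k < n"
  shows "card {l \<in> {1..n}. order_stat x n (n - k) < x l} \<le> k"
proof (rule ccontr)
  let ?S = "{l \<in> {1..n}. order_stat x n (n - k) < x l}"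
  assume "\<not> card ?S \<le> k"
  then have card: "k + 1 \<le> card ?S" by simp
  have "?S \<noteq> {}"
  proof
    assume "?S = {}"
    with card show False by (simp only: card.empty)
  qed
  define s where "s = Min (x ` ?S)"
  have "s \<in> x ` ?S" unfolding s_def using \<open>?S \<noteq> {}\<close> by (intro Min_in) auto
  then have "order_stat x n (n - k) < s" by auto
  have "card ?S \<le> card {l \<in> {1..n}. s \<le> x l}"
    by (intro card_mono) (auto simp: s_def)
  with card have "s \<le> order_stat x n (n - k)" using assms by (subst order_stat_ge_iff) auto
  with \<open>order_stat x n (n - k) < s\<close> show False by simp
qed

lemma card_ge_order_stat:
  assumes "k < n"
  shows "card {l \<in> {1..n}. order_stat x n (n - k) \<le> x l} \<ge> k + 1"
  using order_stat_ge_iff[of "n - k" n "order_stat x n (n - k)" x] assms by simp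

text \<open>Through \<open>order_stat_ge_iff\<close>, the upper level sets are described by a sum of
  indicators of the observations.\<close>

lemma borel_measurable_order_stat:
  assumes x: "\<And>l. l \<in> {1..n} \<Longrightarrow> x l \<in> borel_measurable M" and "1 \<le> i" "i \<le> n"
  shows "(\<lambda>\<omega>. order_stat (\<lambda>l. x l \<omega>) n i) \<in> borel_measurable M"
  unfolding borel_measurable_iff_ge
proof
  fix s
  have "{\<omega> \<in> space M. s \<le> order_stat (\<lambda>l. x l \<omega>) n i} =
      {\<omega> \<in> space M. real (n - i + 1) \<le> (\<Sum>l\<in>{1..n}. indicat_real {s..} (x l \<omega>))}"
  proof -
    have "(\<Sum>l\<in>{1..n}. indicat_real {s..} (x l \<omega>)) = real (card {l \<in> {1..n}. s \<le> x l \<omega>})" for \<omega>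
      by (simp add: indicator_def sum_of_bool_eq Int_def)
    then show ?thesis using assms(2,3) by (simp only: order_stat_ge_iff of_nat_le_iff)
  qed
  also have "\<dots> \<in> sets M"
  proof -
    have "(\<lambda>\<omega>. \<Sum>l\<in>{1..n}. indicat_real {s..} (x l \<omega>)) \<in> borel_measurable M"
      using x by (intro borel_measurable_sum) (auto intro!: measurable_compose[OF x])
    then show ?thesis by measurable
  qed
  finally show "{\<omega> \<in> space M. s \<le> order_stat (\<lambda>l. x l \<omega>) n i} \<in> sets M" .
qed

text \<open>For indices outside \<open>1..n\<close> (reached when \<open>k \<ge> n\<close>), \<open>order_stat\<close> falls back to the first
  order statistic, or to a constant if the sample is empty.\<close>

lemma borel_measurable_hill:
  assumes x: "\<And>l. l \<in> {1..n} \<Longrightarrow> x l \<in> borel_measurable M"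
  shows "(\<lambda>\<omega>. hill (\<lambda>l. x l \<omega>) n k) \<in> borel_measurable M"
proof (cases "n = 0")
  case True
  then show ?thesis by (simp add: hill_def order_stat_def)
next
  case False
  have 0: "order_stat y n 0 = order_stat y n 1" for y unfolding order_stat_def by simp
  have os: "(\<lambda>\<omega>. order_stat (\<lambda>l. x l \<omega>) n i) \<in> borel_measurable M" if "i \<le> n" for i
    using borel_measurable_order_stat[of n x M i, OF x] borel_measurable_order_stat[of n x M 1, OF x] that False
    by (cases "i = 0") (auto simp: 0)
  show ?thesis unfolding hill_def using False
    by (intro borel_measurable_times borel_measurable_sum borel_measurable_const borel_measurable_ln
        borel_measurable_divide os) auto
qed

text \<open>The lower bound for \<open>ln (1 - 2 * \<delta>)\<close> loses a quadratic term
  \<open>8 * \<delta>\<^sup>2\<close>, at most \<open>2 * \<delta>\<close> for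
  \<open>\<delta> \<le> 1/4\<close>; added to the linear \<open>2 * \<delta>\<close> this gives the
  constant 4.\<close>

lemma abs_ln_near_one:
  fixes x \<delta> :: real
  assumes "0 \<le> \<delta>" "\<delta> \<le> 1/4" "1 - 2 * \<delta> \<le> x" "x \<le> 1 + 2 * \<delta>"
  shows "\<bar>ln x\<bar> \<le> 4 * \<delta>"
proof -
  have "x > 0" using assms by simp
  have "ln x \<le> x - 1" using \<open>x > 0\<close> by (rule ln_le_minus_one)
  then have 1: "ln x \<le> 4 * \<delta>" using assms by simp
  have "- (2 * \<delta>) - 2 * (2 * \<delta>)\<^sup>2 \<le> ln (1 - 2 * \<delta>)"
    using assms by (intro ln_one_minus_pos_lower_bound) auto
  also have "\<dots> \<le> ln x" using assms \<open>x > 0\<close> by (subst ln_le_cancel_iff) auto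
  finally have "- (2 * \<delta>) - 8 * (\<delta> * \<delta>) \<le> ln x" by (simp add: power2_eq_square)
  moreover have "\<delta> * \<delta> \<le> 1/4 * \<delta>" using assms by (intro mult_right_mono) auto
  ultimately show ?thesis using 1 by simp
qed

text \<open>A perturbation of relative size \<open>\<delta>\<close> is sandwiched between two increasing maps, which commute with
  taking order statistics.\<close>

lemma order_stat_perturb:
  assumes "1 \<le> i" "i \<le> n" and \<delta>: "0 \<le> \<delta>" "\<delta> \<le> 1/4"
    and close: "\<And>l. l \<in> {1..n} \<Longrightarrow> \<bar>r l - e l\<bar> \<le> \<delta> * (1 + \<bar>e l\<bar>)"
    and large: "1 \<le> order_stat e n i"
  shows "\<bar>ln (order_stat r n i) - ln (order_stat e n i)\<bar> \<le> 4 * \<delta>" "0 < order_stat r n i"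
proof -
  define v where "v = order_stat e n i"
  have v: "1 \<le> v" using large by (simp add: v_def)
  \<comment> \<open>Both maps increase because \<open>\<delta> \<le> 1/4\<close> keeps the slope of
    the added term below that of the identity.\<close>
  have m: "mono (\<lambda>x. x + \<delta> * (1 + \<bar>x\<bar>))" "mono (\<lambda>x. x - \<delta> * (1 + \<bar>x\<bar>))"
  proof -
    have "\<delta> * \<bar>\<bar>y\<bar> - \<bar>x\<bar>\<bar> \<le> 1 * (y - x)" if "x \<le> y" for x y :: real
      using \<delta> that by (intro mult_mono) auto
    then have *: "\<delta> * \<bar>x\<bar> - \<delta> * \<bar>y\<bar> \<le> y - x" "\<delta> * \<bar>y\<bar> - \<delta> * \<bar>x\<bar> \<le> y - x" if "x \<le> y" for x y :: real
      using \<delta>(1) that by (smt (verit) mult_left_mono right_diff_distrib mult_1)+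
    show "mono (\<lambda>x. x + \<delta> * (1 + \<bar>x\<bar>))" by (intro monoI) (use * in \<open>fastforce simp: algebra_simps\<close>)
    show "mono (\<lambda>x. x - \<delta> * (1 + \<bar>x\<bar>))" by (intro monoI) (use * in \<open>fastforce simp: algebra_simps\<close>)
  qed
  have "order_stat (\<lambda>l. e l + \<delta> * (1 + \<bar>e l\<bar>)) n i = v + \<delta> * (1 + \<bar>v\<bar>)"
    "order_stat (\<lambda>l. e l - \<delta> * (1 + \<bar>e l\<bar>)) n i = v - \<delta> * (1 + \<bar>v\<bar>)"
    unfolding v_def by (rule order_stat_map[OF assms(1,2) mono_on_subset[OF m(1) subset_UNIV]],
      rule order_stat_map[OF assms(1,2) mono_on_subset[OF m(2) subset_UNIV]])
  moreover have "order_stat r n i \<le> order_stat (\<lambda>l. e l + \<delta> * (1 + \<bar>e l\<bar>)) n i"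
    using close assms(1,2) by (intro order_stat_mono) (force simp: abs_le_iff)+
  moreover have "order_stat (\<lambda>l. e l - \<delta> * (1 + \<bar>e l\<bar>)) n i \<le> order_stat r n i"
    using close assms(1,2) by (intro order_stat_mono) (force simp: abs_le_iff)+
  \<comment> \<open>Here \<open>large\<close> enters: \<open>1 + v \<le> 2 * v\<close> for
    \<open>v \<ge> 1\<close> turns the error into a relative one of size
    \<open>2 * \<delta>\<close>.\<close>
  moreover have "\<delta> * (1 + \<bar>v\<bar>) \<le> 2 * \<delta> * v" using v mult_left_mono[OF v \<delta>(1)] by (simp add: algebra_simps)
  ultimately have "(1 - 2 * \<delta>) * v \<le> order_stat r n i" "order_stat r n i \<le> (1 + 2 * \<delta>) * v"
    by (simp_all add: algebra_simps)
  moreover have "0 < (1 - 2 * \<delta>) * v" using v \<delta> by (intro mult_pos_pos) auto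
  ultimately show pos: "0 < order_stat r n i" by linarith
  have "1 - 2 * \<delta> \<le> order_stat r n i / v" "order_stat r n i / v \<le> 1 + 2 * \<delta>"
    using v \<open>(1 - 2 * \<delta>) * v \<le> _\<close> \<open>_ \<le> (1 + 2 * \<delta>) * v\<close> by (simp_all add: pos_le_divide_eq pos_divide_le_eq)
  from abs_ln_near_one[OF \<delta> this] show "\<bar>ln (order_stat r n i) - ln (order_stat e n i)\<bar> \<le> 4 * \<delta>"
    using v pos by (simp add: v_def[symmetric] ln_div)
qed

text \<open>Every logarithm in the average involves two order statistics, each off by at most
  \<open>4 * \<delta>\<close> on the logarithmic scale; averaging preserves the bound.\<close>

lemma hill_perturb:
  assumes "0 < k" "k < n" and \<delta>: "0 \<le> \<delta>" "\<delta> \<le> 1/4"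
    and close: "\<And>l. l \<in> {1..n} \<Longrightarrow> \<bar>r l - e l\<bar> \<le> \<delta> * (1 + \<bar>e l\<bar>)"
    and large: "1 \<le> order_stat e n (n - k)"
  shows "\<bar>hill r n k - hill e n k\<bar> \<le> 8 * \<delta>"
proof -
  have top: "1 \<le> order_stat e n i" if "n - k \<le> i" "i \<le> n" for i
  proof -
    have "1 \<le> n - k" using assms(2) by simp
    from order_stat_le[OF this that] show ?thesis using large by (rule order_trans[rotated])
  qed
  note pert = order_stat_perturb[OF _ _ \<delta> close]
  have 0: "\<bar>ln (order_stat r n (n - k)) - ln (order_stat e n (n - k))\<bar> \<le> 4 * \<delta>" "0 < order_stat r n (n - k)"
    using pert[of "n - k"] assms(2) large by simp_all
  have "\<bar>ln (order_stat r n (n - i + 1) / order_stat r n (n - k)) - ln (order_stat e n (n - i + 1) / order_stat e n (n - k))\<bar> \<le> 8 * \<delta>"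
    if i: "i \<in> {1..k}" for i
  proof -
    have idx: "1 \<le> n - i + 1" "n - i + 1 \<le> n" "n - k \<le> n - i + 1" using i assms(2) by auto
    have t: "1 \<le> order_stat e n (n - i + 1)" by (rule top[OF idx(3,2)])
    have 1: "\<bar>ln (order_stat r n (n - i + 1)) - ln (order_stat e n (n - i + 1))\<bar> \<le> 4 * \<delta>" "0 < order_stat r n (n - i + 1)"
      using pert[OF idx(1,2) _ t] by simp_all
    have "ln (order_stat r n (n - i + 1) / order_stat r n (n - k)) = ln (order_stat r n (n - i + 1)) - ln (order_stat r n (n - k))"
      using 0(2) 1(2) by (simp add: ln_div)
    moreover have "ln (order_stat e n (n - i + 1) / order_stat e n (n - k)) = ln (order_stat e n (n - i + 1)) - ln (order_stat e n (n - k))"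
      using t large by (simp add: ln_div)
    ultimately show ?thesis using 0(1) 1(1) by linarith
  qed
  then have "\<bar>(\<Sum>i=1..k. ln (order_stat r n (n - i + 1) / order_stat r n (n - k)) - ln (order_stat e n (n - i + 1) / order_stat e n (n - k)))\<bar> \<le> (\<Sum>i=1..k. 8 * \<delta>)"
    by (intro order_trans[OF sum_abs] sum_mono)
  then have "\<bar>real k * (hill r n k - hill e n k)\<bar> \<le> real k * (8 * \<delta>)"
    using \<open>0 < k\<close> by (simp add: hill_def right_diff_distrib sum_subtractf)
  then show ?thesis using \<open>0 < k\<close> by (simp add: abs_mult)
qed

text \<open>Removes the ordering except through the threshold: the logarithms of the top
  \<open>k\<close> quotients are positive parts, which vanish below the threshold, so the sum
  extends over the whole sample. The function \<open>u\<close> has to agree with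
  \<open>ln (q s)\<close> only beyond \<open>s0\<close>.\<close>

lemma hill_of_quantile_transform:
  assumes "0 < k" "k < n" and pos: "\<And>l. l \<in> {1..n} \<Longrightarrow> 0 < x l"
    and q: "mono_on {0<..} q" and u: "mono u" "\<And>s. s0 \<le> s \<Longrightarrow> 0 < q s \<and> u s = ln (q s)"
    and large: "s0 \<le> order_stat x n (n - k)"
  shows "hill (\<lambda>l. q (x l)) n k = (\<Sum>l=1..n. max 0 (u (x l) - u (order_stat x n (n - k)))) / real k"
proof -
  define z where "z = order_stat x n (n - k)"
  have "mono_on (x ` {1..n}) q" using q by (rule mono_on_subset) (use pos in auto)
  then have os: "order_stat (\<lambda>l. q (x l)) n i = q (order_stat x n i)" if "1 \<le> i" "i \<le> n" for i
    using that by (intro order_stat_map)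
  have "ln (order_stat (\<lambda>l. q (x l)) n (n - i + 1) / order_stat (\<lambda>l. q (x l)) n (n - k)) = max 0 (u (order_stat x n (n - i + 1)) - u z)"
    if i: "i \<in> {1..k}" for i
  proof -
    have idx: "1 \<le> n - i + 1" "n - i + 1 \<le> n" "n - k \<le> n - i + 1" "1 \<le> n - k" using i assms(2) by auto
    have "z \<le> order_stat x n (n - i + 1)" unfolding z_def by (rule order_stat_le[OF idx(4,3,2)])
    moreover from this have "u z \<le> u (order_stat x n (n - i + 1))" by (rule monoD[OF u(1)])
    ultimately show ?thesis
      using u(2)[of "order_stat x n (n - i + 1)"] u(2)[of z] large idx(1,2,4) assms(2)
      by (simp add: os z_def[symmetric] ln_div)
  qed
  then have "hill (\<lambda>l. q (x l)) n k = (\<Sum>i=1..k. max 0 (u (order_stat x n (n - i + 1)) - u z)) / real k"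
    by (simp add: hill_def)
  also have "(\<Sum>i=1..k. max 0 (u (order_stat x n (n - i + 1)) - u z)) = (\<Sum>l=1..n. max 0 (u (x l) - u z))"
    using assms(2) monoD[OF u(1)] by (intro sum_top_order_stats) (auto simp: z_def)
  finally show ?thesis unfolding z_def .
qed

section \<open>Exponential samples\<close>

abbreviation std_exponential :: "real measure" where
  "std_exponential \<equiv> density lborel (exponential_density 1)"

lemma prob_space_std_exponential: "prob_space std_exponential"
  by (rule prob_space_exponential_density) simp

text \<open>Exponential tilting: density times integrand is \<open>1 / (1 - c)\<close> times the
  exponential density of rate \<open>1 - c\<close>.\<close>

lemma std_exponential_exp:
  assumes "c < 1"
  shows "integrable std_exponential (\<lambda>x. exp (c * x))"
    and "(LINT x|std_exponential. exp (c * x)) = 1 / (1 - c)"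
proof -
  interpret E: prob_space "density lborel (exponential_density (1 - c))"
    using assms by (intro prob_space_exponential_density) simp
  have eq: "exponential_density 1 x * exp (c * x) = exponential_density (1 - c) x * (1 / (1 - c))" for x
    using assms by (simp add: exponential_density_def exp_add[symmetric]) (simp add: algebra_simps)
  have "integrable (density lborel (exponential_density (1 - c))) (\<lambda>_. 1 / (1 - c))" by simp
  then have "integrable lborel (\<lambda>x. exponential_density (1 - c) x * (1 / (1 - c)))"
    using assms by (subst (asm) integrable_density) auto
  then show "integrable std_exponential (\<lambda>x. exp (c * x))"
    by (subst integrable_density) (auto simp: eq)
  have "(LINT x|std_exponential. exp (c * x)) = (LINT x|lborel. exponential_density (1 - c) x * (1 / (1 - c)))"
    by (subst integral_density) (auto simp: eq)
  also have "\<dots> = (LINT x|density lborel (exponential_density (1 - c)). 1 / (1 - c))"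
    using assms by (subst integral_density) auto
  also have "\<dots> = 1 / (1 - c)" using E.prob_space by simp
  finally show "(LINT x|std_exponential. exp (c * x)) = 1 / (1 - c)" .
qed

lemma std_exponential_moment:
  shows "integrable std_exponential (\<lambda>x. x ^ i)" and "(LINT x|std_exponential. x ^ i) = fact i"
proof -
  interpret E: prob_space std_exponential by (rule prob_space_std_exponential)
  have D: "distributed std_exponential lborel (\<lambda>x. x) (exponential_density 1)"
    by (simp add: distributed_def distr_id2)
  show "integrable std_exponential (\<lambda>x. x ^ i)" by (rule E.erlang_ith_moment_integrable[OF _ D]) simp
  show "(LINT x|std_exponential. x ^ i) = fact i" using E.erlang_ith_moment[OF _ D, of i] by simp
qed

lemma AE_std_exponential_nonneg: "AE x in std_exponential. 0 \<le> x"
  by (subst AE_density) (auto simp: exponential_density_def)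

lemma std_exponential_centred:
  shows "integrable std_exponential (\<lambda>x. x - 1)" "(LINT x|std_exponential. x - 1) = 0"
    "integrable std_exponential (\<lambda>x. (x - 1)\<^sup>2)" "(LINT x|std_exponential. (x - 1)\<^sup>2) = 1"
    "integrable std_exponential (\<lambda>x. \<bar>x - 1\<bar> ^ 3)"
proof -
  interpret E: prob_space std_exponential by (rule prob_space_std_exponential)
  note m = std_exponential_moment[of 1, simplified] std_exponential_moment[of 2] std_exponential_moment[of 3]
  show "integrable std_exponential (\<lambda>x. x - 1)" "(LINT x|std_exponential. x - 1) = 0"
    using m(1,2) E.prob_space by simp_all
  have eq: "(x - 1)\<^sup>2 = x ^ 2 - 2 * x + 1" for x :: real by (simp add: power2_eq_square algebra_simps)
  show "integrable std_exponential (\<lambda>x. (x - 1)\<^sup>2)" "(LINT x|std_exponential. (x - 1)\<^sup>2) = 1"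
    unfolding eq using m E.prob_space by (simp_all add: fact_2)
  show "integrable std_exponential (\<lambda>x. \<bar>x - 1\<bar> ^ 3)"
  proof (rule Bochner_Integration.integrable_bound)
    show "integrable std_exponential (\<lambda>x. x ^ 3 + 1)" using m by simp
    have "\<bar>x - 1\<bar> ^ 3 \<le> x ^ 3 + 1" if "x \<ge> 0" for x :: real
    proof (cases "x \<ge> 1")
      case True
      then have "(x - 1) ^ 3 \<le> x ^ 3" by (intro power_mono) auto
      moreover have "\<bar>x - 1\<bar> = x - 1" using True by simp
      ultimately show ?thesis by linarith
    next
      case False
      then have "(1 - x) ^ 3 \<le> 1 ^ 3" using that by (intro power_mono) auto
      moreover have "\<bar>x - 1\<bar> = 1 - x" using False by simp
      ultimately show ?thesis using zero_le_power[OF that, of 3] by (simp only: power_one)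
    qed
    then have "norm (\<bar>x - 1\<bar> ^ 3) \<le> norm (x ^ 3 + 1)" if "x \<ge> 0" for x :: real
      using that zero_le_power[OF that, of 3] by (simp add: power_abs)
    with AE_std_exponential_nonneg show "AE x in std_exponential. norm (\<bar>x - 1\<bar> ^ 3) \<le> norm (x ^ 3 + 1)"
      by (auto elim: eventually_mono)
  qed simp
qed

text \<open>The source of the factor \<open>1 / (1 - \<rho>)\<close> in the bias: the second-order
  increment is averaged over an exponential excess.\<close>

lemma std_exponential_second_order_limit:
  assumes "\<rho> \<le> 0"
  shows "(LINT x|std_exponential. second_order_limit \<rho> x) = 1 / (1 - \<rho>)"
proof (cases "\<rho> = 0")
  case True
  then show ?thesis using std_exponential_moment(2)[of 1] by (simp add: second_order_limit_def)
next
  case False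
  interpret E: prob_space std_exponential by (rule prob_space_std_exponential)
  have "(LINT x|std_exponential. second_order_limit \<rho> x) = (LINT x|std_exponential. (exp (\<rho> * x) - 1)) / \<rho>"
    using False by (simp add: second_order_limit_def)
  also have "(LINT x|std_exponential. (exp (\<rho> * x) - 1)) = 1 / (1 - \<rho>) - 1"
    using std_exponential_exp[of \<rho>] assms E.prob_space by simp
  also have "\<dots> / \<rho> = 1 / (1 - \<rho>)" using assms False by (simp add: field_simps)
  finally show ?thesis .
qed

text \<open>Lack of memory: translating by \<open>y\<close> multiplies the density by
  \<open>exp (- y)\<close>. The moment computations at a high level rest on this.\<close>

lemma (in prob_space) exponential_excess:
  assumes D: "distributed M lborel Q (exponential_density 1)" and "y \<ge> 0"
    and [measurable]: "\<phi> \<in> borel_measurable borel"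
  shows exponential_excess_integrable:
      "integrable std_exponential \<phi> \<Longrightarrow> integrable M (\<lambda>\<omega>. indicat_real {y..} (Q \<omega>) * \<phi> (Q \<omega> - y))"
    and exponential_excess_expectation:
      "expectation (\<lambda>\<omega>. indicat_real {y..} (Q \<omega>) * \<phi> (Q \<omega> - y)) = exp (- y) * (LINT x|std_exponential. \<phi> x)"
proof -
  let ?f = "\<lambda>x. exponential_density 1 x * (indicat_real {y..} x * \<phi> (x - y))"
  have shift: "?f (y + 1 * x) = exp (- y) * (exponential_density 1 x * \<phi> x)" for x
    using \<open>y \<ge> 0\<close> by (auto simp: exponential_density_def exp_add[symmetric] indicator_def)
  show "integrable M (\<lambda>\<omega>. indicat_real {y..} (Q \<omega>) * \<phi> (Q \<omega> - y))" if "integrable std_exponential \<phi>"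
  proof -
    have "integrable lborel (\<lambda>x. exp (- y) * (exponential_density 1 x * \<phi> x))"
      using that by (subst (asm) integrable_density) auto
    then have "integrable lborel (\<lambda>x. ?f (y + 1 * x))" unfolding shift .
    then have "integrable lborel ?f" by (rule lborel_integrable_real_affine_iff[THEN iffD1, rotated]) simp
    then show ?thesis by (subst (asm) distributed_integrable[OF D]) auto
  qed
  have "expectation (\<lambda>\<omega>. indicat_real {y..} (Q \<omega>) * \<phi> (Q \<omega> - y)) = (LINT x|lborel. ?f x)"
    by (subst distributed_integral[OF D]) auto
  also have "\<dots> = (LINT x|lborel. ?f (y + 1 * x))"
    by (subst lborel_integral_real_affine[of 1 _ y]) auto
  also have "\<dots> = exp (- y) * (LINT x|std_exponential. \<phi> x)"
    unfolding shift by (subst integral_density) auto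
  finally show "expectation (\<lambda>\<omega>. indicat_real {y..} (Q \<omega>) * \<phi> (Q \<omega> - y)) = exp (- y) * (LINT x|std_exponential. \<phi> x)" .
qed

text \<open>Cross terms vanish by independence. Integrability and mean of the partial sum are
  carried through the induction because the cross term needs them.\<close>

lemma (in prob_space) second_moment_indep_sum:
  fixes X :: "'i \<Rightarrow> 'a \<Rightarrow> real"
  assumes "finite I" "indep_vars (\<lambda>_. borel) X I"
    and "\<And>i. i \<in> I \<Longrightarrow> integrable M (\<lambda>\<omega>. (X i \<omega>)\<^sup>2)" "\<And>i. i \<in> I \<Longrightarrow> expectation (X i) = 0"
  shows "integrable M (\<lambda>\<omega>. \<Sum>i\<in>I. X i \<omega>) \<and> expectation (\<lambda>\<omega>. \<Sum>i\<in>I. X i \<omega>) = 0 \<and>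
    integrable M (\<lambda>\<omega>. (\<Sum>i\<in>I. X i \<omega>)\<^sup>2) \<and>
    expectation (\<lambda>\<omega>. (\<Sum>i\<in>I. X i \<omega>)\<^sup>2) = (\<Sum>i\<in>I. expectation (\<lambda>\<omega>. (X i \<omega>)\<^sup>2))"
  using assms
proof (induction I rule: finite_induct)
  case empty
  then show ?case by simp
next
  case (insert i I)
  define S where "S \<omega> = (\<Sum>i\<in>I. X i \<omega>)" for \<omega>
  have "indep_vars (\<lambda>_. borel) X I" using insert.prems(1) by (rule indep_vars_subset) auto
  then have IH: "integrable M S" "expectation S = 0" "integrable M (\<lambda>\<omega>. (S \<omega>)\<^sup>2)"
    "expectation (\<lambda>\<omega>. (S \<omega>)\<^sup>2) = (\<Sum>i\<in>I. expectation (\<lambda>\<omega>. (X i \<omega>)\<^sup>2))"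
    using insert.IH insert.prems unfolding S_def by simp_all
  have rv: "X i \<in> borel_measurable M" using insert.prems(1) unfolding indep_vars_def2 by blast
  have int2: "integrable M (\<lambda>\<omega>. (X i \<omega>)\<^sup>2)" and mean: "expectation (X i) = 0"
    using insert.prems by simp_all
  have int1: "integrable M (X i)" by (rule square_integrable_imp_integrable[OF rv int2])
  have ind: "indep_var borel (X i) borel S"
    unfolding S_def using insert by (intro indep_vars_sum) auto
  have "integrable M (\<lambda>\<omega>. X i \<omega> * S \<omega>)" by (rule indep_var_integrable[OF ind int1 IH(1)])
  moreover have "expectation (\<lambda>\<omega>. X i \<omega> * S \<omega>) = 0"
    using indep_var_lebesgue_integral[OF ind int1 IH(1)] mean by simp
  moreover have "(X i \<omega> + S \<omega>)\<^sup>2 = (X i \<omega>)\<^sup>2 + 2 * (X i \<omega> * S \<omega>) + (S \<omega>)\<^sup>2" for \<omega>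
    by (simp add: power2_eq_square algebra_simps)
  ultimately have "integrable M (\<lambda>\<omega>. X i \<omega> + S \<omega>) \<and> expectation (\<lambda>\<omega>. X i \<omega> + S \<omega>) = 0 \<and>
      integrable M (\<lambda>\<omega>. (X i \<omega> + S \<omega>)\<^sup>2) \<and>
      expectation (\<lambda>\<omega>. (X i \<omega> + S \<omega>)\<^sup>2) = expectation (\<lambda>\<omega>. (X i \<omega>)\<^sup>2) + expectation (\<lambda>\<omega>. (S \<omega>)\<^sup>2)"
    using int1 int2 mean IH(1-3) by simp
  then show ?case using insert.hyps IH(4) unfolding S_def by simp
qed

context prob_space
begin

lemma exponential_transfer:
  fixes h :: "real \<Rightarrow> real"
  assumes D: "distributed M lborel Q (exponential_density 1)" and [measurable]: "h \<in> borel_measurable borel"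
  shows "integrable M (\<lambda>\<omega>. h (Q \<omega>)) \<longleftrightarrow> integrable std_exponential h"
    and "expectation (\<lambda>\<omega>. h (Q \<omega>)) = (LINT x|std_exponential. h x)"
  using distributed_integrable[OF D, of h] distributed_integral[OF D, of h]
  by (simp_all add: integrable_density integral_density)

lemma second_moment_centred_iid_sum:
  fixes Q :: "nat \<Rightarrow> 'a \<Rightarrow> real"
  assumes indep: "indep_vars (\<lambda>_. borel) Q {1..}"
    and D: "\<And>i. i \<ge> 1 \<Longrightarrow> distributed M lborel (Q i) (exponential_density 1)"
    and [measurable]: "f \<in> borel_measurable borel"
    and f2: "integrable std_exponential (\<lambda>x. (f x)\<^sup>2)"
  defines "\<mu> \<equiv> LINT x|std_exponential. f x"
  shows "integrable M (\<lambda>\<omega>. ((\<Sum>i=1..n. f (Q i \<omega>)) - real n * \<mu>)\<^sup>2)"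
    and "expectation (\<lambda>\<omega>. ((\<Sum>i=1..n. f (Q i \<omega>)) - real n * \<mu>)\<^sup>2) \<le> real n * (LINT x|std_exponential. (f x)\<^sup>2)"
proof -
  interpret E: prob_space std_exponential by (rule prob_space_std_exponential)
  have f1: "integrable std_exponential f" by (rule E.square_integrable_imp_integrable[OF _ f2]) simp
  have eq: "(f x - \<mu>)\<^sup>2 = (f x)\<^sup>2 - 2 * \<mu> * f x + \<mu>\<^sup>2" for x by (simp add: power2_eq_square algebra_simps)
  have int: "integrable std_exponential (\<lambda>x. f x - \<mu>)" "integrable std_exponential (\<lambda>x. (f x - \<mu>)\<^sup>2)"
    unfolding eq using f1 f2 by simp_all
  have "(LINT x|std_exponential. (f x - \<mu>)\<^sup>2) = (LINT x|std_exponential. (f x)\<^sup>2) - \<mu>\<^sup>2"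
    unfolding eq using f1 f2 E.prob_space by (simp add: \<mu>_def[symmetric] power2_eq_square)
  then have le: "(LINT x|std_exponential. (f x - \<mu>)\<^sup>2) \<le> (LINT x|std_exponential. (f x)\<^sup>2)" by simp
  have mean: "(LINT x|std_exponential. f x - \<mu>) = 0"
    using f1 E.prob_space by (simp add: \<mu>_def)
  have transfer: "integrable M (\<lambda>\<omega>. h (Q i \<omega>))" "expectation (\<lambda>\<omega>. h (Q i \<omega>)) = (LINT x|std_exponential. h x)"
    if "integrable std_exponential h" "h \<in> borel_measurable borel" "i \<ge> 1" for h :: "real \<Rightarrow> real" and i
    using exponential_transfer[OF D[OF that(3)] that(2)] that(1) by simp_all
  have "indep_vars (\<lambda>_. borel) Q {1..n}" using indep by (rule indep_vars_subset) auto
  then have ind: "indep_vars (\<lambda>_. borel) (\<lambda>i \<omega>. f (Q i \<omega>) - \<mu>) {1..n}"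
    by (rule indep_vars_compose2) auto
  have sum: "(\<Sum>i=1..n. f (Q i \<omega>)) - real n * \<mu> = (\<Sum>i=1..n. f (Q i \<omega>) - \<mu>)" for \<omega>
    by (simp add: sum_subtractf)
  have *: "integrable M (\<lambda>\<omega>. (\<Sum>i=1..n. f (Q i \<omega>) - \<mu>)\<^sup>2) \<and>
    expectation (\<lambda>\<omega>. (\<Sum>i=1..n. f (Q i \<omega>) - \<mu>)\<^sup>2) = (\<Sum>i=1..n. expectation (\<lambda>\<omega>. (f (Q i \<omega>) - \<mu>)\<^sup>2))"
    using second_moment_indep_sum[OF _ ind] transfer[OF int(1)] transfer[OF int(2)] mean by simp
  then show "integrable M (\<lambda>\<omega>. ((\<Sum>i=1..n. f (Q i \<omega>)) - real n * \<mu>)\<^sup>2)" unfolding sum by blast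
  have "(\<Sum>i=1..n. expectation (\<lambda>\<omega>. (f (Q i \<omega>) - \<mu>)\<^sup>2)) = (\<Sum>i=1..n. LINT x|std_exponential. (f x - \<mu>)\<^sup>2)"
    by (intro sum.cong refl transfer(2)[OF int(2)]) auto
  with * le show "expectation (\<lambda>\<omega>. ((\<Sum>i=1..n. f (Q i \<omega>)) - real n * \<mu>)\<^sup>2) \<le> real n * (LINT x|std_exponential. (f x)\<^sup>2)"
    unfolding sum by (simp add: mult_left_mono)
qed

end

text \<open>As a function of the threshold, the sum of positive parts is convex and piecewise
  linear, with minus the number of exceedances as slope. Between \<open>y\<close> and
  \<open>z\<close> that number lies between \<open>k\<close> and \<open>C\<close>, so a constant
  slope \<open>- k\<close> is wrong by at most \<open>\<bar>C - k\<bar>\<close>.\<close>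

lemma top_sum_change_threshold:
  fixes q :: "nat \<Rightarrow> real" and y :: real
  assumes "k < n"
  defines "z \<equiv> order_stat q n (n - k)" and "C \<equiv> real (card {i \<in> {1..n}. y \<le> q i})"
  shows "\<bar>(\<Sum>i=1..n. max 0 (q i - z)) - (\<Sum>i=1..n. max 0 (q i - y)) + real k * (z - y)\<bar> \<le> \<bar>C - real k\<bar> * \<bar>z - y\<bar>"
proof -
  have card: "(\<Sum>i=1..n. of_bool (P i)) = real (card {i \<in> {1..n}. P i})" for P
    by (simp add: sum_of_bool_eq Int_def)
  have ge: "real k \<le> (\<Sum>i=1..n. of_bool (z \<le> q i))"
    unfolding card using card_ge_order_stat[OF \<open>k < n\<close>, of q] by (simp add: z_def)
  have gt: "(\<Sum>i=1..n. of_bool (z < q i)) \<le> real k"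
    unfolding card using card_gt_order_stat_le[OF \<open>k < n\<close>, of q] by (simp add: z_def)
  have C: "C = (\<Sum>i=1..n. of_bool (y \<le> q i))" unfolding C_def card ..
  let ?d = "(\<Sum>i=1..n. max 0 (q i - z)) - (\<Sum>i=1..n. max 0 (q i - y))"
  have d: "?d = (\<Sum>i=1..n. max 0 (q i - z) - max 0 (q i - y))" by (simp add: sum_subtractf)
  show ?thesis
  proof (cases "y \<le> z")
    case True
    have "?d \<le> (\<Sum>i=1..n. of_bool (z \<le> q i) * (y - z))"
      unfolding d using True by (intro sum_mono) (auto simp: max_def)
    also have "\<dots> = (\<Sum>i=1..n. of_bool (z \<le> q i)) * (y - z)" by (simp add: sum_distrib_right)
    also have "\<dots> \<le> real k * (y - z)" using True ge by (intro mult_right_mono_neg) auto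
    finally have 1: "?d \<le> real k * (y - z)" .
    have "C * (y - z) = (\<Sum>i=1..n. of_bool (y \<le> q i) * (y - z))" unfolding C by (simp add: sum_distrib_right)
    also have "\<dots> \<le> ?d" unfolding d using True by (intro sum_mono) (auto simp: max_def)
    finally have 2: "C * (y - z) \<le> ?d" .
    have "\<bar>?d + real k * (z - y)\<bar> = - (?d + real k * (z - y))" using 1 by (simp add: algebra_simps)
    also have "\<dots> \<le> (C - real k) * (z - y)" using 2 by (simp add: algebra_simps)
    also have "\<dots> \<le> \<bar>C - real k\<bar> * \<bar>z - y\<bar>" unfolding abs_mult[symmetric] by (rule abs_ge_self)
    finally show ?thesis .
  next
    case False
    have "?d \<le> (\<Sum>i=1..n. of_bool (z < q i) * (y - z))"
      unfolding d using False by (intro sum_mono) (auto simp: max_def)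
    also have "\<dots> = (\<Sum>i=1..n. of_bool (z < q i)) * (y - z)" by (simp add: sum_distrib_right)
    also have "\<dots> \<le> real k * (y - z)" using False gt by (intro mult_right_mono) auto
    finally have 1: "?d \<le> real k * (y - z)" .
    have "C * (y - z) = (\<Sum>i=1..n. of_bool (y \<le> q i) * (y - z))" unfolding C by (simp add: sum_distrib_right)
    also have "\<dots> \<le> ?d" unfolding d using False by (intro sum_mono) (auto simp: max_def)
    finally have 2: "C * (y - z) \<le> ?d" .
    have "\<bar>?d + real k * (z - y)\<bar> = - (?d + real k * (z - y))" using 1 by (simp add: algebra_simps)
    also have "\<dots> \<le> (C - real k) * (z - y)" using 2 by (simp add: algebra_simps)
    also have "\<dots> \<le> \<bar>C - real k\<bar> * \<bar>z - y\<bar>" unfolding abs_mult[symmetric] by (rule abs_ge_self)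
    finally show ?thesis .
  qed
qed

text \<open>A change of threshold alters the subtracted value of \<open>g\<close>, by at most
  \<open>\<eta>\<close>, and the membership of observations between \<open>y\<close> and
  \<open>z\<close>, whose increments are themselves at most \<open>\<eta>\<close> from
  \<open>y\<close> and \<open>2 * \<eta>\<close> from \<open>z\<close>. Hence a charge of
  \<open>2 * \<eta>\<close> for every observation beyond either threshold.\<close>

lemma top_increment_sum_change_threshold:
  fixes q :: "nat \<Rightarrow> real" and y \<eta> :: real
  assumes "k < n"
  defines "z \<equiv> order_stat q n (n - k)" and "C \<equiv> real (card {i \<in> {1..n}. y \<le> q i})"
  assumes g: "\<And>v. \<bar>v\<bar> \<le> \<bar>z - y\<bar> \<Longrightarrow> \<bar>g (y + v) - g y\<bar> \<le> \<eta>"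
  shows "\<bar>(\<Sum>i=1..n. indicat_real {z..} (q i) * (g (q i) - g z)) - (\<Sum>i=1..n. indicat_real {y..} (q i) * (g (q i) - g y))\<bar>
    \<le> 2 * \<eta> * (C + real k)"
proof -
  have card: "(\<Sum>i=1..n. of_bool (P i)) = real (card {i \<in> {1..n}. P i})" for P
    by (simp add: sum_of_bool_eq Int_def)
  have "\<eta> \<ge> 0" using g[of 0] by simp
  have gz: "\<bar>g z - g y\<bar> \<le> \<eta>" using g[of "z - y"] by simp
  have "\<bar>indicat_real {z..} (q i) * (g (q i) - g z) - indicat_real {y..} (q i) * (g (q i) - g y)\<bar>
      \<le> of_bool (y \<le> q i) * (2 * \<eta>) + of_bool (z < q i) * (2 * \<eta>)" for i
  proof -
    \<comment> \<open>An observation equal to \<open>z\<close> contributes 0 to the first sum. So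
      beyond the indices with \<open>y \<le> q i\<close>, only those with \<open>z < q i\<close>, at
      most \<open>k\<close> of them, have to be charged.\<close>
    consider "y \<le> q i" "z \<le> q i" | "q i < y" "q i < z" | "y \<le> q i" "q i < z" | "q i < y" "z < q i" | "q i < y" "q i = z"
      by linarith
    then show ?thesis
    proof cases
      case 3
      then have "\<bar>g (y + (q i - y)) - g y\<bar> \<le> \<eta>" by (intro g) auto
      then show ?thesis using 3 \<open>\<eta> \<ge> 0\<close> by auto
    next
      case 4
      then have "\<bar>g (y + (q i - y)) - g y\<bar> \<le> \<eta>" by (intro g) auto
      then show ?thesis using 4 \<open>\<eta> \<ge> 0\<close> gz by auto
    qed (use gz \<open>\<eta> \<ge> 0\<close> in auto)
  qed
  then have "\<bar>(\<Sum>i=1..n. indicat_real {z..} (q i) * (g (q i) - g z)) - (\<Sum>i=1..n. indicat_real {y..} (q i) * (g (q i) - g y))\<bar>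
    \<le> (\<Sum>i=1..n. of_bool (y \<le> q i) * (2 * \<eta>) + of_bool (z < q i) * (2 * \<eta>))"
    unfolding sum_subtractf[symmetric] by (intro order_trans[OF sum_abs] sum_mono)
  also have "\<dots> = 2 * \<eta> * (C + (\<Sum>i=1..n. of_bool (z < q i)))"
    unfolding C_def card[symmetric] sum.distrib sum_distrib_right[symmetric] by (simp only: algebra_simps)
  also have "\<dots> \<le> 2 * \<eta> * (C + real k)"
    unfolding card using card_gt_order_stat_le[OF \<open>k < n\<close>, of q] \<open>\<eta> \<ge> 0\<close>
    by (intro mult_left_mono add_left_mono) (simp_all add: z_def)
  finally show ?thesis .
qed

section \<open>The random threshold of an exponential sample\<close>

context prob_space
begin

text \<open>A crossing argument (in the manner of Ghosh): \<open>B\<close> is confined to a finite grid up to a small probability.\<close>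

lemma prob_lim_of_crossings:
  assumes B: "prob_bounded M B"
    and V: "\<And>a. prob_lim M (\<lambda>n \<omega>. V a n \<omega> - (B n \<omega> - a)) 0"
    and \<theta>: "\<theta> \<longlonglongrightarrow> 0"
    and cross: "\<And>a. eventually (\<lambda>p. a \<le> X (fst p) (snd p) \<longleftrightarrow> \<theta> (fst p) \<le> V a (fst p) (snd p)) (prob_filter M)"
  shows "prob_lim M (\<lambda>n \<omega>. X n \<omega> - B n \<omega>) 0"
proof (rule tendstoI)
  fix \<delta> :: real assume "\<delta> > 0"
  define \<eta> where "\<eta> = \<delta> / 3"
  have "\<eta> > 0" "2 * \<eta> < \<delta>" unfolding \<eta>_def using \<open>\<delta> > 0\<close> by auto
  show "eventually (\<lambda>p. dist (X (fst p) (snd p) - B (fst p) (snd p)) 0 < \<delta>) (prob_filter M)"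
    unfolding eventually_prob_filter
  proof (intro allI impI)
    fix \<zeta> :: real assume "\<zeta> > 0"
    then have "\<zeta> / 2 > 0" by simp
    with B obtain b where "b > 0" and b: "eventually_prob M (\<zeta>/2) (\<lambda>n \<omega>. \<bar>B n \<omega>\<bar> \<le> b)"
      by (rule prob_boundedE)
    \<comment> \<open>Leaves a margin for the grid points \<open>i - 1\<close> and
      \<open>i + 2\<close> used below, where \<open>\<bar>i\<bar>\<close> is at most
      \<open>\<lceil>b / \<eta>\<rceil>\<close>.\<close>
    define m where "m = \<lceil>b / \<eta>\<rceil> + 3"
    have "eventually (\<lambda>p. \<forall>i\<in>{-m..m}. (real_of_int i * \<eta> \<le> X (fst p) (snd p) \<longleftrightarrow> \<theta> (fst p) \<le> V (real_of_int i * \<eta>) (fst p) (snd p)) \<and>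
        \<bar>V (real_of_int i * \<eta>) (fst p) (snd p) - (B (fst p) (snd p) - real_of_int i * \<eta>)\<bar> < \<eta>/2) (prob_filter M)"
    proof (rule eventually_ball_finite, simp, intro ballI eventually_conj cross)
      fix i
      show "\<forall>\<^sub>F p in prob_filter M. \<bar>V (real_of_int i * \<eta>) (fst p) (snd p) - (B (fst p) (snd p) - real_of_int i * \<eta>)\<bar> < \<eta>/2"
        using tendstoD[OF V[of "real_of_int i * \<eta>"], of "\<eta>/2"] \<open>\<eta> > 0\<close> by simp
    qed
    moreover have "eventually (\<lambda>p. \<bar>\<theta> (fst p)\<bar> < \<eta>/2) (prob_filter M)"
      using tendstoD[OF prob_lim_sequence[OF \<theta>], of "\<eta>/2"] \<open>\<eta> > 0\<close> by simp
    ultimately have "eventually (\<lambda>p. \<bar>B (fst p) (snd p)\<bar> \<le> b \<longrightarrow> \<bar>X (fst p) (snd p) - B (fst p) (snd p)\<bar> < \<delta>) (prob_filter M)"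
    proof eventually_elim
      case (elim p)
      show ?case
      proof
        assume Bb: "\<bar>B (fst p) (snd p)\<bar> \<le> b"
        define i where "i = \<lfloor>B (fst p) (snd p) / \<eta>\<rfloor>"
        have i: "real_of_int i * \<eta> \<le> B (fst p) (snd p)" "B (fst p) (snd p) < (real_of_int i + 1) * \<eta>"
          unfolding i_def using \<open>\<eta> > 0\<close> by (simp_all add: pos_le_divide_eq[symmetric] pos_divide_less_eq[symmetric])
        have "- (b / \<eta>) \<le> B (fst p) (snd p) / \<eta>" "B (fst p) (snd p) / \<eta> \<le> b / \<eta>"
          using Bb \<open>\<eta> > 0\<close> divide_right_mono[of "- b" "B (fst p) (snd p)" \<eta>]
            divide_right_mono[of "B (fst p) (snd p)" b \<eta>] by (simp_all add: abs_le_iff)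
        then have "\<lfloor>- (b / \<eta>)\<rfloor> \<le> i" "i \<le> \<lceil>b / \<eta>\<rceil>"
          unfolding i_def using floor_mono order_trans[OF floor_mono floor_le_ceiling] by blast+
        then have "i - 1 \<in> {-m..m}" "i + 2 \<in> {-m..m}"
          unfolding m_def floor_minus using \<open>b > 0\<close> by auto
        \<comment> \<open>\<open>B\<close> lies in the cell from \<open>i * \<eta>\<close> to
          \<open>(i + 1) * \<eta>\<close>. A distance of one cell on either side makes
          \<open>\<bar>B - a\<bar>\<close> at least \<open>\<eta>\<close>, which beats the errors of
          \<open>V\<close> and \<open>\<theta>\<close>, each below \<open>\<eta>/2\<close>; so
          \<open>X\<close> is caught between these two grid points.\<close>
        with elim(1) have
          1: "real_of_int (i - 1) * \<eta> \<le> X (fst p) (snd p) \<longleftrightarrow> \<theta> (fst p) \<le> V (real_of_int (i - 1) * \<eta>) (fst p) (snd p)"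
             "\<bar>V (real_of_int (i - 1) * \<eta>) (fst p) (snd p) - (B (fst p) (snd p) - real_of_int (i - 1) * \<eta>)\<bar> < \<eta>/2" and
          2: "real_of_int (i + 2) * \<eta> \<le> X (fst p) (snd p) \<longleftrightarrow> \<theta> (fst p) \<le> V (real_of_int (i + 2) * \<eta>) (fst p) (snd p)"
             "\<bar>V (real_of_int (i + 2) * \<eta>) (fst p) (snd p) - (B (fst p) (snd p) - real_of_int (i + 2) * \<eta>)\<bar> < \<eta>/2"
          by blast+
        have e: "real_of_int (i - 1) * \<eta> = real_of_int i * \<eta> - \<eta>"
          "real_of_int (i + 2) * \<eta> = real_of_int i * \<eta> + 2 * \<eta>" "(real_of_int i + 1) * \<eta> = real_of_int i * \<eta> + \<eta>"
          by (simp_all add: algebra_simps)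
        note 1 = 1[unfolded e] and 2 = 2[unfolded e] and i = i[unfolded e]
        have "\<theta> (fst p) \<le> V (real_of_int i * \<eta> - \<eta>) (fst p) (snd p)"
          using 1(2) i elim(2) by linarith
        then have lower: "real_of_int i * \<eta> - \<eta> \<le> X (fst p) (snd p)" using 1 by simp
        have "\<not> \<theta> (fst p) \<le> V (real_of_int i * \<eta> + 2 * \<eta>) (fst p) (snd p)"
          using 2(2) i elim(2) by linarith
        then have "X (fst p) (snd p) < real_of_int i * \<eta> + 2 * \<eta>" using 2 by simp
        with lower i \<open>2 * \<eta> < \<delta>\<close> \<open>\<eta> > 0\<close> show "\<bar>X (fst p) (snd p) - B (fst p) (snd p)\<bar> < \<delta>"
          by linarith
      qed
    qed
    then have "eventually_prob M (\<zeta>/2) (\<lambda>n \<omega>. \<bar>B n \<omega>\<bar> \<le> b \<longrightarrow> \<bar>X n \<omega> - B n \<omega>\<bar> < \<delta>)"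
      unfolding eventually_prob_filter using \<open>\<zeta> / 2 > 0\<close> by simp
    from eventually_prob_conj[OF b this]
    show "eventually_prob M \<zeta> (\<lambda>n \<omega>. dist (X (fst (n, \<omega>)) (snd (n, \<omega>)) - B (fst (n, \<omega>)) (snd (n, \<omega>))) 0 < \<delta>)"
      by (rule eventually_prob_mono) simp
  qed
qed

end

text \<open>This is the difference quotient of \<open>exp (- (a * t))\<close> at 0 with step
  \<open>1 / r n\<close>.\<close>

lemma mult_exp_minus_one_tendsto:
  fixes r :: "nat \<Rightarrow> real"
  assumes r: "filterlim r at_top sequentially"
  shows "(\<lambda>n. r n * (exp (- (a / r n)) - 1)) \<longlonglongrightarrow> - a"
proof -
  have "((\<lambda>t. exp (- (a * t))) has_real_derivative - a) (at 0)"
    by (auto intro!: derivative_eq_intros)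
  then have "((\<lambda>h. (exp (- (a * h)) - 1) / h) \<longlongrightarrow> - a) (at 0)"
    by (simp add: DERIV_def)
  moreover have "filterlim (\<lambda>n. inverse (r n)) (at 0) sequentially"
    using filterlim_compose[OF filterlim_inverse_at_right_top r] by (rule filterlim_mono) (simp_all add: at_within_le_at)
  ultimately have "(\<lambda>n. (exp (- (a * inverse (r n))) - 1) / inverse (r n)) \<longlonglongrightarrow> - a"
    by (rule filterlim_compose)
  then show ?thesis by (simp add: divide_inverse mult.commute)
qed

locale exponential_sample = prob_space M for M :: "'a measure" +
  fixes Q :: "nat \<Rightarrow> 'a \<Rightarrow> real" and N k :: "nat \<Rightarrow> nat"
  assumes indep: "indep_vars (\<lambda>_. borel) Q {1..}"
    and exponential: "\<And>i. i \<ge> 1 \<Longrightarrow> distributed M lborel (Q i) (exponential_density 1)"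
    and N_top: "filterlim N at_top sequentially"
    and k_top: "filterlim k at_top sequentially"
    and k_small: "(\<lambda>n. real (k n) / real (N n)) \<longlonglongrightarrow> 0"
begin

text \<open>Chosen so that the expected number of exceedances, \<open>N * exp (- level)\<close>, is
  \<open>k\<close>.\<close>

definition level :: "nat \<Rightarrow> real" where
  "level n = ln (real (N n) / real (k n))"

definition exceedances :: "real \<Rightarrow> nat \<Rightarrow> 'a \<Rightarrow> real" where
  "exceedances s n \<omega> = real (card {i \<in> {1..N n}. s \<le> Q i \<omega>})"

text \<open>The \<open>(k + 1)\<close>-th largest observation: the denominator of the Hill estimator
  on the exponential scale.\<close>

definition threshold :: "nat \<Rightarrow> 'a \<Rightarrow> real" where
  "threshold n \<omega> = order_stat (\<lambda>i. Q i \<omega>) (N n) (N n - k n)"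

definition count_fluct :: "nat \<Rightarrow> 'a \<Rightarrow> real" where
  "count_fluct n \<omega> = (exceedances (level n) n \<omega> - real (k n)) / sqrt (real (k n))"

definition tail_fluct :: "nat \<Rightarrow> 'a \<Rightarrow> real" where
  "tail_fluct n \<omega> = (\<Sum>i=1..N n. indicat_real {level n..} (Q i \<omega>) * (Q i \<omega> - level n - 1)) / sqrt (real (k n))"

lemma borel_measurable_Q: "i \<ge> 1 \<Longrightarrow> Q i \<in> borel_measurable M"
  using distributed_measurable[OF exponential] by simp

lemma k_real_top: "filterlim (\<lambda>n. real (k n)) at_top sequentially"
  by (rule filterlim_compose[OF filterlim_real_sequentially k_top])

lemma sqrt_k_top: "filterlim (\<lambda>n. sqrt (real (k n))) at_top sequentially"
  by (rule filterlim_compose[OF sqrt_at_top k_real_top])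

lemma inverse_sqrt_k: "(\<lambda>n. 1 / sqrt (real (k n))) \<longlonglongrightarrow> 0"
  using tendsto_inverse_0_at_top[OF sqrt_k_top] by (simp add: inverse_eq_divide)

lemma eventually_k: "\<forall>\<^sub>F n in sequentially. 0 < k n \<and> k n < N n"
proof -
  have "\<forall>\<^sub>F n in sequentially. 1 \<le> k n" "\<forall>\<^sub>F n in sequentially. 1 \<le> N n"
    using k_top N_top by (simp_all add: filterlim_at_top)
  moreover have "\<forall>\<^sub>F n in sequentially. real (k n) / real (N n) < 1"
    using k_small by (rule order_tendstoD) simp
  ultimately show ?thesis
    by eventually_elim (auto simp: pos_divide_less_eq)
qed

lemma level_top: "filterlim level at_top sequentially"
proof -
  have "filterlim (\<lambda>n. inverse (real (k n) / real (N n))) at_top sequentially"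
    using k_small by (rule filterlim_inverse_at_top) (use eventually_k in \<open>auto elim: eventually_mono\<close>)
  then show ?thesis unfolding level_def
    by (intro filterlim_compose[OF ln_at_top]) (simp add: inverse_eq_divide)
qed

lemma exp_level: "0 < k n \<Longrightarrow> k n < N n \<Longrightarrow> real (N n) * exp (- level n) = real (k n)"
  unfolding level_def by (simp add: exp_minus)

lemma level_nonneg: "0 < k n \<Longrightarrow> k n < N n \<Longrightarrow> 0 \<le> level n"
  unfolding level_def by simp

text \<open>By lack of memory each of the \<open>N\<close> summands has second moment
  \<open>k / N\<close> times that of \<open>\<phi>\<close> under the exponential law. Division by
  \<open>sqrt k\<close> therefore leaves a bound free of \<open>n\<close>, which serves tightness
  (fixed \<open>\<phi>\<close>) and negligibility (small \<open>\<phi>\<close>) alike.\<close>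

lemma sum_excess_second_moment:
  assumes n: "0 < k n" "k n < N n" and [measurable]: "\<phi> \<in> borel_measurable borel"
    and \<phi>2: "integrable std_exponential (\<lambda>x. (\<phi> x)\<^sup>2)"
  defines "X \<equiv> \<lambda>\<omega>. ((\<Sum>i=1..N n. indicat_real {level n..} (Q i \<omega>) * \<phi> (Q i \<omega> - level n)) -
      real (k n) * (LINT x|std_exponential. \<phi> x)) / sqrt (real (k n))"
  shows "X \<in> borel_measurable M \<and> integrable M (\<lambda>\<omega>. (X \<omega>)\<^sup>2) \<and>
    expectation (\<lambda>\<omega>. (X \<omega>)\<^sup>2) \<le> (LINT x|std_exponential. (\<phi> x)\<^sup>2)"
proof -
  interpret E: prob_space std_exponential by (rule prob_space_std_exponential)
  have D: "distributed std_exponential lborel (\<lambda>x. x) (exponential_density 1)"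
    by (simp add: distributed_def distr_id2)
  let ?y = "level n"
  let ?f = "\<lambda>x. indicat_real {?y..} x * \<phi> (x - ?y)"
  have y: "?y \<ge> 0" using n by (rule level_nonneg)
  have f2: "(?f x)\<^sup>2 = indicat_real {?y..} x * (\<phi> (x - ?y))\<^sup>2" for x by (simp add: indicator_def)
  have mean: "(LINT x|std_exponential. ?f x) = exp (- ?y) * (LINT x|std_exponential. \<phi> x)"
    by (rule E.exponential_excess_expectation[OF D y]) simp
  have int: "integrable std_exponential (\<lambda>x. (?f x)\<^sup>2)"
    unfolding f2 by (rule E.exponential_excess_integrable[OF D y _ \<phi>2]) simp
  have second: "(LINT x|std_exponential. (?f x)\<^sup>2) = exp (- ?y) * (LINT x|std_exponential. (\<phi> x)\<^sup>2)"
    unfolding f2 by (rule E.exponential_excess_expectation[OF D y]) simp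
  have Nk: "real (N n) * (exp (- ?y) * c) = real (k n) * c" for c
    using exp_level[OF n] by (simp add: mult.assoc[symmetric])
  note iid = second_moment_centred_iid_sum[OF indep exponential _ int, of "N n", unfolded mean second Nk]
  have X2: "(X \<omega>)\<^sup>2 = ((\<Sum>i=1..N n. ?f (Q i \<omega>)) - real (k n) * (LINT x|std_exponential. \<phi> x))\<^sup>2 / real (k n)" for \<omega>
    unfolding X_def by (simp add: power_divide)
  have "X \<in> borel_measurable M" unfolding X_def
    by (intro borel_measurable_divide borel_measurable_diff borel_measurable_sum borel_measurable_const
        borel_measurable_times measurable_compose[OF borel_measurable_Q]) auto
  moreover have "integrable M (\<lambda>\<omega>. (X \<omega>)\<^sup>2)" unfolding X2 using iid(1) by simp
  moreover have "expectation (\<lambda>\<omega>. (X \<omega>)\<^sup>2) \<le> (LINT x|std_exponential. (\<phi> x)\<^sup>2)"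
    unfolding X2 using iid(2) n by (simp add: pos_divide_le_eq mult.commute)
  ultimately show ?thesis by blast
qed

lemma exceedances_eq_sum: "exceedances s n \<omega> = (\<Sum>i=1..N n. indicat_real {s..} (Q i \<omega>))"
  by (simp add: exceedances_def indicator_def sum_of_bool_eq Int_def)

lemma count_fluct_bounded: "prob_bounded M count_fluct"
proof (rule prob_bounded_second_moment[where v = 1])
  show "\<forall>\<^sub>F n in sequentially. count_fluct n \<in> borel_measurable M \<and>
      integrable M (\<lambda>\<omega>. (count_fluct n \<omega>)\<^sup>2) \<and> expectation (\<lambda>\<omega>. (count_fluct n \<omega>)\<^sup>2) \<le> 1"
    using eventually_k
  proof eventually_elim
    case (elim n)
    interpret E: prob_space std_exponential by (rule prob_space_std_exponential)
    show ?case using sum_excess_second_moment[of n "\<lambda>_. 1"] elim E.prob_space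
      by (simp add: count_fluct_def[abs_def] exceedances_eq_sum)
  qed
qed

lemma tail_fluct_bounded: "prob_bounded M tail_fluct"
proof (rule prob_bounded_second_moment[where v = 1])
  show "\<forall>\<^sub>F n in sequentially. tail_fluct n \<in> borel_measurable M \<and>
      integrable M (\<lambda>\<omega>. (tail_fluct n \<omega>)\<^sup>2) \<and> expectation (\<lambda>\<omega>. (tail_fluct n \<omega>)\<^sup>2) \<le> 1"
    using eventually_k
  proof eventually_elim
    case (elim n)
    show ?case using sum_excess_second_moment[of n "\<lambda>x. x - 1"] elim std_exponential_centred
      by (simp add: tail_fluct_def[abs_def])
  qed
qed

lemma exceedances_ratio: "prob_lim M (\<lambda>n \<omega>. exceedances (level n) n \<omega> / real (k n)) 1"
proof -
  have "prob_lim M (\<lambda>n \<omega>. 1 / sqrt (real (k n)) * count_fluct n \<omega>) 0"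
    by (rule prob_lim_zero_mult_bounded[OF prob_lim_sequence[OF inverse_sqrt_k] count_fluct_bounded])
  then have "prob_lim M (\<lambda>n \<omega>. 1 / sqrt (real (k n)) * count_fluct n \<omega> + 1) 1"
    using tendsto_add[OF _ tendsto_const[of 1]] by fastforce
  moreover have "eventually (\<lambda>p. 1 / sqrt (real (k (fst p))) * count_fluct (fst p) (snd p) + 1 =
      exceedances (level (fst p)) (fst p) (snd p) / real (k (fst p))) (prob_filter M)"
    using eventually_prob_filter_sequentially[OF eventually_k] by eventually_elim (simp add: count_fluct_def field_simps)
  ultimately show ?thesis by (rule Lim_transform_eventually)
qed

text \<open>The process \<open>V\<close> of the crossing lemma: the centred exceedance count at a
  level moved by \<open>a\<close> on the scale \<open>1 / sqrt k\<close> of the threshold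
  fluctuations.\<close>

definition shifted_count :: "real \<Rightarrow> nat \<Rightarrow> 'a \<Rightarrow> real" where
  "shifted_count a n \<omega> = (exceedances (level n + a / sqrt (real (k n))) n \<omega> - real (k n)) / sqrt (real (k n))"

text \<open>The deterministic drift \<open>sqrt k * (exp (- h) - 1)\<close> tends to
  \<open>- a\<close>. The random part counts observations in the strip between the two levels, of
  probability \<open>(k / N) * \<bar>exp (- h) - 1\<bar>\<close>, so its variance after scaling
  tends to 0.\<close>

lemma shifted_count_expansion:
  "prob_lim M (\<lambda>n \<omega>. shifted_count a n \<omega> - (count_fluct n \<omega> - a)) 0"
proof -
  define h where "h n = a / sqrt (real (k n))" for n
  have h0: "h \<longlonglongrightarrow> 0"
    unfolding h_def using tendsto_mult[OF tendsto_const[of a] inverse_sqrt_k] by simp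
  define X where "X n \<omega> = (exceedances (level n + h n) n \<omega> - exceedances (level n) n \<omega>
      - real (k n) * (exp (- h n) - 1)) / sqrt (real (k n))" for n \<omega>
  have "prob_lim M X 0"
  proof (rule prob_lim_second_moment)
    show "(\<lambda>n. \<bar>exp (- h n) - 1\<bar>) \<longlonglongrightarrow> 0"
      using tendsto_rabs[OF tendsto_diff[OF tendsto_exp[OF tendsto_minus[OF h0]] tendsto_const[of 1]]] by simp
    \<comment> \<open>Together with \<open>\<bar>h n\<bar> < 1\<close> this keeps the shifted level
      nonnegative, where the exponential tail is exactly \<open>exp (- s)\<close>.\<close>
    have "\<forall>\<^sub>F n in sequentially. level n \<ge> 1" using level_top by (simp add: filterlim_at_top)
    moreover have "\<forall>\<^sub>F n in sequentially. \<bar>h n\<bar> < 1" using tendstoD[OF h0 zero_less_one] by simp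
    ultimately show "\<forall>\<^sub>F n in sequentially. X n \<in> borel_measurable M \<and> integrable M (\<lambda>\<omega>. (X n \<omega>)\<^sup>2) \<and>
        expectation (\<lambda>\<omega>. (X n \<omega>)\<^sup>2) \<le> \<bar>exp (- h n) - 1\<bar>"
      using eventually_k
    proof eventually_elim
      case (elim n)
      define y z where "y = level n" and "z = level n + h n"
      have yz: "0 \<le> y" "0 \<le> z" using elim by (auto simp: y_def z_def)
      let ?f = "\<lambda>x. indicat_real {z..} x - indicat_real {y..} x"
      interpret E: prob_space std_exponential by (rule prob_space_std_exponential)
      have D: "distributed std_exponential lborel (\<lambda>x. x) (exponential_density 1)"
        by (simp add: distributed_def distr_id2)
      have ind: "integrable std_exponential (indicat_real {s..})" "(LINT x|std_exponential. indicat_real {s..} x) = exp (- s)"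
        if "s \<ge> 0" for s
        using E.exponential_excess_integrable[OF D that, of "\<lambda>_. 1"]
          E.exponential_excess_expectation[OF D that, of "\<lambda>_. 1"] E.prob_space by simp_all
      have f2: "(?f x)\<^sup>2 = indicat_real {min y z..} x - indicat_real {max y z..} x" for x
        by (auto simp: indicator_def)
      have int: "integrable std_exponential (\<lambda>x. (?f x)\<^sup>2)"
        unfolding f2 using yz by (intro Bochner_Integration.integrable_diff ind) auto
      have ez: "exp (- z) = exp (- y) * exp (- h n)" by (simp add: z_def y_def exp_add[symmetric])
      have mean: "(LINT x|std_exponential. ?f x) = exp (- y) * (exp (- h n) - 1)"
        using ind[OF yz(1)] ind[OF yz(2)] by (simp add: ez algebra_simps)
      have "(LINT x|std_exponential. (?f x)\<^sup>2) = exp (- min y z) - exp (- max y z)"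
        unfolding f2 using ind[of "min y z"] ind[of "max y z"] yz by simp
      also have "\<dots> = \<bar>exp (- z) - exp (- y)\<bar>" by (auto simp: min_def max_def)
      also have "\<dots> = \<bar>exp (- y) * (exp (- h n) - 1)\<bar>" unfolding ez by (simp add: algebra_simps)
      also have "\<dots> = exp (- y) * \<bar>exp (- h n) - 1\<bar>" by (simp add: abs_mult)
      finally have second: "(LINT x|std_exponential. (?f x)\<^sup>2) = exp (- y) * \<bar>exp (- h n) - 1\<bar>" .
      have Nk: "real (N n) * (exp (- y) * c) = real (k n) * c" for c
        using exp_level[of n] elim by (simp add: y_def mult.assoc[symmetric])
      note iid = second_moment_centred_iid_sum[OF indep exponential _ int, of "N n", unfolded mean second Nk]
      have X: "X n \<omega> = ((\<Sum>i=1..N n. ?f (Q i \<omega>)) - real (k n) * (exp (- h n) - 1)) / sqrt (real (k n))" for \<omega>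
        unfolding X_def exceedances_eq_sum by (simp add: sum_subtractf y_def z_def)
      have X2: "(X n \<omega>)\<^sup>2 = ((\<Sum>i=1..N n. ?f (Q i \<omega>)) - real (k n) * (exp (- h n) - 1))\<^sup>2 / real (k n)" for \<omega>
        unfolding X by (simp add: power_divide)
      have "X n \<in> borel_measurable M" unfolding X[abs_def]
        by (intro borel_measurable_divide borel_measurable_diff borel_measurable_sum borel_measurable_const
            measurable_compose[OF borel_measurable_Q]) auto
      moreover have "integrable M (\<lambda>\<omega>. (X n \<omega>)\<^sup>2)" unfolding X2 using iid(1) by simp
      moreover have "expectation (\<lambda>\<omega>. (X n \<omega>)\<^sup>2) \<le> \<bar>exp (- h n) - 1\<bar>"
        unfolding X2 using iid(2) elim by (simp add: pos_divide_le_eq mult.commute)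
      ultimately show ?case by blast
    qed
  qed
  moreover have "(\<lambda>n. sqrt (real (k n)) * (exp (- h n) - 1) + a) \<longlonglongrightarrow> - a + a"
    unfolding h_def by (intro tendsto_add tendsto_const mult_exp_minus_one_tendsto sqrt_k_top)
  note tendsto_add[OF calculation prob_lim_sequence[OF this]]
  then have lim: "prob_lim M (\<lambda>n \<omega>. X n \<omega> + (sqrt (real (k n)) * (exp (- h n) - 1) + a)) 0" by simp
  have "shifted_count a n \<omega> - (count_fluct n \<omega> - a) = X n \<omega> + (sqrt (real (k n)) * (exp (- h n) - 1) + a)" for n \<omega>
  proof -
    have "real (k n) * (exp (- h n) - 1) / sqrt (real (k n)) = sqrt (real (k n)) * (exp (- h n) - 1)"
      by (metis times_divide_eq_left real_div_sqrt of_nat_0_le_iff)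
    then show ?thesis
      unfolding shifted_count_def count_fluct_def X_def h_def[symmetric] by (simp add: diff_divide_distrib)
  qed
  then show ?thesis using lim by (simp only:)
qed

text \<open>The normalised threshold is at least \<open>a\<close> exactly when the shifted level is
  reached \<open>k + 1\<close> times; the crossing lemma then inverts the expansion of the shifted
  count.\<close>

lemma threshold_expansion:
  "prob_lim M (\<lambda>n \<omega>. sqrt (real (k n)) * (threshold n \<omega> - level n) - count_fluct n \<omega>) 0"
proof (rule prob_lim_of_crossings[OF count_fluct_bounded shifted_count_expansion inverse_sqrt_k])
  fix a
  show "eventually (\<lambda>p. (a \<le> sqrt (real (k (fst p))) * (threshold (fst p) (snd p) - level (fst p))) \<longleftrightarrow>
      (1 / sqrt (real (k (fst p))) \<le> shifted_count a (fst p) (snd p))) (prob_filter M)"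
    using eventually_prob_filter_sequentially[OF eventually_k]
  proof eventually_elim
    case (elim p)
    obtain n \<omega> where p: "p = (n, \<omega>)" by (cases p)
    have r: "sqrt (real (k n)) > 0" and kn: "k n < N n" using elim by (simp_all add: p)
    have "a \<le> sqrt (real (k n)) * (threshold n \<omega> - level n) \<longleftrightarrow> level n + a / sqrt (real (k n)) \<le> threshold n \<omega>"
      using r by (simp add: field_simps)
    \<comment> \<open>The threshold has rank \<open>N - k\<close> from below, so
      \<open>k + 1\<close> observations must reach the level; the extra 1 becomes
      \<open>\<theta> = 1 / sqrt k\<close>.\<close>
    also have "\<dots> \<longleftrightarrow> real (k n) + 1 \<le> exceedances (level n + a / sqrt (real (k n))) n \<omega>"
      unfolding threshold_def exceedances_def using kn by (subst order_stat_ge_iff) auto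
    also have "\<dots> \<longleftrightarrow> 1 / sqrt (real (k n)) \<le> shifted_count a n \<omega>"
      unfolding shifted_count_def using r by (simp add: divide_le_cancel le_diff_eq add.commute)
    finally show ?case by (simp add: p)
  qed
qed

lemma threshold_fluct_bounded: "prob_bounded M (\<lambda>n \<omega>. sqrt (real (k n)) * (threshold n \<omega> - level n))"
  using prob_bounded_add[OF prob_lim_imp_bounded[OF threshold_expansion] count_fluct_bounded] by simp

lemma threshold_minus_level: "prob_lim M (\<lambda>n \<omega>. threshold n \<omega> - level n) 0"
proof (rule Lim_transform_eventually)
  show "prob_lim M (\<lambda>n \<omega>. 1 / sqrt (real (k n)) * (sqrt (real (k n)) * (threshold n \<omega> - level n))) 0"
    by (rule prob_lim_zero_mult_bounded[OF prob_lim_sequence[OF inverse_sqrt_k] threshold_fluct_bounded])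
  show "eventually (\<lambda>p. 1 / sqrt (real (k (fst p))) * (sqrt (real (k (fst p))) * (threshold (fst p) (snd p) - level (fst p)))
      = threshold (fst p) (snd p) - level (fst p)) (prob_filter M)"
    using eventually_prob_filter_sequentially[OF eventually_k] by eventually_elim simp
qed

end

section \<open>Expansion of the Hill estimator of one sample\<close>

context exponential_sample
begin

text \<open>The linear case \<open>u s = s\<close>. Moving the threshold costs
  \<open>sqrt k * (threshold - level)\<close>, up to a product of a null and a tight sequence, and
  this is asymptotically the count fluctuation; excess minus count at the level is
  \<open>tail_fluct\<close>.\<close>

lemma exponential_hill_expansion:
  "prob_lim M (\<lambda>n \<omega>. sqrt (real (k n)) * ((\<Sum>i=1..N n. max 0 (Q i \<omega> - threshold n \<omega>)) / real (k n) - 1)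
    - tail_fluct n \<omega>) 0"
proof -
  define T where "T n \<omega> s = (\<Sum>i=1..N n. max 0 (Q i \<omega> - s))" for n \<omega> and s :: real
  define E where "E n \<omega> = (T n \<omega> (threshold n \<omega>) - T n \<omega> (level n) + real (k n) * (threshold n \<omega> - level n)) / sqrt (real (k n))" for n \<omega>
  define D where "D n \<omega> = sqrt (real (k n)) * (threshold n \<omega> - level n) - count_fluct n \<omega>" for n \<omega>
  have "prob_lim M (\<lambda>n \<omega>. (threshold n \<omega> - level n) * count_fluct n \<omega>) 0"
    by (rule prob_lim_zero_mult_bounded[OF threshold_minus_level count_fluct_bounded])
  then have lim0: "prob_lim M (\<lambda>n \<omega>. \<bar>(threshold n \<omega> - level n) * count_fluct n \<omega>\<bar>) 0"
    by (rule tendsto_rabs_zero)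
  have "prob_lim M E 0"
  proof (rule Lim_null_comparison[OF _ lim0])
    show "\<forall>\<^sub>F p in prob_filter M. norm (E (fst p) (snd p)) \<le> abs ((threshold (fst p) (snd p) - level (fst p)) * count_fluct (fst p) (snd p))"
      using eventually_prob_filter_sequentially[OF eventually_k]
    proof eventually_elim
      case (elim p)
      obtain n \<omega> where p: "p = (n, \<omega>)" by (cases p)
      have "\<bar>E n \<omega>\<bar> \<le> \<bar>exceedances (level n) n \<omega> - real (k n)\<bar> * \<bar>threshold n \<omega> - level n\<bar> / sqrt (real (k n))"
        unfolding E_def T_def exceedances_def threshold_def abs_divide real_sqrt_abs2
        using top_sum_change_threshold[of "k n" "N n" "\<lambda>i. Q i \<omega>" "level n"] elim
        by (simp add: p divide_right_mono)
      then show ?case by (simp add: p count_fluct_def abs_mult mult.commute)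
    qed
  qed
  then have "prob_lim M (\<lambda>n \<omega>. E n \<omega> - D n \<omega>) (0 - 0)"
    unfolding D_def by (intro tendsto_diff threshold_expansion)
  moreover have "eventually (\<lambda>p. E (fst p) (snd p) - D (fst p) (snd p) = sqrt (real (k (fst p))) *
      ((\<Sum>i=1..N (fst p). max 0 (Q i (snd p) - threshold (fst p) (snd p))) / real (k (fst p)) - 1)
      - tail_fluct (fst p) (snd p)) (prob_filter M)"
    using eventually_prob_filter_sequentially[OF eventually_k]
  proof eventually_elim
    case (elim p)
    obtain n \<omega> where p: "p = (n, \<omega>)" by (cases p)
    define r where "r = sqrt (real (k n))"
    have r: "r > 0" "real (k n) = r * r" using elim by (auto simp: r_def p)
    have "(\<Sum>i=1..N n. indicat_real {level n..} (Q i \<omega>) * (Q i \<omega> - level n - 1)) = T n \<omega> (level n) - exceedances (level n) n \<omega>"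
      unfolding T_def exceedances_eq_sum sum_subtractf[symmetric]
      by (intro sum.cong refl) (auto simp: indicator_def max_def)
    then have tf: "tail_fluct n \<omega> = (T n \<omega> (level n) - exceedances (level n) n \<omega>) / r"
      unfolding tail_fluct_def r_def by simp
    show ?case
      unfolding p fst_conv snd_conv E_def D_def count_fluct_def T_def[symmetric] tf r_def[symmetric] r(2)
      using r(1) by (simp add: field_simps)
  qed
  ultimately show ?thesis by (simp add: Lim_transform_eventually)
qed

text \<open>The part \<open>\<gamma> * s\<close> of \<open>u\<close> is covered by the exponential
  case. The part \<open>g\<close> is treated at the fixed level, where its normalised sum has mean
  tending to \<open>lam / (1 - \<rho>)\<close> and variance of order \<open>A\<^sup>2\<close>, and
  is then carried over to the random threshold.\<close>

lemma hill_expansion: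
  fixes u A :: "real \<Rightarrow> real"
  assumes u: "mono u"
    and lim: "\<And>x. ((\<lambda>s. (u (s + x) - u s - \<gamma> * x) / A s) \<longlongrightarrow> second_order_limit \<rho> x) at_top"
    and sgn: "\<forall>\<^sub>F s in at_top. sgn (A s) = c"
    and "\<rho> \<le> 0"
    and A0: "(A \<longlongrightarrow> 0) at_top"
    and lam: "(\<lambda>n. sqrt (real (k n)) * A (level n)) \<longlonglongrightarrow> lam"
  shows "prob_lim M (\<lambda>n \<omega>. sqrt (real (k n)) * ((\<Sum>i=1..N n. max 0 (u (Q i \<omega>) - u (threshold n \<omega>))) / real (k n) - \<gamma>)
    - \<gamma> * tail_fluct n \<omega>) (lam / (1 - \<rho>))"
proof -
  define g where "g s = u s - \<gamma> * s" for s
  have [measurable]: "u \<in> borel_measurable borel" using u by (rule borel_measurable_mono)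
  have [measurable]: "g \<in> borel_measurable borel" unfolding g_def by measurable
  have lim': "((\<lambda>s. (g (s + x) - g s) / A s) \<longlongrightarrow> second_order_limit \<rho> x) at_top" for x
    using lim[of x] unfolding g_def by (simp add: algebra_simps)
  have unif: "uniform_limit {-1..1} (\<lambda>s x. (g (s + x) - g s) / A s) (second_order_limit \<rho>) at_top"
    by (rule second_order_uniform_limit[OF _ lim' sgn]) simp
  obtain C s0 where Potter: "\<And>s x. s \<ge> s0 \<Longrightarrow> x \<ge> 0 \<Longrightarrow> \<bar>g (s + x) - g s\<bar> \<le> C * \<bar>A s\<bar> * exp (x / 4)"
    using second_order_Potter_bound[OF _ lim' sgn \<open>\<rho> \<le> 0\<close>] by auto
  \<comment> \<open>Division by 0 gives 0, whereas the increment over 1, divided by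
    \<open>A\<close>, has a nonzero limit.\<close>
  have A_nz: "\<forall>\<^sub>F s in at_top. A s \<noteq> 0"
  proof -
    have "\<forall>\<^sub>F s in at_top. (g (s + 1) - g s) / A s \<noteq> 0"
      by (rule tendsto_imp_eventually_ne[OF lim' second_order_limit_1_neq_0])
    then show ?thesis by eventually_elim auto
  qed
  have ev_level: "\<forall>\<^sub>F n in sequentially. level n \<ge> s0 \<and> A (level n) \<noteq> 0"
    using level_top eventually_compose_filterlim[OF A_nz level_top] unfolding filterlim_at_top
    by (auto intro: eventually_conj)
  define \<phi> where "\<phi> n x = g (level n + x) - g (level n)" for n x
  have \<phi>_m [measurable]: "\<phi> n \<in> borel_measurable borel" for n unfolding \<phi>_def by measurable
  define G where "G n \<omega> s = (\<Sum>i=1..N n. indicat_real {s..} (Q i \<omega>) * (g (Q i \<omega>) - g s)) / sqrt (real (k n))" for n \<omega> s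
  let ?\<mu> = "\<lambda>n. LINT x|std_exponential. \<phi> n x"

  \<comment> \<open>The increments divided by \<open>A\<close> converge pointwise and are dominated
    by the Potter bound, where \<open>exp (x / 4)\<close> is integrable; the factor
    \<open>sqrt k * A (level)\<close> then contributes \<open>lam\<close>.\<close>
  have mean: "(\<lambda>n. sqrt (real (k n)) * ?\<mu> n) \<longlonglongrightarrow> lam * (1 / (1 - \<rho>))"
  proof -
    have "((\<lambda>s. LINT x|std_exponential. (g (s + x) - g s) / A s) \<longlongrightarrow> (LINT x|std_exponential. second_order_limit \<rho> x)) at_top"
    proof (rule integral_dominated_convergence_at_top[where w = "\<lambda>x. \<bar>C\<bar> * exp (1/4 * x)"])
      show "second_order_limit \<rho> \<in> borel_measurable std_exponential"
        using borel_measurable_continuous_onI[OF continuous_on_second_order_limit] by simp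
      show "AE x in std_exponential. ((\<lambda>s. (g (s + x) - g s) / A s) \<longlongrightarrow> second_order_limit \<rho> x) at_top"
        using lim' by simp
      show "integrable std_exponential (\<lambda>x. \<bar>C\<bar> * exp (1/4 * x))"
        by (intro integrable_mult_right std_exponential_exp) simp
      show "\<forall>\<^sub>F s in at_top. AE x in std_exponential. norm ((g (s + x) - g s) / A s) \<le> \<bar>C\<bar> * exp (1/4 * x)"
        using A_nz eventually_ge_at_top[of s0]
      proof eventually_elim
        case (elim s)
        show ?case using AE_std_exponential_nonneg
        proof eventually_elim
          case (elim x)
          have "\<bar>g (s + x) - g s\<bar> \<le> C * \<bar>A s\<bar> * exp (x / 4)" using Potter elim \<open>s0 \<le> s\<close> by simp
          also have "\<dots> \<le> \<bar>C\<bar> * \<bar>A s\<bar> * exp (x / 4)" by (intro mult_right_mono) auto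
          finally show ?case using \<open>A s \<noteq> 0\<close> by (simp add: abs_divide pos_divide_le_eq mult_ac)
        qed
      qed
    qed simp
    from filterlim_compose[OF this level_top]
    have "(\<lambda>n. sqrt (real (k n)) * A (level n) * (?\<mu> n / A (level n))) \<longlonglongrightarrow> lam * (1 / (1 - \<rho>))"
      unfolding std_exponential_second_order_limit[OF \<open>\<rho> \<le> 0\<close>] \<phi>_def by (intro tendsto_mult lam) simp
    then show ?thesis
      by (rule Lim_transform_eventually) (use ev_level in \<open>auto elim: eventually_mono\<close>)
  qed
  have "prob_lim M (\<lambda>n \<omega>. G n \<omega> (level n) - sqrt (real (k n)) * ?\<mu> n) 0"
  proof (rule prob_lim_second_moment)
    have "(\<lambda>n. C\<^sup>2 * (A (level n))\<^sup>2 * 2) \<longlonglongrightarrow> C\<^sup>2 * 0\<^sup>2 * 2"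
      by (intro tendsto_intros filterlim_compose[OF A0 level_top])
    then show "(\<lambda>n. C\<^sup>2 * (A (level n))\<^sup>2 * 2) \<longlonglongrightarrow> 0" by simp
    show "\<forall>\<^sub>F n in sequentially. (\<lambda>\<omega>. G n \<omega> (level n) - sqrt (real (k n)) * ?\<mu> n) \<in> borel_measurable M \<and>
        integrable M (\<lambda>\<omega>. (G n \<omega> (level n) - sqrt (real (k n)) * ?\<mu> n)\<^sup>2) \<and>
        expectation (\<lambda>\<omega>. (G n \<omega> (level n) - sqrt (real (k n)) * ?\<mu> n)\<^sup>2) \<le> C\<^sup>2 * (A (level n))\<^sup>2 * 2"
      using ev_level eventually_k
    proof eventually_elim
      case (elim n)
      \<comment> \<open>The squared Potter bound; the integral of \<open>exp (x / 2)\<close> under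
        the exponential law is \<open>1 / (1 - 1/2) = 2\<close>.\<close>
      let ?w = "\<lambda>x. C\<^sup>2 * (A (level n))\<^sup>2 * exp (1/2 * x)"
      have w: "integrable std_exponential ?w" "(LINT x|std_exponential. ?w x) = C\<^sup>2 * (A (level n))\<^sup>2 * 2"
        using std_exponential_exp[of "1/2"] by simp_all
      have "AE x in std_exponential. (\<phi> n x)\<^sup>2 \<le> ?w x"
        using AE_std_exponential_nonneg
      proof eventually_elim
        case (elim x)
        have "\<bar>\<phi> n x\<bar> \<le> C * \<bar>A (level n)\<bar> * exp (x / 4)" unfolding \<phi>_def using Potter elim \<open>level n \<ge> s0 \<and> _\<close> by simp
        then have "(\<phi> n x)\<^sup>2 \<le> (C * \<bar>A (level n)\<bar> * exp (x / 4))\<^sup>2" by (rule abs_le_square_iff[THEN iffD1, OF order_trans]) simp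
        also have "\<dots> = ?w x" by (simp add: power_mult_distrib exp_double[symmetric])
        finally show ?case .
      qed
      note le = this
      have int: "integrable std_exponential (\<lambda>x. (\<phi> n x)\<^sup>2)"
      proof (rule Bochner_Integration.integrable_bound[OF w(1)])
        show "AE x in std_exponential. norm ((\<phi> n x)\<^sup>2) \<le> norm (?w x)"
          using le by eventually_elim simp
      qed simp
      moreover have "(LINT x|std_exponential. (\<phi> n x)\<^sup>2) \<le> C\<^sup>2 * (A (level n))\<^sup>2 * 2"
        using integral_mono_AE[OF int w(1) le] unfolding w(2) .
      moreover have "sqrt (real (k n)) * c = real (k n) * c / sqrt (real (k n))" for c
        by (metis times_divide_eq_left real_div_sqrt of_nat_0_le_iff)
      ultimately show ?case
        using sum_excess_second_moment[of n "\<phi> n"] elim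
        unfolding G_def diff_divide_distrib \<phi>_def by (auto intro: order_trans)
    qed
  qed
  then have "prob_lim M (\<lambda>n \<omega>. (G n \<omega> (level n) - sqrt (real (k n)) * ?\<mu> n) + sqrt (real (k n)) * ?\<mu> n) (0 + lam * (1 / (1 - \<rho>)))"
    by (rule tendsto_add[OF _ prob_lim_sequence[OF mean]])
  then have G_level: "prob_lim M (\<lambda>n \<omega>. G n \<omega> (level n)) (lam / (1 - \<rho>))" by simp

  have G_diff: "prob_lim M (\<lambda>n \<omega>. G n \<omega> (threshold n \<omega>) - G n \<omega> (level n)) 0"
  proof (rule tendstoI)
    fix \<eta> :: real assume "\<eta> > 0"
    \<comment> \<open>The change of threshold costs
      \<open>2 * (e * \<bar>A\<bar>) * (3 * k) / sqrt k\<close>, the 3 coming from fewer than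
      \<open>2 * k\<close> exceedances plus \<open>k\<close>. With
      \<open>sqrt k * \<bar>A\<bar> < \<bar>lam\<bar> + 1\<close> this is at most
      \<open>6 * (\<eta> / 8)\<close>.\<close>
    define e where "e = \<eta> / (8 * (\<bar>lam\<bar> + 1))"
    have "e > 0" unfolding e_def using \<open>\<eta> > 0\<close> by (intro divide_pos_pos) auto
    have "x \<noteq> 0 \<Longrightarrow> \<eta> / (8 * x) * x = \<eta> / 8" for x by simp
    then have "e * (\<bar>lam\<bar> + 1) = \<eta> / 8" unfolding e_def by this linarith
    \<comment> \<open>The limit function vanishes at 0, so by uniform convergence increments over
      short distances are small even relative to \<open>A\<close>.\<close>
    have "isCont (second_order_limit \<rho>) 0"
      using continuous_on_second_order_limit[of UNIV] by (simp add: continuous_on_eq_continuous_at)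
    then obtain d0 where d0: "d0 > 0" "\<And>v. \<bar>v\<bar> < d0 \<Longrightarrow> \<bar>second_order_limit \<rho> v\<bar> < e/2"
      using \<open>e > 0\<close> unfolding continuous_at_eps_delta dist_real_def by (metis half_gt_zero diff_zero second_order_limit_0)
    define d where "d = min (d0 / 2) 1"
    have "d > 0" "d < d0" "d \<le> 1" using d0 by (auto simp: d_def)
    have "\<forall>\<^sub>F s in at_top. \<forall>v\<in>{-1..1}. dist ((g (s + v) - g s) / A s) (second_order_limit \<rho> v) < e / 2"
      using uniform_limitD[OF unif, of "e/2"] \<open>e > 0\<close> by simp
    from eventually_compose_filterlim[OF this level_top]
    have "\<forall>\<^sub>F n in sequentially. \<forall>v\<in>{-d..d}. \<bar>g (level n + v) - g (level n)\<bar> \<le> e * \<bar>A (level n)\<bar>"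
      using ev_level
    proof eventually_elim
      case (elim n)
      show ?case
      proof
        fix v assume v: "v \<in> {-d..d}"
        then have "\<bar>second_order_limit \<rho> v\<bar> < e/2" "v \<in> {-1..1}" using d0(2)[of v] \<open>d < d0\<close> \<open>d \<le> 1\<close> by auto
        moreover from this elim(1) have "\<bar>(g (level n + v) - g (level n)) / A (level n) - second_order_limit \<rho> v\<bar> < e/2"
          unfolding dist_real_def by blast
        ultimately have "\<bar>(g (level n + v) - g (level n)) / A (level n)\<bar> \<le> e" by linarith
        then show "\<bar>g (level n + v) - g (level n)\<bar> \<le> e * \<bar>A (level n)\<bar>"
          using elim(2) by (simp add: abs_divide pos_divide_le_eq)
      qed
    qed
    moreover have "\<forall>\<^sub>F n in sequentially. sqrt (real (k n)) * \<bar>A (level n)\<bar> < \<bar>lam\<bar> + 1"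
      using order_tendstoD(2)[OF tendsto_rabs[OF lam], of "\<bar>lam\<bar> + 1"] by (simp add: abs_mult)
    ultimately have "\<forall>\<^sub>F n in sequentially. (0 < k n \<and> k n < N n) \<and>
        (\<forall>v\<in>{-d..d}. \<bar>g (level n + v) - g (level n)\<bar> \<le> e * \<bar>A (level n)\<bar>) \<and>
        sqrt (real (k n)) * \<bar>A (level n)\<bar> < \<bar>lam\<bar> + 1"
      using eventually_k by eventually_elim blast
    then have "eventually (\<lambda>p. (0 < k (fst p) \<and> k (fst p) < N (fst p)) \<and>
        (\<forall>v\<in>{-d..d}. \<bar>g (level (fst p) + v) - g (level (fst p))\<bar> \<le> e * \<bar>A (level (fst p))\<bar>) \<and>
        sqrt (real (k (fst p))) * \<bar>A (level (fst p))\<bar> < \<bar>lam\<bar> + 1) (prob_filter M)"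
      by (rule eventually_prob_filter_sequentially)
    moreover have "eventually (\<lambda>p. \<bar>threshold (fst p) (snd p) - level (fst p)\<bar> < d) (prob_filter M)"
      using tendstoD[OF threshold_minus_level \<open>d > 0\<close>] by simp
    moreover have "eventually (\<lambda>p. exceedances (level (fst p)) (fst p) (snd p) / real (k (fst p)) < 2) (prob_filter M)"
      by (rule order_tendstoD(2)[OF exceedances_ratio]) simp
    ultimately show "\<forall>\<^sub>F p in prob_filter M. dist (G (fst p) (snd p) (threshold (fst p) (snd p)) - G (fst p) (snd p) (level (fst p))) 0 < \<eta>"
    proof eventually_elim
      case (elim p)
      obtain n \<omega> where p: "p = (n, \<omega>)" by (cases p)
      define r where "r = sqrt (real (k n))"
      have r: "r > 0" "real (k n) = r * r" using elim(1) by (auto simp: r_def p)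
      have C: "exceedances (level n) n \<omega> < 2 * real (k n)" using elim(1,3) by (simp add: p pos_divide_less_eq)
      have "\<bar>(\<Sum>i=1..N n. indicat_real {threshold n \<omega>..} (Q i \<omega>) * (g (Q i \<omega>) - g (threshold n \<omega>)))
          - (\<Sum>i=1..N n. indicat_real {level n..} (Q i \<omega>) * (g (Q i \<omega>) - g (level n)))\<bar>
        \<le> 2 * (e * \<bar>A (level n)\<bar>) * (exceedances (level n) n \<omega> + real (k n))"
        unfolding threshold_def exceedances_def
      proof (rule top_increment_sum_change_threshold)
        show "k n < N n" using elim(1) by (simp add: p)
        fix v assume "\<bar>v\<bar> \<le> \<bar>order_stat (\<lambda>i. Q i \<omega>) (N n) (N n - k n) - level n\<bar>"
        then have "v \<in> {-d..d}" using elim(2) by (auto simp: p threshold_def)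
        then show "\<bar>g (level n + v) - g (level n)\<bar> \<le> e * \<bar>A (level n)\<bar>" using elim(1) by (simp add: p)
      qed
      also have "\<dots> \<le> 2 * (e * \<bar>A (level n)\<bar>) * (3 * real (k n))"
        using C \<open>e > 0\<close> by (intro mult_left_mono) auto
      also have "\<dots> = 6 * e * (r * \<bar>A (level n)\<bar>) * r" unfolding r(2) by simp
      also have "\<dots> \<le> 6 * e * (\<bar>lam\<bar> + 1) * r"
        using elim(1) r(1) \<open>e > 0\<close> by (intro mult_right_mono mult_left_mono) (auto simp: r_def p)
      also have "\<dots> = 6 * (\<eta> / 8) * r" using \<open>e * (\<bar>lam\<bar> + 1) = \<eta> / 8\<close> by simp
      also have "\<dots> < \<eta> * r" using r(1) \<open>\<eta> > 0\<close> by simp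
      finally show ?case
        unfolding p G_def r_def[symmetric] fst_conv snd_conv diff_divide_distrib[symmetric] dist_real_def
        using r(1) by (simp add: abs_divide pos_divide_less_eq)
    qed
  qed

  have split: "(\<Sum>i=1..n. max 0 (u (q i) - u z)) =
      \<gamma> * (\<Sum>i=1..n. max 0 (q i - z)) + (\<Sum>i=1..n. indicat_real {z..} (q i) * (g (q i) - g z))"
    for n and q :: "nat \<Rightarrow> real" and z
  proof -
    have "max 0 (u (q i) - u z) = \<gamma> * max 0 (q i - z) + indicat_real {z..} (q i) * (g (q i) - g z)" for i
    proof (cases "z \<le> q i")
      case True
      then show ?thesis using monoD[OF u, of z "q i"] by (simp add: g_def algebra_simps)
    next
      case False
      then show ?thesis using monoD[OF u, of "q i" z] by simp
    qed
    then show ?thesis by (simp add: sum.distrib sum_distrib_left)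
  qed
  define X where "X n \<omega> = sqrt (real (k n)) * ((\<Sum>i=1..N n. max 0 (Q i \<omega> - threshold n \<omega>)) / real (k n) - 1) - tail_fluct n \<omega>" for n \<omega>
  have "prob_lim M (\<lambda>n \<omega>. \<gamma> * X n \<omega> + (G n \<omega> (threshold n \<omega>) - G n \<omega> (level n)) + G n \<omega> (level n)) (\<gamma> * 0 + 0 + lam / (1 - \<rho>))"
    unfolding X_def by (intro tendsto_add tendsto_mult tendsto_const G_diff G_level exponential_hill_expansion)
  then have "prob_lim M (\<lambda>n \<omega>. \<gamma> * X n \<omega> + (G n \<omega> (threshold n \<omega>) - G n \<omega> (level n)) + G n \<omega> (level n)) (lam / (1 - \<rho>))"
    by simp
  moreover have "eventually (\<lambda>p. \<gamma> * X (fst p) (snd p) + (G (fst p) (snd p) (threshold (fst p) (snd p)) - G (fst p) (snd p) (level (fst p)))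
      + G (fst p) (snd p) (level (fst p)) = sqrt (real (k (fst p))) * ((\<Sum>i=1..N (fst p). max 0 (u (Q i (snd p)) - u (threshold (fst p) (snd p)))) / real (k (fst p)) - \<gamma>)
    - \<gamma> * tail_fluct (fst p) (snd p)) (prob_filter M)"
    using eventually_prob_filter_sequentially[OF eventually_k]
  proof eventually_elim
    case (elim p)
    define r where "r = sqrt (real (k (fst p)))"
    have r: "r > 0" "real (k (fst p)) = r * r" using elim by (auto simp: r_def)
    show ?case
      unfolding split X_def G_def r_def[symmetric] r(2) using r(1) by (simp add: field_simps)
  qed
  ultimately show ?thesis by (rule Lim_transform_eventually)
qed

end

section \<open>Passage from errors to residuals\<close>

context exponential_sample
begin

lemma threshold_large: "eventually (\<lambda>p. s0 \<le> threshold (fst p) (snd p)) (prob_filter M)"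
proof -
  have "eventually (\<lambda>p. dist (threshold (fst p) (snd p) - level (fst p)) 0 < 1) (prob_filter M)"
    by (rule tendstoD[OF threshold_minus_level zero_less_one])
  moreover have "\<forall>\<^sub>F n in sequentially. s0 + 1 \<le> level n" using level_top by (simp add: filterlim_at_top)
  then have "eventually (\<lambda>p. s0 + 1 \<le> level (fst p)) (prob_filter M)"
    by (rule eventually_prob_filter_sequentially)
  ultimately show ?thesis by eventually_elim (auto simp: dist_real_def)
qed

text \<open>The threshold exceeds \<open>s0\<close> with high probability, so its quantile is at
  least 1 and \<open>hill_perturb\<close> applies. The price is \<open>8 * sqrt k\<close> times the
  maximal relative error, which \<open>res\<close> makes negligible.\<close>

lemma residual_hill_expansion:
  fixes q u A :: "real \<Rightarrow> real" and e :: "nat \<Rightarrow> 'a \<Rightarrow> real" and r :: "nat \<Rightarrow> nat \<Rightarrow> 'a \<Rightarrow> real"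
  assumes q: "mono_on {0<..} q"
    and u: "mono u" "\<And>s. s0 \<le> s \<Longrightarrow> 1 \<le> q s \<and> u s = ln (q s)"
    and lim: "\<And>x. ((\<lambda>s. (u (s + x) - u s - \<gamma> * x) / A s) \<longlongrightarrow> second_order_limit \<rho> x) at_top"
    and sgn: "\<forall>\<^sub>F s in at_top. sgn (A s) = c"
    and "\<rho> \<le> 0"
    and A0: "(A \<longlongrightarrow> 0) at_top"
    and lam: "(\<lambda>n. sqrt (real (k n)) * A (level n)) \<longlonglongrightarrow> lam"
    and e: "\<And>i. 1 \<le> i \<Longrightarrow> AE \<omega> in M. 0 < Q i \<omega> \<and> e i \<omega> = q (Q i \<omega>)"
    and res: "prob_lim M (\<lambda>n \<omega>. sqrt (real (k n)) * (MAX i\<in>{1..N n}. \<bar>r n i \<omega> - e i \<omega>\<bar> / (1 + \<bar>e i \<omega>\<bar>))) 0"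
  shows "prob_lim M (\<lambda>n \<omega>. sqrt (real (k n)) * (hill (\<lambda>i. r n i \<omega>) (N n) (k n) - \<gamma>) - \<gamma> * tail_fluct n \<omega>) (lam / (1 - \<rho>))"
proof -
  define \<delta> where "\<delta> n \<omega> = (MAX i\<in>{1..N n}. \<bar>r n i \<omega> - e i \<omega>\<bar> / (1 + \<bar>e i \<omega>\<bar>))" for n \<omega>
  define H where "H n \<omega> = (\<Sum>i=1..N n. max 0 (u (Q i \<omega>) - u (threshold n \<omega>))) / real (k n)" for n \<omega>
  have quantile: "eventually (\<lambda>p. \<forall>i\<in>{1..N (fst p)}. 0 < Q i (snd p) \<and> e i (snd p) = q (Q i (snd p))) (prob_filter M)"
  proof (rule eventually_prob_filter_AE[where P = "\<lambda>n \<omega>. \<forall>i\<in>{1..N n}. 0 < Q i \<omega> \<and> e i \<omega> = q (Q i \<omega>)"], rule always_eventually, rule allI)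
    fix n
    show "AE \<omega> in M. \<forall>i\<in>{1..N n}. 0 < Q i \<omega> \<and> e i \<omega> = q (Q i \<omega>)"
      by (subst AE_ball_countable) (auto intro: e simp del: AE_conj_iff)
  qed
  have ks: "eventually (\<lambda>p. 0 < k (fst p) \<and> k (fst p) < N (fst p)) (prob_filter M)"
    by (rule eventually_prob_filter_sequentially[OF eventually_k])
  have "eventually (\<lambda>p. \<bar>sqrt (real (k (fst p))) * \<delta> (fst p) (snd p)\<bar> < 1/4) (prob_filter M)"
    using tendstoD[OF res, of "1/4"] by (simp add: \<delta>_def)
  with quantile ks threshold_large[of s0]
  have bound: "eventually (\<lambda>p. norm (sqrt (real (k (fst p))) * (hill (\<lambda>i. r (fst p) i (snd p)) (N (fst p)) (k (fst p)) - H (fst p) (snd p)))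
      \<le> 8 * (sqrt (real (k (fst p))) * \<delta> (fst p) (snd p))) (prob_filter M)"
  proof eventually_elim
    case (elim p)
    obtain n \<omega> where p: "p = (n, \<omega>)" by (cases p)
    let ?e = "\<lambda>i. e i \<omega>" and ?r = "\<lambda>i. r n i \<omega>"
    have kn: "0 < k n" "k n < N n" and large: "s0 \<le> threshold n \<omega>" and Q: "\<And>i. i \<in> {1..N n} \<Longrightarrow> 0 < Q i \<omega> \<and> ?e i = q (Q i \<omega>)"
      using elim by (simp_all add: p)
    have ratio_le: "\<bar>?r i - ?e i\<bar> / (1 + \<bar>?e i\<bar>) \<le> \<delta> n \<omega>" if "i \<in> {1..N n}" for i
      unfolding \<delta>_def using that by (intro Max_ge) auto
    have "0 \<le> \<bar>?r 1 - ?e 1\<bar> / (1 + \<bar>?e 1\<bar>)" by simp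
    also have "\<dots> \<le> \<delta> n \<omega>" using kn by (intro ratio_le) simp
    finally have "0 \<le> \<delta> n \<omega>" .
    \<comment> \<open>Since \<open>sqrt k \<ge> 1\<close>, smallness of
      \<open>sqrt k * \<delta>\<close> bounds \<open>\<delta>\<close> itself by \<open>1/4\<close>,
      as the perturbation lemma requires.\<close>
    have "1 * \<delta> n \<omega> \<le> sqrt (real (k n)) * \<delta> n \<omega>"
      using kn \<open>0 \<le> \<delta> n \<omega>\<close> by (intro mult_right_mono) (auto simp: real_sqrt_ge_one)
    then have "\<delta> n \<omega> \<le> 1/4" using elim(4) by (simp add: p abs_less_iff)
    have close: "\<bar>?r i - ?e i\<bar> \<le> \<delta> n \<omega> * (1 + \<bar>?e i\<bar>)" if "i \<in> {1..N n}" for i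
      using ratio_le[OF that] by (simp add: pos_divide_le_eq add_pos_nonneg)
    have map: "map ?e [1..<Suc (N n)] = map (\<lambda>i. q (Q i \<omega>)) [1..<Suc (N n)]"
      using Q by (intro map_cong refl) auto
    have os: "order_stat ?e (N n) i = order_stat (\<lambda>i. q (Q i \<omega>)) (N n) i" for i
      unfolding order_stat_def map ..
    have "order_stat ?e (N n) (N n - k n) = q (threshold n \<omega>)"
      unfolding os threshold_def using kn Q by (intro order_stat_map mono_on_subset[OF q]) auto
    then have "1 \<le> order_stat ?e (N n) (N n - k n)" using u(2)[OF large] by simp
    then have "\<bar>hill ?r (N n) (k n) - hill ?e (N n) (k n)\<bar> \<le> 8 * \<delta> n \<omega>"
      using kn close \<open>0 \<le> \<delta> n \<omega>\<close> \<open>\<delta> n \<omega> \<le> 1/4\<close> by (intro hill_perturb)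
    moreover have "hill ?e (N n) (k n) = H n \<omega>"
    proof -
      have "hill ?e (N n) (k n) = hill (\<lambda>i. q (Q i \<omega>)) (N n) (k n)" unfolding hill_def os ..
      also have "\<dots> = H n \<omega>" unfolding H_def threshold_def
        using kn Q u(2) large unfolding threshold_def
        by (intro hill_of_quantile_transform[OF _ _ _ q u(1)]) force+
      finally show ?thesis .
    qed
    ultimately have "\<bar>hill ?r (N n) (k n) - H n \<omega>\<bar> \<le> 8 * \<delta> n \<omega>" by simp
    then have "sqrt (real (k n)) * \<bar>hill ?r (N n) (k n) - H n \<omega>\<bar> \<le> sqrt (real (k n)) * (8 * \<delta> n \<omega>)"
      by (rule mult_left_mono) simp
    then show ?case by (simp add: p abs_mult)
  qed
  have "prob_lim M (\<lambda>n \<omega>. 8 * (sqrt (real (k n)) * \<delta> n \<omega>)) (8 * 0)"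
    using res unfolding \<delta>_def by (intro tendsto_mult tendsto_const)
  then have "prob_lim M (\<lambda>n \<omega>. sqrt (real (k n)) * (hill (\<lambda>i. r n i \<omega>) (N n) (k n) - H n \<omega>)) 0"
    by (intro Lim_null_comparison[OF bound]) simp
  moreover have "prob_lim M (\<lambda>n \<omega>. sqrt (real (k n)) * (H n \<omega> - \<gamma>) - \<gamma> * tail_fluct n \<omega>) (lam / (1 - \<rho>))"
    unfolding H_def by (rule hill_expansion[OF u(1) lim sgn \<open>\<rho> \<le> 0\<close> A0 lam])
  ultimately have "prob_lim M (\<lambda>n \<omega>. sqrt (real (k n)) * (hill (\<lambda>i. r n i \<omega>) (N n) (k n) - H n \<omega>) +
      (sqrt (real (k n)) * (H n \<omega> - \<gamma>) - \<gamma> * tail_fluct n \<omega>)) (0 + lam / (1 - \<rho>))"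
    by (rule tendsto_add)
  then show ?thesis by (simp add: algebra_simps)
qed

end

section \<open>Tail covariances\<close>

text \<open>Tonelli's theorem. Measurability of \<open>g\<close> and \<open>m\<close> is derived
  from the iterated integrals, so that probabilities depending on a level can be integrated over
  that level.\<close>

lemma (in prob_space) layer_integral:
  fixes f :: "'a \<times> real \<Rightarrow> ennreal"
  assumes [measurable]: "f \<in> borel_measurable (M \<Otimes>\<^sub>M lborel)"
    and g: "\<And>\<omega>. \<omega> \<in> space M \<Longrightarrow> (\<integral>\<^sup>+a. f (\<omega>, a) \<partial>lborel) = ennreal (g \<omega>)" "\<And>\<omega>. 0 \<le> g \<omega>"
    and m: "\<And>a. (\<integral>\<^sup>+\<omega>. f (\<omega>, a) \<partial>M) = ennreal (m a)" "\<And>a. 0 \<le> m a"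
  shows "m \<in> borel_measurable borel" and "expectation g = (LINT a|lborel. m a)"
proof -
  interpret pair_sigma_finite M lborel ..
  have "(\<lambda>a. enn2real (\<integral>\<^sup>+\<omega>. f (\<omega>, a) \<partial>M)) \<in> borel_measurable lborel" by measurable
  then show m_meas: "m \<in> borel_measurable borel" using m by simp
  have "(\<lambda>\<omega>. enn2real (\<integral>\<^sup>+a. f (\<omega>, a) \<partial>lborel)) \<in> borel_measurable M" by measurable
  also have "?this \<longleftrightarrow> g \<in> borel_measurable M" by (rule measurable_cong) (simp add: g)
  finally have g_meas: "g \<in> borel_measurable M" .
  have "expectation g = enn2real (\<integral>\<^sup>+\<omega>. ennreal (g \<omega>) \<partial>M)"
    using g_meas g(2) by (intro integral_eq_nn_integral) auto
  also have "(\<integral>\<^sup>+\<omega>. ennreal (g \<omega>) \<partial>M) = (\<integral>\<^sup>+\<omega>. \<integral>\<^sup>+a. f (\<omega>, a) \<partial>lborel \<partial>M)"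
    by (rule nn_integral_cong) (simp add: g)
  also have "\<dots> = (\<integral>\<^sup>+a. \<integral>\<^sup>+\<omega>. f (\<omega>, a) \<partial>M \<partial>lborel)" by (rule Fubini[symmetric]) measurable
  also have "enn2real \<dots> = (LINT a|lborel. m a)"
    unfolding m(1) using m_meas m(2) by (intro integral_eq_nn_integral[symmetric]) auto
  finally show "expectation g = (LINT a|lborel. m a)" .
qed

lemma positive_part_layers:
  fixes x :: real
  shows "(\<integral>\<^sup>+a. indicator {0..} a * indicator {a..} x \<partial>lborel) = ennreal (max 0 x)"
proof -
  have "(\<integral>\<^sup>+a. indicator {0..} a * indicator {a..} x \<partial>lborel) = (\<integral>\<^sup>+a. indicator {0..x} a \<partial>lborel)"
    by (intro nn_integral_cong) (auto simp: indicator_def)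
  then show ?thesis by (simp add: max_def ennreal_neg)
qed

text \<open>Layers along the diagonal: the derivative of \<open>(x - h) * (z - h)\<close> in
  \<open>h\<close> is \<open>- ((x - h) + (z - h))\<close>. Lowering both excesses by the same
  \<open>h\<close> matches the homogeneity of the limit, in which a joint shift only produces a
  factor \<open>exp (- h)\<close>.\<close>

lemma positive_part_product_layers:
  fixes x z :: real
  shows "(\<integral>\<^sup>+h. indicator {0..} h * (ennreal (max 0 (x - h)) * indicator {h..} z + ennreal (max 0 (z - h)) * indicator {h..} x) \<partial>lborel)
    = ennreal (max 0 x * max 0 z)"
proof (cases "0 \<le> x \<and> 0 \<le> z")
  case True
  \<comment> \<open>The layers end at the smaller of the two excesses, where one factor of the
    product vanishes.\<close>
  define w where "w = min x z"
  have w: "0 \<le> w" "w \<le> x" "w \<le> z" using True by (auto simp: w_def)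
  have "(\<integral>\<^sup>+h. indicator {0..} h * (ennreal (max 0 (x - h)) * indicator {h..} z + ennreal (max 0 (z - h)) * indicator {h..} x) \<partial>lborel)
    = (\<integral>\<^sup>+h. ennreal (x + z - 2 * h) * indicator {0..w} h \<partial>lborel)"
    by (intro nn_integral_cong) (auto simp: indicator_def w_def min_def max_def simp flip: ennreal_plus intro!: arg_cong[where f = ennreal])
  also have "\<dots> = ennreal (((x + z) * w - w\<^sup>2) - ((x + z) * 0 - 0\<^sup>2))"
    using w by (intro nn_integral_FTC_Icc) (auto intro!: derivative_eq_intros)
  also have "(x + z) * w - w\<^sup>2 = x * z" by (auto simp: w_def min_def power2_eq_square algebra_simps)
  finally show ?thesis using True by simp
next
  case False
  then have "(\<integral>\<^sup>+h. indicator {0..} h * (ennreal (max 0 (x - h)) * indicator {h..} z + ennreal (max 0 (z - h)) * indicator {h..} x) \<partial>lborel)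
    = (\<integral>\<^sup>+(h :: real). 0 \<partial>lborel)"
    by (intro nn_integral_cong) (auto simp: indicator_def max_def ennreal_neg)
  then show ?thesis using False by (auto simp: max_def)
qed

lemma integrable_exp_decay: "integrable lborel (\<lambda>a. indicat_real {0..} a * exp (- a))"
  and integral_exp_decay: "(LINT a|lborel. indicat_real {0..} a * exp (- a)) = 1"
proof -
  interpret E: prob_space std_exponential by (rule prob_space_std_exponential)
  have eq: "exponential_density 1 a * 1 = indicat_real {0..} a * exp (- a)" for a
    by (simp add: exponential_density_def indicator_def)
  have "integrable std_exponential (\<lambda>_. 1 :: real)" by simp
  then show "integrable lborel (\<lambda>a. indicat_real {0..} a * exp (- a))"
    by (simp add: integrable_density eq[simplified])
  have "(LINT a|lborel. indicat_real {0..} a * exp (- a)) = (LINT a|std_exponential. 1)"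
    by (subst integral_density) (auto simp: eq[simplified])
  also have "\<dots> = 1" using E.prob_space by simp
  finally show "(LINT a|lborel. indicat_real {0..} a * exp (- a)) = 1" .
qed

section \<open>Expectations of products of excesses through layers\<close>

context prob_space
begin

context
  fixes X Y :: "'a \<Rightarrow> real"
  assumes X [measurable]: "X \<in> borel_measurable M" and Y [measurable]: "Y \<in> borel_measurable M"
    and intX: "integrable M (\<lambda>\<omega>. max 0 (X \<omega>))" and intY: "integrable M (\<lambda>\<omega>. max 0 (Y \<omega>))"
begin

text \<open>Only the first variable is cut into layers; the indicator in the second is carried
  along, so that joint tail probabilities appear.\<close>

lemma expectation_positive_part_layers:
  "(\<lambda>a. indicat_real {0..} a * prob {\<omega> \<in> space M. a \<le> X \<omega> \<and> b \<le> Y \<omega>}) \<in> borel_measurable borel"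
  "expectation (\<lambda>\<omega>. max 0 (X \<omega>) * indicat_real {b..} (Y \<omega>)) =
    (LINT a|lborel. indicat_real {0..} a * prob {\<omega> \<in> space M. a \<le> X \<omega> \<and> b \<le> Y \<omega>})"
proof -
  let ?f = "\<lambda>(\<omega>, a). indicator {0..} a * indicator {a..} (X \<omega>) * indicator {b..} (Y \<omega>) :: ennreal"
  have f: "?f \<in> borel_measurable (M \<Otimes>\<^sub>M lborel)"
  proof -
    have "Measurable.pred (M \<Otimes>\<^sub>M lborel) (\<lambda>p. snd p \<le> X (fst p))" by measurable
    then have "(\<lambda>p. indicator {0..} (snd p) * indicator {p. snd p \<le> X (fst p)} p * indicator {b..} (Y (fst p)) :: ennreal)
        \<in> borel_measurable (M \<Otimes>\<^sub>M lborel)" by measurable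
    then show ?thesis by (simp add: case_prod_beta' indicator_def)
  qed
  have g: "(\<integral>\<^sup>+a. ?f (\<omega>, a) \<partial>lborel) = ennreal (max 0 (X \<omega>) * indicat_real {b..} (Y \<omega>))" for \<omega>
    using positive_part_layers[of "X \<omega>"] by (cases "b \<le> Y \<omega>") simp_all
  have m: "(\<integral>\<^sup>+\<omega>. ?f (\<omega>, a) \<partial>M) = ennreal (indicat_real {0..} a * prob {\<omega> \<in> space M. a \<le> X \<omega> \<and> b \<le> Y \<omega>})" for a
  proof -
    have "(\<integral>\<^sup>+\<omega>. ?f (\<omega>, a) \<partial>M) = (\<integral>\<^sup>+\<omega>. indicator {0..} a * indicator {\<omega> \<in> space M. a \<le> X \<omega> \<and> b \<le> Y \<omega>} \<omega> \<partial>M)"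
      by (intro nn_integral_cong) (auto simp: indicator_def)
    also have "\<dots> = indicator {0..} a * emeasure M {\<omega> \<in> space M. a \<le> X \<omega> \<and> b \<le> Y \<omega>}"
      by (subst nn_integral_cmult) auto
    finally show ?thesis by (simp add: emeasure_eq_measure ennreal_mult ennreal_indicator)
  qed
  show "(\<lambda>a. indicat_real {0..} a * prob {\<omega> \<in> space M. a \<le> X \<omega> \<and> b \<le> Y \<omega>}) \<in> borel_measurable borel"
    "expectation (\<lambda>\<omega>. max 0 (X \<omega>) * indicat_real {b..} (Y \<omega>)) =
    (LINT a|lborel. indicat_real {0..} a * prob {\<omega> \<in> space M. a \<le> X \<omega> \<and> b \<le> Y \<omega>})"
    using layer_integral[OF f g _ m] by (auto simp: zero_le_mult_iff)
qed

lemma expectation_positive_part_product_layers: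
  fixes m :: "real \<Rightarrow> real"
  defines "m \<equiv> \<lambda>h. indicat_real {0..} h * (expectation (\<lambda>\<omega>. max 0 (X \<omega> - h) * indicat_real {h..} (Y \<omega>)) +
      expectation (\<lambda>\<omega>. max 0 (Y \<omega> - h) * indicat_real {h..} (X \<omega>)))"
  shows "m \<in> borel_measurable borel" "expectation (\<lambda>\<omega>. max 0 (X \<omega>) * max 0 (Y \<omega>)) = (LINT h|lborel. m h)"
proof -
  let ?f = "\<lambda>(\<omega>, h). indicator {0..} h * (ennreal (max 0 (X \<omega> - h)) * indicator {h..} (Y \<omega>) + ennreal (max 0 (Y \<omega> - h)) * indicator {h..} (X \<omega>))"
  have f: "?f \<in> borel_measurable (M \<Otimes>\<^sub>M lborel)"
  proof -
    have "Measurable.pred (M \<Otimes>\<^sub>M lborel) (\<lambda>p. snd p \<le> X (fst p))" "Measurable.pred (M \<Otimes>\<^sub>M lborel) (\<lambda>p. snd p \<le> Y (fst p))"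
      by measurable
    then have "(\<lambda>p. indicator {0..} (snd p) * (ennreal (max 0 (X (fst p) - snd p)) * indicator {p. snd p \<le> Y (fst p)} p
        + ennreal (max 0 (Y (fst p) - snd p)) * indicator {p. snd p \<le> X (fst p)} p))
        \<in> borel_measurable (M \<Otimes>\<^sub>M lborel)" by measurable
    then show ?thesis by (simp add: case_prod_beta' indicator_def)
  qed
  have int: "integrable M (\<lambda>\<omega>. max 0 (V \<omega> - h) * indicat_real {h..} (W \<omega>))"
    if "h \<ge> 0" and [measurable]: "V \<in> borel_measurable M" "W \<in> borel_measurable M"
      and V: "integrable M (\<lambda>\<omega>. max 0 (V \<omega>))" for h V W
    by (rule Bochner_Integration.integrable_bound[OF V]) (use \<open>h \<ge> 0\<close> in \<open>auto simp: indicator_def max_def\<close>)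
  have mh: "(\<integral>\<^sup>+\<omega>. ?f (\<omega>, h) \<partial>M) = ennreal (m h)" for h
  proof (cases "h \<ge> 0")
    case True
    have "(\<integral>\<^sup>+\<omega>. ?f (\<omega>, h) \<partial>M) = (\<integral>\<^sup>+\<omega>. ennreal (max 0 (X \<omega> - h) * indicat_real {h..} (Y \<omega>) +
        max 0 (Y \<omega> - h) * indicat_real {h..} (X \<omega>)) \<partial>M)"
      using True by (intro nn_integral_cong) (auto simp: indicator_def ennreal_plus ennreal_neg)
    also have "\<dots> = ennreal (expectation (\<lambda>\<omega>. max 0 (X \<omega> - h) * indicat_real {h..} (Y \<omega>) +
        max 0 (Y \<omega> - h) * indicat_real {h..} (X \<omega>)))"
      using True intX intY by (intro nn_integral_eq_integral Bochner_Integration.integrable_add int AE_I2) auto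
    also have "\<dots> = ennreal (m h)"
      unfolding m_def using True intX intY by (subst Bochner_Integration.integral_add) (auto intro: int)
    finally show ?thesis .
  qed (simp add: m_def)
  have m0: "0 \<le> m h" for h
    unfolding m_def by (intro mult_nonneg_nonneg add_nonneg_nonneg integral_nonneg_AE AE_I2) auto
  have g: "(\<integral>\<^sup>+h. ?f (\<omega>, h) \<partial>lborel) = ennreal (max 0 (X \<omega>) * max 0 (Y \<omega>))" for \<omega>
    using positive_part_product_layers[of "X \<omega>" "Y \<omega>"] by simp
  show "m \<in> borel_measurable borel" "expectation (\<lambda>\<omega>. max 0 (X \<omega>) * max 0 (Y \<omega>)) = (LINT h|lborel. m h)"
    using layer_integral[OF f g _ mh m0] by auto
qed

end

end

section \<open>Covariances of centred excesses over two levels\<close>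

context prob_space
begin

lemma prob_exponential_ge:
  assumes D: "distributed M lborel X (exponential_density 1)" and "0 \<le> s"
  shows "prob {\<omega> \<in> space M. s \<le> X \<omega>} = exp (- s)"
proof -
  have [measurable]: "X \<in> borel_measurable M" using distributed_measurable[OF D] by simp
  interpret E: prob_space std_exponential by (rule prob_space_std_exponential)
  have "prob {\<omega> \<in> space M. s \<le> X \<omega>} = expectation (indicat_real {\<omega> \<in> space M. s \<le> X \<omega>})" by simp
  also have "\<dots> = expectation (\<lambda>\<omega>. indicat_real {s..} (X \<omega>) * 1)"
    by (intro Bochner_Integration.integral_cong) (auto simp: indicator_def)
  also have "\<dots> = exp (- s)"
    using exponential_excess_expectation[OF assms, of "\<lambda>_. 1"] E.prob_space by simp
  finally show ?thesis .
qed

text \<open>The two one-dimensional integrals \<open>I1\<close> and \<open>I2\<close> of \<open>r\<close> along the axes, which the homogeneity of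
  \<open>r\<close> produces from the product of the excesses, cancel against the mixed terms.\<close>

lemma exponential_tail_covariance:
  fixes X Y :: "'a \<Rightarrow> real" and y t :: "nat \<Rightarrow> real" and r :: "real \<Rightarrow> real \<Rightarrow> real"
  assumes X: "distributed M lborel X (exponential_density 1)"
    and Y: "distributed M lborel Y (exponential_density 1)"
    and y: "\<And>n. 0 \<le> y n" and t: "\<And>n. 0 \<le> t n" and \<kappa>: "\<And>n. y n - t n \<le> \<kappa>"
    and lim: "\<And>a b. 0 \<le> a \<Longrightarrow> 0 \<le> b \<Longrightarrow>
      (\<lambda>n. exp (y n) * prob {\<omega> \<in> space M. y n + a \<le> X \<omega> \<and> t n + b \<le> Y \<omega>}) \<longlonglongrightarrow> r a b"
    and hom: "\<And>a b h. 0 \<le> a \<Longrightarrow> 0 \<le> b \<Longrightarrow> 0 \<le> h \<Longrightarrow> r (a + h) (b + h) = exp (- h) * r a b"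
  shows "(\<lambda>n. exp (y n) * expectation (\<lambda>\<omega>. (indicat_real {y n..} (X \<omega>) * (X \<omega> - y n - 1)) *
      (indicat_real {t n..} (Y \<omega>) * (Y \<omega> - t n - 1)))) \<longlonglongrightarrow> r 0 0"
proof -
  have [measurable]: "X \<in> borel_measurable M" "Y \<in> borel_measurable M"
    using distributed_measurable[OF X] distributed_measurable[OF Y] by simp_all
  define p where "p n a b = exp (y n) * prob {\<omega> \<in> space M. y n + a \<le> X \<omega> \<and> t n + b \<le> Y \<omega>}" for n a b
  have p0: "0 \<le> p n a b" for n a b unfolding p_def by simp
  note tail = prob_exponential_ge
  \<comment> \<open>\<open>p1\<close> and \<open>p2\<close> bound the joint tail by one margin each;
    they dominate the integrals along the two axes. The second needs the bound
    \<open>\<kappa>\<close> on the difference of levels, because the scaling factor is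
    \<open>exp (y n)\<close> and not \<open>exp (t n)\<close>.\<close>
  have p1: "p n a b \<le> exp (- a)" if "0 \<le> a" for n a b
  proof -
    have "p n a b \<le> exp (y n) * prob {\<omega> \<in> space M. y n + a \<le> X \<omega>}"
      unfolding p_def by (intro mult_left_mono finite_measure_mono) auto
    also have "\<dots> = exp (- a)" using that y[of n] by (subst tail[OF X]) (auto simp: exp_add[symmetric])
    finally show ?thesis .
  qed
  have p2: "p n a b \<le> exp \<kappa> * exp (- b)" if "0 \<le> b" for n a b
  proof -
    have "p n a b \<le> exp (y n) * prob {\<omega> \<in> space M. t n + b \<le> Y \<omega>}"
      unfolding p_def by (intro mult_left_mono finite_measure_mono) auto
    also have "\<dots> = exp (y n - t n) * exp (- b)" using that t[of n] by (subst tail[OF Y]) (auto simp: exp_add[symmetric])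
    also have "\<dots> \<le> exp \<kappa> * exp (- b)" using \<kappa>[of n] by (intro mult_right_mono) auto
    finally show ?thesis .
  qed
  have lim_p: "(\<lambda>n. p n a b) \<longlonglongrightarrow> r a b" if "0 \<le> a" "0 \<le> b" for a b
    unfolding p_def using that by (rule lim)
  have sq: "integrable M (\<lambda>\<omega>. (V \<omega>)\<^sup>2)" "integrable M V"
    if "distributed M lborel V (exponential_density 1)" for V
    using erlang_ith_moment_integrable[OF _ that, of 2] erlang_ith_moment_integrable[OF _ that, of 1] by simp_all
  have pos: "integrable M (\<lambda>\<omega>. max 0 (X \<omega> - s))" "integrable M (\<lambda>\<omega>. max 0 (Y \<omega> - s))" for s
    using sq(2)[OF X] sq(2)[OF Y] by (intro integrable_max; simp)+
  \<comment> \<open>\<open>S1\<close> and \<open>S2\<close> are mixed moments, an excess in one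
    variable times an indicator in the other; at \<open>h = 0\<close> they are the mixed terms in
    the product of the scores.\<close>
  define S1 where "S1 n h = exp (y n) * expectation (\<lambda>\<omega>. max 0 (X \<omega> - y n - h) * indicat_real {h..} (Y \<omega> - t n))" for n h
  define S2 where "S2 n h = exp (y n) * expectation (\<lambda>\<omega>. max 0 (Y \<omega> - t n - h) * indicat_real {h..} (X \<omega> - y n))" for n h
  let ?ind = "indicat_real {0..}"
  have pm: "(\<lambda>a. ?ind a * p n (a + h) h) \<in> borel_measurable borel" "(\<lambda>b. ?ind b * p n h (b + h)) \<in> borel_measurable borel"
    and S1: "S1 n h = (LINT a|lborel. ?ind a * p n (a + h) h)"
    and S2: "S2 n h = (LINT b|lborel. ?ind b * p n h (b + h))" for n h
  proof -
    have eq: "?ind a * p n (a + h) h = exp (y n) * (?ind a * prob {\<omega> \<in> space M. a \<le> X \<omega> - y n - h \<and> h \<le> Y \<omega> - t n})"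
      "?ind a * p n h (a + h) = exp (y n) * (?ind a * prob {\<omega> \<in> space M. a \<le> Y \<omega> - t n - h \<and> h \<le> X \<omega> - y n})" for a
      unfolding p_def by (simp_all add: algebra_simps conj_commute)
    note L1 = expectation_positive_part_layers[of "\<lambda>\<omega>. X \<omega> - y n - h" "\<lambda>\<omega>. Y \<omega> - t n" h]
    note L2 = expectation_positive_part_layers[of "\<lambda>\<omega>. Y \<omega> - t n - h" "\<lambda>\<omega>. X \<omega> - y n" h]
    have i: "integrable M (\<lambda>\<omega>. max 0 (X \<omega> - y n - h))" "integrable M (\<lambda>\<omega>. max 0 (Y \<omega> - t n - h))"
      "integrable M (\<lambda>\<omega>. max 0 (X \<omega> - y n))" "integrable M (\<lambda>\<omega>. max 0 (Y \<omega> - t n))"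
      using pos[of "y n + h"] pos[of "t n + h"] pos by (simp_all add: diff_diff_eq)
    show "(\<lambda>a. ?ind a * p n (a + h) h) \<in> borel_measurable borel" "(\<lambda>b. ?ind b * p n h (b + h)) \<in> borel_measurable borel"
      unfolding eq using L1(1) L2(1) i by (auto intro!: borel_measurable_times)
    show "S1 n h = (LINT a|lborel. ?ind a * p n (a + h) h)" "S2 n h = (LINT b|lborel. ?ind b * p n h (b + h))"
      unfolding eq S1_def S2_def using L1(2) L2(2) i by simp_all
  qed
  define I1 where "I1 = (LINT a|lborel. ?ind a * r a 0)"
  define I2 where "I2 = (LINT b|lborel. ?ind b * r 0 b)"
  have S1_lim: "(\<lambda>n. S1 n h) \<longlonglongrightarrow> exp (- h) * I1" if h: "0 \<le> h" for h
  proof -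
    have pw: "(\<lambda>n. ?ind a * p n (a + h) h) \<longlonglongrightarrow> exp (- h) * (?ind a * r a 0)" for a
      using lim_p[of "a + h" h] hom[of a 0 h] h by (cases "a \<ge> 0") (auto simp: mult.commute)
    have "(\<lambda>n. S1 n h) \<longlonglongrightarrow> (LINT a|lborel. exp (- h) * (?ind a * r a 0))"
      unfolding S1
    proof (rule integral_dominated_convergence[OF _ _ integrable_exp_decay])
      show "(\<lambda>a. exp (- h) * (?ind a * r a 0)) \<in> borel_measurable lborel"
        by (rule borel_measurable_LIMSEQ_real[OF pw]) (use pm in simp)
      show "AE a in lborel. norm (?ind a * p n (a + h) h) \<le> ?ind a * exp (- a)" for n
      proof (rule AE_I2)
        fix a
        show "norm (?ind a * p n (a + h) h) \<le> ?ind a * exp (- a)"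
          using p0[of n "a + h" h] p1[of "a + h" n h] h by (auto simp: indicator_def intro: order_trans)
      qed
    qed (use pm pw in auto)
    then show ?thesis unfolding I1_def by simp
  qed
  have S2_lim: "(\<lambda>n. S2 n h) \<longlonglongrightarrow> exp (- h) * I2" if h: "0 \<le> h" for h
  proof -
    have pw: "(\<lambda>n. ?ind b * p n h (b + h)) \<longlonglongrightarrow> exp (- h) * (?ind b * r 0 b)" for b
      using lim_p[of h "b + h"] hom[of 0 b h] h by (cases "b \<ge> 0") (auto simp: mult.commute)
    have "(\<lambda>n. S2 n h) \<longlonglongrightarrow> (LINT b|lborel. exp (- h) * (?ind b * r 0 b))"
      unfolding S2
    proof (rule integral_dominated_convergence[OF _ _ integrable_mult_right[OF integrable_exp_decay, of "exp \<kappa>"]])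
      show "(\<lambda>b. exp (- h) * (?ind b * r 0 b)) \<in> borel_measurable lborel"
        by (rule borel_measurable_LIMSEQ_real[OF pw]) (use pm in simp)
      show "AE b in lborel. norm (?ind b * p n h (b + h)) \<le> exp \<kappa> * (?ind b * exp (- b))" for n
      proof (rule AE_I2)
        fix b
        have "exp \<kappa> * exp (- (b + h)) \<le> exp \<kappa> * exp (- b)" using h by (intro mult_left_mono) auto
        then show "norm (?ind b * p n h (b + h)) \<le> exp \<kappa> * (?ind b * exp (- b))"
          using p0[of n h "b + h"] p2[of "b + h" n h] h by (auto simp: indicator_def intro: order_trans)
      qed
    qed (use pm pw in auto)
    then show ?thesis unfolding I2_def by simp
  qed
  have S1_bound: "0 \<le> S1 n h" "S1 n h \<le> exp (- h)" if h: "0 \<le> h" for n h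
  proof -
    show "0 \<le> S1 n h" unfolding S1_def by (intro mult_nonneg_nonneg integral_nonneg_AE AE_I2) auto
    have "S1 n h \<le> (LINT a|lborel. exp (- h) * (?ind a * exp (- a)))"
      unfolding S1
    proof (rule integral_mono_AE'[OF integrable_mult_right[OF integrable_exp_decay]])
      show "AE a in lborel. ?ind a * p n (a + h) h \<le> exp (- h) * (?ind a * exp (- a))"
      proof (rule AE_I2)
        fix a
        show "?ind a * p n (a + h) h \<le> exp (- h) * (?ind a * exp (- a))"
          using p1[of "a + h" n h] h by (cases "0 \<le> a") (auto simp: exp_add[symmetric] add.commute)
      qed
    qed (simp add: p0)
    then show "S1 n h \<le> exp (- h)" using integral_exp_decay by simp
  qed
  have S2_bound: "0 \<le> S2 n h" "S2 n h \<le> exp \<kappa> * exp (- h)" if h: "0 \<le> h" for n h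
  proof -
    show "0 \<le> S2 n h" unfolding S2_def by (intro mult_nonneg_nonneg integral_nonneg_AE AE_I2) auto
    have "S2 n h \<le> (LINT b|lborel. exp \<kappa> * exp (- h) * (?ind b * exp (- b)))"
      unfolding S2
    proof (rule integral_mono_AE'[OF integrable_mult_right[OF integrable_exp_decay]])
      show "AE b in lborel. ?ind b * p n h (b + h) \<le> exp \<kappa> * exp (- h) * (?ind b * exp (- b))"
      proof (rule AE_I2)
        fix b
        have "exp (- (b + h)) = exp (- h) * exp (- b)" by (simp add: exp_add[symmetric])
        then show "?ind b * p n h (b + h) \<le> exp \<kappa> * exp (- h) * (?ind b * exp (- b))"
          using p2[of "b + h" n h] h by (cases "0 \<le> b") (auto simp: mult.assoc)
      qed
    qed (simp add: p0)
    then show "S2 n h \<le> exp \<kappa> * exp (- h)" using integral_exp_decay by simp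
  qed
  define P where "P n = exp (y n) * expectation (\<lambda>\<omega>. max 0 (X \<omega> - y n) * max 0 (Y \<omega> - t n))" for n
  have Pm: "(\<lambda>h. ?ind h * (S1 n h + S2 n h)) \<in> borel_measurable borel"
    and P: "P n = (LINT h|lborel. ?ind h * (S1 n h + S2 n h))" for n
  proof -
    note L = expectation_positive_part_product_layers[of "\<lambda>\<omega>. X \<omega> - y n" "\<lambda>\<omega>. Y \<omega> - t n"]
    have eq: "?ind h * (S1 n h + S2 n h) = exp (y n) * (?ind h * (expectation (\<lambda>\<omega>. max 0 (X \<omega> - y n - h) * indicat_real {h..} (Y \<omega> - t n)) +
      expectation (\<lambda>\<omega>. max 0 (Y \<omega> - t n - h) * indicat_real {h..} (X \<omega> - y n))))" for h
      unfolding S1_def S2_def by (simp add: algebra_simps)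
    show "(\<lambda>h. ?ind h * (S1 n h + S2 n h)) \<in> borel_measurable borel"
      unfolding eq using L(1) pos by (auto intro!: borel_measurable_times)
    show "P n = (LINT h|lborel. ?ind h * (S1 n h + S2 n h))"
      unfolding eq P_def using L(2) pos by simp
  qed
  \<comment> \<open>Each diagonal layer tends to \<open>exp (- h) * (I1 + I2)\<close>, and
    \<open>exp (- h)\<close> integrates to 1.\<close>
  have "P \<longlonglongrightarrow> (LINT h|lborel. (I1 + I2) * (?ind h * exp (- h)))"
    unfolding P[abs_def]
  proof (rule integral_dominated_convergence[OF _ _ integrable_mult_right[OF integrable_exp_decay, of "1 + exp \<kappa>"]])
    show "AE h in lborel. (\<lambda>n. ?ind h * (S1 n h + S2 n h)) \<longlonglongrightarrow> (I1 + I2) * (?ind h * exp (- h))"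
    proof (rule AE_I2)
      fix h
      show "(\<lambda>n. ?ind h * (S1 n h + S2 n h)) \<longlonglongrightarrow> (I1 + I2) * (?ind h * exp (- h))"
        using tendsto_add[OF S1_lim[of h] S2_lim[of h]] by (cases "0 \<le> h") (auto simp: algebra_simps)
    qed
    show "AE h in lborel. norm (?ind h * (S1 n h + S2 n h)) \<le> (1 + exp \<kappa>) * (?ind h * exp (- h))" for n
    proof (rule AE_I2)
      fix h
      show "norm (?ind h * (S1 n h + S2 n h)) \<le> (1 + exp \<kappa>) * (?ind h * exp (- h))"
        using S1_bound[of h n] S2_bound[of h n] by (cases "0 \<le> h") (auto simp: algebra_simps)
    qed
  qed (use Pm in auto)
  then have P_lim: "P \<longlonglongrightarrow> I1 + I2" using integral_exp_decay by simp
  have "(\<lambda>n. P n - S1 n 0 - S2 n 0 + p n 0 0) \<longlonglongrightarrow> (I1 + I2) - exp (- 0) * I1 - exp (- 0) * I2 + r 0 0"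
    by (intro tendsto_add tendsto_diff P_lim S1_lim S2_lim lim_p) auto
  moreover have "P n - S1 n 0 - S2 n 0 + p n 0 0 =
      exp (y n) * expectation (\<lambda>\<omega>. (indicat_real {y n..} (X \<omega>) * (X \<omega> - y n - 1)) *
      (indicat_real {t n..} (Y \<omega>) * (Y \<omega> - t n - 1)))" for n
  proof -
    let ?A = "\<lambda>\<omega>. max 0 (X \<omega> - y n) * max 0 (Y \<omega> - t n)"
    let ?B = "\<lambda>\<omega>. max 0 (X \<omega> - y n - 0) * indicat_real {0..} (Y \<omega> - t n)"
    let ?C = "\<lambda>\<omega>. max 0 (Y \<omega> - t n - 0) * indicat_real {0..} (X \<omega> - y n)"
    let ?D = "indicat_real {\<omega> \<in> space M. y n + 0 \<le> X \<omega> \<and> t n + 0 \<le> Y \<omega>}"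
    have "integrable M (\<lambda>\<omega>. (X \<omega> - y n)\<^sup>2)" "integrable M (\<lambda>\<omega>. (Y \<omega> - t n)\<^sup>2)"
      using sq[OF X] sq[OF Y] by (simp_all add: power2_diff)
    then have "integrable M (\<lambda>\<omega>. (X \<omega> - y n)\<^sup>2 + (Y \<omega> - t n)\<^sup>2)" by (rule Bochner_Integration.integrable_add)
    then have A: "integrable M ?A"
    proof (rule Bochner_Integration.integrable_bound)
      have "norm (max 0 a * max 0 b) \<le> norm (a\<^sup>2 + b\<^sup>2)" for a b :: real
      proof -
        have "max 0 a * max 0 b \<le> \<bar>a\<bar> * \<bar>b\<bar>" by (intro mult_mono) auto
        also have "2 * (\<bar>a\<bar> * \<bar>b\<bar>) \<le> a\<^sup>2 + b\<^sup>2" using sum_squares_bound[of "\<bar>a\<bar>" "\<bar>b\<bar>"] by (simp add: mult.assoc)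
        then have "\<bar>a\<bar> * \<bar>b\<bar> \<le> a\<^sup>2 + b\<^sup>2" using mult_nonneg_nonneg[of "\<bar>a\<bar>" "\<bar>b\<bar>"] by linarith
        finally show ?thesis by simp
      qed
      then show "AE \<omega> in M. norm (?A \<omega>) \<le> norm ((X \<omega> - y n)\<^sup>2 + (Y \<omega> - t n)\<^sup>2)" by simp
    qed measurable
    have B: "integrable M ?B" by (rule Bochner_Integration.integrable_bound[OF pos(1)[of "y n"]]) (auto simp: indicator_def)
    have C: "integrable M ?C" by (rule Bochner_Integration.integrable_bound[OF pos(2)[of "t n"]]) (auto simp: indicator_def)
    have D: "integrable M ?D" by (intro integrable_real_indicator) (auto simp: less_top[symmetric])
    have "P n - S1 n 0 - S2 n 0 + p n 0 0 = exp (y n) * (expectation ?A - expectation ?B - expectation ?C + expectation ?D)"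
      unfolding P_def S1_def S2_def p_def by (simp add: algebra_simps)
    also have "expectation ?A - expectation ?B - expectation ?C + expectation ?D = expectation (\<lambda>\<omega>. ?A \<omega> - ?B \<omega> - ?C \<omega> + ?D \<omega>)"
      using A B C D by simp
    also have "\<dots> = expectation (\<lambda>\<omega>. (indicat_real {y n..} (X \<omega>) * (X \<omega> - y n - 1)) *
      (indicat_real {t n..} (Y \<omega>) * (Y \<omega> - t n - 1)))"
      by (intro Bochner_Integration.integral_cong) (auto simp: indicator_def max_def algebra_simps)
    finally show ?thesis .
  qed
  ultimately show ?thesis by simp
qed

end

text \<open>On the logarithmic scale quotients of quantiles become increments. Logarithms need
  eventually positive quantiles, which regular variation with \<open>\<gamma> > 0\<close> and
  monotonicity enforce; as the correction \<open>Y\<close> tends to 0, linearising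
  \<open>ln (1 + Y)\<close> keeps the second-order limit.\<close>

lemma (in prob_space) quantile_second_order:
  fixes X :: "'a \<Rightarrow> real" and A :: "real \<Rightarrow> real"
  assumes X: "X \<in> borel_measurable M" "continuous_on UNIV (dist_fun M X)"
    and "0 < \<gamma>" and A0: "(A \<longlongrightarrow> 0) at_top"
    and lim: "\<And>x. 0 < x \<Longrightarrow> ((\<lambda>t. 1 / A t * (tail_quantile M X (t * x) / tail_quantile M X t - x powr \<gamma>)) \<longlongrightarrow>
      (if \<rho> = 0 then x powr \<gamma> * ln x else x powr \<gamma> * ((x powr \<rho> - 1) / \<rho>))) at_top"
  obtains u s0 where "mono u"
    and "\<And>s. s0 \<le> s \<Longrightarrow> 1 \<le> tail_quantile M X (exp s) \<and> u s = ln (tail_quantile M X (exp s))"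
    and "\<And>x. ((\<lambda>s. (u (s + x) - u s - \<gamma> * x) / A (exp s)) \<longlongrightarrow> second_order_limit \<rho> x) at_top"
proof -
  define q where "q s = tail_quantile M X (exp s)" for s
  have q_mono: "q s \<le> q t" if "0 < s" "s \<le> t" for s t
    unfolding q_def using that by (intro tail_quantile_mono[OF X]) auto
  define D where "D x s = (q (s + x) / q s - exp (\<gamma> * x)) / A (exp s)" for x s
  have D: "(D x \<longlongrightarrow> exp (\<gamma> * x) * second_order_limit \<rho> x) at_top" for x
  proof -
    have "((\<lambda>s. 1 / A (exp s) * (tail_quantile M X (exp s * exp x) / tail_quantile M X (exp s) - exp x powr \<gamma>)) \<longlongrightarrow>
      (if \<rho> = 0 then exp x powr \<gamma> * ln (exp x) else exp x powr \<gamma> * ((exp x powr \<rho> - 1) / \<rho>))) at_top"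
      by (rule filterlim_compose[OF lim exp_at_top]) simp
    then show ?thesis
      unfolding D_def[abs_def] q_def second_order_limit_def by (cases "\<rho> = 0") (simp_all add: exp_add exp_powr_real mult.commute)
  qed
  have A_nz: "\<forall>\<^sub>F s in at_top. A (exp s) \<noteq> 0"
  proof -
    have "\<forall>\<^sub>F s in at_top. D 1 s \<noteq> 0"
      by (rule tendsto_imp_eventually_ne[OF D]) (use second_order_limit_1_neq_0 in simp)
    then show ?thesis by eventually_elim (auto simp: D_def)
  qed
  have Ae0: "((\<lambda>s. A (exp s)) \<longlongrightarrow> 0) at_top" by (rule filterlim_compose[OF A0 exp_at_top])
  have ratio: "((\<lambda>s. q (s + x) / q s) \<longlongrightarrow> exp (\<gamma> * x)) at_top" for x
  proof (rule Lim_transform_eventually)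
    have "((\<lambda>s. A (exp s) * D x s + exp (\<gamma> * x)) \<longlongrightarrow> 0 * (exp (\<gamma> * x) * second_order_limit \<rho> x) + exp (\<gamma> * x)) at_top"
      by (intro tendsto_add tendsto_mult Ae0 D tendsto_const)
    then show "((\<lambda>s. A (exp s) * D x s + exp (\<gamma> * x)) \<longlongrightarrow> exp (\<gamma> * x)) at_top" by simp
    show "\<forall>\<^sub>F s in at_top. A (exp s) * D x s + exp (\<gamma> * x) = q (s + x) / q s"
      using A_nz by eventually_elim (simp add: D_def)
  qed
  \<comment> \<open>Strictly between 1 and the limit \<open>exp \<gamma>\<close> of the ratio over a
    unit step; this yields geometric growth once \<open>q\<close> is positive.\<close>
  define \<kappa> where "\<kappa> = (1 + exp \<gamma>) / 2"
  have \<kappa>: "1 < \<kappa>" "\<kappa> < exp \<gamma>" unfolding \<kappa>_def using \<open>0 < \<gamma>\<close> by (simp_all add: field_simps)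
  have "\<forall>\<^sub>F s in at_top. \<kappa> < q (s + 1) / q s" using \<kappa> by (intro order_tendstoD(1)[OF ratio]) simp
  then obtain S' where S': "\<And>s. S' \<le> s \<Longrightarrow> \<kappa> < q (s + 1) / q s" unfolding eventually_at_top_linorder by blast
  define S where "S = max S' 1"
  have S: "\<kappa> * q s \<le> q (s + 1)" "0 < q s" if "S \<le> s" for s
  proof -
    have r: "\<kappa> < q (s + 1) / q s" and le: "q s \<le> q (s + 1)"
      using that by (auto intro: S' q_mono simp: S_def)
    show pos: "0 < q s"
    \<comment> \<open>A negative value would be multiplied by more than \<open>\<kappa> > 1\<close>
      and so decrease, against the monotonicity of \<open>q\<close>; the value 0 would make the
      ratio 0.\<close>
    proof (rule ccontr)
      assume "\<not> 0 < q s"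
      moreover have "q s \<noteq> 0" using r \<kappa> by auto
      ultimately have neg: "q s < 0" by simp
      then have "q (s + 1) < \<kappa> * q s" using r by (simp add: neg_less_divide_eq)
      also have "\<dots> < 1 * q s" using neg \<kappa> by (intro mult_strict_right_mono_neg)
      finally show False using le by simp
    qed
    show "\<kappa> * q s \<le> q (s + 1)" using r pos by (simp add: pos_less_divide_eq)
  qed
  have grow: "\<kappa> ^ n * q S \<le> q (S + real n)" for n
  proof (induction n)
    case (Suc n)
    have "\<kappa> ^ Suc n * q S = \<kappa> * (\<kappa> ^ n * q S)" by simp
    also have "\<dots> \<le> \<kappa> * q (S + real n)" using Suc \<kappa> by (intro mult_left_mono) auto
    also have "\<dots> \<le> q (S + real n + 1)" by (rule S) simp
    also have "S + real n + 1 = S + real (Suc n)" by simp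
    finally show ?case .
  qed simp
  obtain n where "1 / q S < \<kappa> ^ n" using real_arch_pow[OF \<kappa>(1)] by blast
  then have "1 < \<kappa> ^ n * q S" using S(2)[of S] by (simp add: pos_divide_less_eq)
  define s0 where "s0 = S + real n"
  have "1 \<le> s0" by (simp add: s0_def S_def)
  have q1: "1 \<le> q s" if "s0 \<le> s" for s
    using grow[of n] \<open>1 < \<kappa> ^ n * q S\<close> q_mono[of s0 s] that \<open>1 \<le> s0\<close> by (simp add: s0_def)
  \<comment> \<open>Frozen below \<open>s0\<close>, so that \<open>u\<close> is monotone on the
    whole line while it equals \<open>ln (q s)\<close> from \<open>s0\<close> on.\<close>
  define u where "u s = ln (q (max s s0))" for s
  have "mono u"
  proof (rule monoI)
    fix s t :: real assume "s \<le> t"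
    then show "u s \<le> u t"
      unfolding u_def using q1[of "max s s0"] q1[of "max t s0"] q_mono[of "max s s0" "max t s0"] \<open>1 \<le> s0\<close> by simp
  qed
  moreover have u: "1 \<le> tail_quantile M X (exp s) \<and> u s = ln (tail_quantile M X (exp s))" if "s0 \<le> s" for s
    using q1[OF that] that unfolding u_def q_def by (simp add: max_def)
  moreover have "((\<lambda>s. (u (s + x) - u s - \<gamma> * x) / A (exp s)) \<longlongrightarrow> second_order_limit \<rho> x) at_top" for x
  proof -
    define Y where "Y s = exp (- (\<gamma> * x)) * (A (exp s) * D x s)" for s
    have YA: "((\<lambda>s. Y s / A (exp s)) \<longlongrightarrow> second_order_limit \<rho> x) at_top"
    proof (rule Lim_transform_eventually)
      have "((\<lambda>s. exp (- (\<gamma> * x)) * D x s) \<longlongrightarrow> exp (- (\<gamma> * x)) * (exp (\<gamma> * x) * second_order_limit \<rho> x)) at_top"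
        by (intro tendsto_mult tendsto_const D)
      then show "((\<lambda>s. exp (- (\<gamma> * x)) * D x s) \<longlongrightarrow> second_order_limit \<rho> x) at_top"
        by (simp add: mult.assoc[symmetric] exp_add[symmetric])
      show "\<forall>\<^sub>F s in at_top. exp (- (\<gamma> * x)) * D x s = Y s / A (exp s)"
        using A_nz by eventually_elim (simp add: Y_def)
    qed
    have "(Y \<longlongrightarrow> exp (- (\<gamma> * x)) * (0 * (exp (\<gamma> * x) * second_order_limit \<rho> x))) at_top"
      unfolding Y_def[abs_def] by (intro tendsto_mult tendsto_const D Ae0)
    then have Y0: "(Y \<longlongrightarrow> 0) at_top" by simp
    have "((\<lambda>s. 2 * \<bar>Y s\<bar> * \<bar>Y s / A (exp s)\<bar>) \<longlongrightarrow> 2 * \<bar>0\<bar> * \<bar>second_order_limit \<rho> x\<bar>) at_top"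
      by (intro tendsto_mult tendsto_const tendsto_rabs Y0 YA)
    then have bound0: "((\<lambda>s. 2 * \<bar>Y s\<bar> * \<bar>Y s / A (exp s)\<bar>) \<longlongrightarrow> 0) at_top" by simp
    have "((\<lambda>s. ln (1 + Y s) / A (exp s) - Y s / A (exp s)) \<longlongrightarrow> 0) at_top"
    proof (rule Lim_null_comparison[OF _ bound0])
      have "\<forall>\<^sub>F s in at_top. \<bar>Y s\<bar> < 1/2" using tendstoD[OF Y0, of "1/2"] by simp
      then show "\<forall>\<^sub>F s in at_top. norm (ln (1 + Y s) / A (exp s) - Y s / A (exp s)) \<le> 2 * \<bar>Y s\<bar> * \<bar>Y s / A (exp s)\<bar>"
        by eventually_elim (use abs_ln_one_plus_div_bound in auto)
    qed
    from tendsto_add[OF this YA] have "((\<lambda>s. ln (1 + Y s) / A (exp s)) \<longlongrightarrow> second_order_limit \<rho> x) at_top" by simp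
    moreover have "\<forall>\<^sub>F s in at_top. ln (1 + Y s) / A (exp s) = (u (s + x) - u s - \<gamma> * x) / A (exp s)"
      using A_nz eventually_ge_at_top[of s0] eventually_ge_at_top[of "s0 - x"]
    proof eventually_elim
      case (elim s)
      have pos: "0 < q s" "0 < q (s + x)" using q1[of s] q1[of "s + x"] elim by auto
      have "A (exp s) * D x s = q (s + x) / q s - exp (\<gamma> * x)" using elim(1) by (simp add: D_def)
      then have "1 + Y s = exp (- (\<gamma> * x)) * (q (s + x) / q s)"
        unfolding Y_def by (simp add: right_diff_distrib exp_add[symmetric])
      then have "ln (1 + Y s) = - (\<gamma> * x) + (ln (q (s + x)) - ln (q s))"
        using pos by (simp add: ln_mult ln_div)
      moreover have "u s = ln (q s)" "u (s + x) = ln (q (s + x))"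
        using u[of s] u[of "s + x"] elim unfolding q_def by simp_all
      ultimately show ?case by simp
    qed
    ultimately show ?thesis by (rule Lim_transform_eventually)
  qed
  ultimately show ?thesis by (rule that[of u s0])
qed

section \<open>Joint tails under the copula condition\<close>

context prob_space
begin

text \<open>Moving the second level costs at most the probability of the strip between its two
  positions, which is explicit in the exponential margin.\<close>

lemma joint_tail_Lipschitz:
  fixes X Y :: "'a \<Rightarrow> real"
  assumes X [measurable]: "X \<in> borel_measurable M"
    and Y: "distributed M lborel Y (exponential_density 1)"
    and "0 \<le> b" "0 \<le> b'"
  shows "\<bar>prob {\<omega> \<in> space M. a \<le> X \<omega> \<and> b \<le> Y \<omega>} - prob {\<omega> \<in> space M. a \<le> X \<omega> \<and> b' \<le> Y \<omega>}\<bar> \<le> \<bar>exp (- b) - exp (- b')\<bar>"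
proof -
  have [measurable]: "Y \<in> borel_measurable M" using distributed_measurable[OF Y] by simp
  have le: "\<bar>prob {\<omega> \<in> space M. a \<le> X \<omega> \<and> b \<le> Y \<omega>} - prob {\<omega> \<in> space M. a \<le> X \<omega> \<and> b' \<le> Y \<omega>}\<bar> \<le> \<bar>exp (- b) - exp (- b')\<bar>"
    if "0 \<le> b" "b \<le> b'" for b b'
  proof -
    let ?D = "{\<omega> \<in> space M. b \<le> Y \<omega> \<and> \<not> b' \<le> Y \<omega>}"
    have "prob {\<omega> \<in> space M. a \<le> X \<omega> \<and> b \<le> Y \<omega>} \<le> prob ({\<omega> \<in> space M. a \<le> X \<omega> \<and> b' \<le> Y \<omega>} \<union> ?D)"
      by (intro finite_measure_mono) auto
    also have "\<dots> \<le> prob {\<omega> \<in> space M. a \<le> X \<omega> \<and> b' \<le> Y \<omega>} + prob ?D"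
      by (intro measure_Un_le) auto
    finally have "prob {\<omega> \<in> space M. a \<le> X \<omega> \<and> b \<le> Y \<omega>} - prob {\<omega> \<in> space M. a \<le> X \<omega> \<and> b' \<le> Y \<omega>} \<le> prob ?D" by simp
    moreover have "prob {\<omega> \<in> space M. a \<le> X \<omega> \<and> b' \<le> Y \<omega>} \<le> prob {\<omega> \<in> space M. a \<le> X \<omega> \<and> b \<le> Y \<omega>}"
      using that by (intro finite_measure_mono) auto
    moreover have "prob ?D = exp (- b) - exp (- b')"
    proof -
      have "prob ({\<omega> \<in> space M. b \<le> Y \<omega>} - {\<omega> \<in> space M. b' \<le> Y \<omega>}) =
          prob {\<omega> \<in> space M. b \<le> Y \<omega>} - prob {\<omega> \<in> space M. b' \<le> Y \<omega>}"
        using \<open>b \<le> b'\<close> by (intro finite_measure_Diff) auto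
      also have "{\<omega> \<in> space M. b \<le> Y \<omega>} - {\<omega> \<in> space M. b' \<le> Y \<omega>} = ?D" by auto
      finally show ?thesis using that by (simp add: prob_exponential_ge[OF Y])
    qed
    ultimately show ?thesis by linarith
  qed
  show ?thesis
    using le[of b b'] le[of b' b] assms by (cases "b \<le> b'") (simp_all add: abs_minus_commute)
qed

text \<open>The copula limit is taken at \<open>s = exp (y n)\<close>, which fits the first level
  exactly; the second level differs from it by the convergent amount \<open>y n - t n\<close>, and
  the Lipschitz bound allows \<open>d\<close> in its place.\<close>

lemma exponential_tail_covariance_of_copula:
  fixes X Y :: "'a \<Rightarrow> real" and y t :: "nat \<Rightarrow> real" and G :: "real \<Rightarrow> real \<Rightarrow> real"
  assumes X: "distributed M lborel X (exponential_density 1)"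
    and Y: "distributed M lborel Y (exponential_density 1)"
    and G: "\<And>u v. 0 < u \<Longrightarrow> 0 < v \<Longrightarrow>
      ((\<lambda>s. s * prob {\<omega> \<in> space M. ln s - ln u \<le> X \<omega> \<and> ln s - ln v \<le> Y \<omega>}) \<longlongrightarrow> G u v) at_top"
    and y: "filterlim y at_top sequentially"
    and d: "(\<lambda>n. y n - t n) \<longlonglongrightarrow> d"
  shows "(\<lambda>n. exp (y n) * expectation (\<lambda>\<omega>. (indicat_real {y n..} (X \<omega>) * (X \<omega> - y n - 1)) *
      (indicat_real {t n..} (Y \<omega>) * (Y \<omega> - t n - 1)))) \<longlonglongrightarrow> G 1 (exp d)"
    and "\<And>c u v. 0 < c \<Longrightarrow> 0 < u \<Longrightarrow> 0 < v \<Longrightarrow> G (c * u) (c * v) = c * G u v"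
proof -
  have [measurable]: "X \<in> borel_measurable M" "Y \<in> borel_measurable M"
    using distributed_measurable[OF X] distributed_measurable[OF Y] by simp_all
  \<comment> \<open>Homogeneity is a consequence of the limit itself: substitute
    \<open>s / c\<close> for \<open>s\<close> and use uniqueness of limits.\<close>
  show hom: "G (c * u) (c * v) = c * G u v" if "0 < c" "0 < u" "0 < v" for c u v
  proof (rule tendsto_unique)
    show "((\<lambda>s. s * prob {\<omega> \<in> space M. ln s - ln (c * u) \<le> X \<omega> \<and> ln s - ln (c * v) \<le> Y \<omega>}) \<longlongrightarrow> G (c * u) (c * v)) at_top"
      using that by (intro G) auto
    have "filterlim (\<lambda>s. s * inverse c) at_top at_top"
      using that by (intro filterlim_at_top_mult_tendsto_pos[OF tendsto_const _ filterlim_ident]) auto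
    from filterlim_compose[OF G[OF that(2,3)] this]
    have "((\<lambda>s. c * (s * inverse c * prob {\<omega> \<in> space M. ln (s * inverse c) - ln u \<le> X \<omega> \<and> ln (s * inverse c) - ln v \<le> Y \<omega>})) \<longlongrightarrow> c * G u v) at_top"
      by (intro tendsto_mult tendsto_const)
    then show "((\<lambda>s. s * prob {\<omega> \<in> space M. ln s - ln (c * u) \<le> X \<omega> \<and> ln s - ln (c * v) \<le> Y \<omega>}) \<longlongrightarrow> c * G u v) at_top"
    proof (rule Lim_transform_eventually)
      show "\<forall>\<^sub>F s in at_top. c * (s * inverse c * prob {\<omega> \<in> space M. ln (s * inverse c) - ln u \<le> X \<omega> \<and> ln (s * inverse c) - ln v \<le> Y \<omega>}) =
          s * prob {\<omega> \<in> space M. ln s - ln (c * u) \<le> X \<omega> \<and> ln s - ln (c * v) \<le> Y \<omega>}"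
        using eventually_gt_at_top[of 0]
      proof eventually_elim
        case (elim s)
        have "ln (s * inverse c) - ln u = ln s - ln (c * u)" "ln (s * inverse c) - ln v = ln s - ln (c * v)"
          using that elim by (simp_all add: ln_mult ln_inverse)
        then show ?case using that(1) by simp
      qed
    qed
  qed simp
  \<comment> \<open>The tail function in the coordinates \<open>u = exp (- a)\<close>,
    \<open>v = exp (d - b)\<close>, where \<open>d\<close> compensates for the different levels;
    homogeneity becomes a factor \<open>exp (- h)\<close> under a common shift.\<close>
  define r where "r a b = G (exp (- a)) (exp (d - b))" for a b
  have t: "filterlim t at_top sequentially"
    using filterlim_tendsto_add_at_top[OF tendsto_minus[OF d] y] by simp
  have lim: "(\<lambda>n. exp (y n) * prob {\<omega> \<in> space M. y n + a \<le> X \<omega> \<and> t n + b \<le> Y \<omega>}) \<longlonglongrightarrow> r a b"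
    if "0 \<le> a" "0 \<le> b" for a b
  proof -
    have "filterlim (\<lambda>n. exp (y n)) at_top sequentially" by (rule filterlim_compose[OF exp_at_top y])
    from filterlim_compose[OF G[of "exp (- a)" "exp (d - b)"] this]
    have 1: "(\<lambda>n. exp (y n) * prob {\<omega> \<in> space M. y n + a \<le> X \<omega> \<and> y n - d + b \<le> Y \<omega>}) \<longlonglongrightarrow> r a b"
      by (simp add: r_def algebra_simps)
    have "(\<lambda>n. exp (y n - t n - b) - exp (d - b)) \<longlonglongrightarrow> exp (d - b) - exp (d - b)"
      by (intro tendsto_intros d)
    then have 0: "(\<lambda>n. \<bar>exp (y n - t n - b) - exp (d - b)\<bar>) \<longlonglongrightarrow> 0"
      using tendsto_rabs_zero by fastforce
    have "(\<lambda>n. exp (y n) * prob {\<omega> \<in> space M. y n + a \<le> X \<omega> \<and> t n + b \<le> Y \<omega>} -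
        exp (y n) * prob {\<omega> \<in> space M. y n + a \<le> X \<omega> \<and> y n - d + b \<le> Y \<omega>}) \<longlonglongrightarrow> 0"
    proof (rule Lim_null_comparison[OF _ 0])
      have "\<forall>\<^sub>F n in sequentially. d \<le> y n" "\<forall>\<^sub>F n in sequentially. 0 \<le> t n"
        using y t by (simp_all add: filterlim_at_top)
      then show "\<forall>\<^sub>F n in sequentially. norm (exp (y n) * prob {\<omega> \<in> space M. y n + a \<le> X \<omega> \<and> t n + b \<le> Y \<omega>} -
        exp (y n) * prob {\<omega> \<in> space M. y n + a \<le> X \<omega> \<and> y n - d + b \<le> Y \<omega>}) \<le> \<bar>exp (y n - t n - b) - exp (d - b)\<bar>"
      proof eventually_elim
        case (elim n)
        have "\<bar>exp (y n) * (prob {\<omega> \<in> space M. y n + a \<le> X \<omega> \<and> t n + b \<le> Y \<omega>} - prob {\<omega> \<in> space M. y n + a \<le> X \<omega> \<and> y n - d + b \<le> Y \<omega>})\<bar>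
            \<le> exp (y n) * \<bar>exp (- (t n + b)) - exp (- (y n - d + b))\<bar>"
          unfolding abs_mult abs_exp_cancel using elim that
          by (intro mult_left_mono joint_tail_Lipschitz Y) auto
        also have "\<dots> = \<bar>exp (y n) * (exp (- (t n + b)) - exp (- (y n - d + b)))\<bar>" by (simp add: abs_mult)
        also have "exp (y n) * (exp (- (t n + b)) - exp (- (y n - d + b))) = exp (y n - t n - b) - exp (d - b)"
          by (simp add: right_diff_distrib exp_add[symmetric] algebra_simps)
        finally show ?case by (simp add: right_diff_distrib)
      qed
    qed
    from tendsto_add[OF this 1] show ?thesis by simp
  qed
  have rhom: "r (a + h) (b + h) = exp (- h) * r a b" for a b h
    using hom[of "exp (- h)" "exp (- a)" "exp (d - b)"] by (simp add: r_def exp_add[symmetric] algebra_simps)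
  have "\<forall>\<^sub>F n in sequentially. 0 \<le> y n \<and> 0 \<le> t n \<and> y n - t n \<le> d + 1"
  proof (intro eventually_conj)
    show "\<forall>\<^sub>F n in sequentially. y n - t n \<le> d + 1"
      using order_tendstoD(2)[OF d, of "d + 1"] by (auto elim: eventually_mono)
  qed (use y t in \<open>simp_all add: filterlim_at_top\<close>)
  \<comment> \<open>The covariance lemma asks for its bounds at every index; dropping the first
    \<open>n0\<close> terms provides them and leaves the limit unchanged.\<close>
  then obtain n0 where n0: "\<And>n. n0 \<le> n \<Longrightarrow> 0 \<le> y n \<and> 0 \<le> t n \<and> y n - t n \<le> d + 1"
    unfolding eventually_sequentially by blast
  have "(\<lambda>n. exp (y (n + n0)) * expectation (\<lambda>\<omega>. (indicat_real {y (n + n0)..} (X \<omega>) * (X \<omega> - y (n + n0) - 1)) *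
      (indicat_real {t (n + n0)..} (Y \<omega>) * (Y \<omega> - t (n + n0) - 1)))) \<longlonglongrightarrow> r 0 0"
  proof (rule exponential_tail_covariance[OF X Y, where r = r])
    show "0 \<le> y (n + n0)" "0 \<le> t (n + n0)" "y (n + n0) - t (n + n0) \<le> d + 1" for n using n0[of "n + n0"] by auto
    show "(\<lambda>n. exp (y (n + n0)) * prob {\<omega> \<in> space M. y (n + n0) + a \<le> X \<omega> \<and> t (n + n0) + b \<le> Y \<omega>}) \<longlonglongrightarrow> r a b"
      if "0 \<le> a" "0 \<le> b" for a b
      using LIMSEQ_ignore_initial_segment[OF lim[OF that], of n0] .
  qed (rule rhom)
  then show "(\<lambda>n. exp (y n) * expectation (\<lambda>\<omega>. (indicat_real {y n..} (X \<omega>) * (X \<omega> - y n - 1)) *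
      (indicat_real {t n..} (Y \<omega>) * (Y \<omega> - t n - 1)))) \<longlonglongrightarrow> G 1 (exp d)"
    by (simp add: r_def LIMSEQ_offset[where k = n0])
qed

text \<open>The copula condition only involves \<open>u / s\<close> and \<open>v / s\<close>, which are finite and positive here.\<close>

lemma survival_copula_limit:
  fixes X Y :: "'a \<Rightarrow> real"
  assumes X: "X \<in> borel_measurable M" "continuous_on UNIV (dist_fun M X)"
    and Y: "Y \<in> borel_measurable M" "continuous_on UNIV (dist_fun M Y)"
    and lim: "((\<lambda>s. s * survival_copula M X Y (ennreal u / ennreal s) (ennreal v / ennreal s)) \<longlongrightarrow> l) at_top"
    and "0 < u" "0 < v"
  shows "((\<lambda>s. s * prob {\<omega> \<in> space M. ln s - ln u \<le> exp_transform M X (X \<omega>) \<and> ln s - ln v \<le> exp_transform M Y (Y \<omega>)}) \<longlongrightarrow> l) at_top"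
  using lim
proof (rule Lim_transform_eventually)
  note [measurable] = X(1) Y(1) borel_measurable_survival[OF X] borel_measurable_survival[OF Y]
    borel_measurable_exp_transform[OF X] borel_measurable_exp_transform[OF Y]
  show "\<forall>\<^sub>F s in at_top. s * survival_copula M X Y (ennreal u / ennreal s) (ennreal v / ennreal s) =
      s * prob {\<omega> \<in> space M. ln s - ln u \<le> exp_transform M X (X \<omega>) \<and> ln s - ln v \<le> exp_transform M Y (Y \<omega>)}"
    using eventually_gt_at_top[of 0]
  proof eventually_elim
    case (elim s)
    have iff: "ennreal p \<le> ennreal w / ennreal s \<longleftrightarrow> ln s - ln w \<le> - ln p" if "0 < p" "0 < w" for p w
    proof -
      have "ennreal p \<le> ennreal w / ennreal s \<longleftrightarrow> p \<le> w / s"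
        using that elim by (simp add: divide_ennreal)
      also have "\<dots> \<longleftrightarrow> ln p \<le> ln (w / s)" using that elim by (intro ln_le_cancel_iff[symmetric]) auto
      also have "\<dots> \<longleftrightarrow> ln s - ln w \<le> - ln p" using that elim by (auto simp: ln_div)
      finally show ?thesis .
    qed
    have "survival_copula M X Y (ennreal u / ennreal s) (ennreal v / ennreal s) =
      prob {\<omega> \<in> space M. ln s - ln u \<le> exp_transform M X (X \<omega>) \<and> ln s - ln v \<le> exp_transform M Y (Y \<omega>)}"
      unfolding survival_copula_def
    proof (rule measure_eq_AE)
      show "AE \<omega> in M. \<omega> \<in> {\<omega> \<in> space M. ennreal (survival M X (X \<omega>)) \<le> ennreal u / ennreal s \<and> ennreal (survival M Y (Y \<omega>)) \<le> ennreal v / ennreal s}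
        \<longleftrightarrow> \<omega> \<in> {\<omega> \<in> space M. ln s - ln u \<le> exp_transform M X (X \<omega>) \<and> ln s - ln v \<le> exp_transform M Y (Y \<omega>)}"
        using AE_survival_bounds[OF X] AE_survival_bounds[OF Y]
        by eventually_elim (use assms(6,7) in \<open>auto simp: iff exp_transform_def\<close>)
    qed measurable
    then show ?case by simp
  qed
qed

end

section \<open>Joint asymptotic normality\<close>

text \<open>The sum is at most the number of terms times the largest one, whose cube is one of the
  summands on the right.\<close>

lemma abs_sum_cubed_le:
  fixes x :: "'i \<Rightarrow> real"
  assumes "finite A"
  shows "\<bar>\<Sum>j\<in>A. x j\<bar> ^ 3 \<le> real (card A) ^ 3 * (\<Sum>j\<in>A. \<bar>x j\<bar> ^ 3)"
proof (cases "A = {}")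
  case False
  define y where "y = (MAX j\<in>A. \<bar>x j\<bar>)"
  have "y \<in> (\<lambda>j. \<bar>x j\<bar>) ` A" unfolding y_def using assms False by (intro Max_in) auto
  then obtain j where j: "j \<in> A" "y = \<bar>x j\<bar>" by auto
  have "\<bar>\<Sum>j\<in>A. x j\<bar> \<le> (\<Sum>j\<in>A. y)"
    unfolding y_def using assms by (intro order_trans[OF sum_abs] sum_mono Max_ge) auto
  then have "\<bar>\<Sum>j\<in>A. x j\<bar> ^ 3 \<le> (real (card A) * y) ^ 3" by (intro power_mono) auto
  also have "\<dots> = real (card A) ^ 3 * \<bar>x j\<bar> ^ 3" unfolding j(2) by (rule power_mult_distrib)
  also have "\<bar>x j\<bar> ^ 3 \<le> (\<Sum>j\<in>A. \<bar>x j\<bar> ^ 3)" using assms j(1) by (intro member_le_sum) auto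
  finally show ?thesis by (simp add: mult_left_mono)
qed simp

lemma abs_mult_le_sum_squares: "\<bar>a * b\<bar> \<le> a\<^sup>2 + b\<^sup>2" for a b :: real
proof -
  have "2 * (\<bar>a\<bar> * \<bar>b\<bar>) \<le> a\<^sup>2 + b\<^sup>2" using sum_squares_bound[of "\<bar>a\<bar>" "\<bar>b\<bar>"] by (simp add: mult.assoc)
  then show ?thesis unfolding abs_mult using mult_nonneg_nonneg[of "\<bar>a\<bar>" "\<bar>b\<bar>"] by linarith
qed

lemma measurable_PiM_borel_component:
  assumes "i \<in> I" "h \<in> borel_measurable borel"
  shows "(\<lambda>v. h (v i)) \<in> borel_measurable (PiM I (\<lambda>_. borel))"
  by (rule measurable_compose[OF measurable_component_singleton[of i I "\<lambda>_. borel"] assms(2)]) (rule assms(1))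

context prob_space
begin

lemma measurable_rand_vec:
  assumes "\<And>j. j \<in> {1..m} \<Longrightarrow> X j \<in> borel_measurable M"
  shows "rand_vec m X \<in> M \<rightarrow>\<^sub>M PiM {1..m} (\<lambda>_. borel)"
  unfolding rand_vec_def by (rule measurable_restrict) (rule assms)

lemma rand_vec_apply: "j \<in> {1..m} \<Longrightarrow> rand_vec m X \<omega> j = X j \<omega>"
  by (simp add: rand_vec_def)

lemma independent_copies_measurable:
  assumes "independent_copies M m X Q" "1 \<le> i"
  shows "rand_vec m (Q i) \<in> M \<rightarrow>\<^sub>M PiM {1..m} (\<lambda>_. borel)"
    and "j \<in> {1..m} \<Longrightarrow> Q i j \<in> borel_measurable M"
proof -
  show rv: "rand_vec m (Q i) \<in> M \<rightarrow>\<^sub>M PiM {1..m} (\<lambda>_. borel)"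
    using assms unfolding independent_copies_def indep_vars_def2 by simp
  show "Q i j \<in> borel_measurable M" if "j \<in> {1..m}"
    using measurable_compose[OF rv measurable_component_singleton[OF that]] by (simp add: rand_vec_apply[OF that])
qed

lemma independent_copies_map:
  assumes copies: "independent_copies M m X Q"
    and X: "\<And>j. j \<in> {1..m} \<Longrightarrow> X j \<in> borel_measurable M"
    and f: "\<And>j. j \<in> {1..m} \<Longrightarrow> f j \<in> borel_measurable borel"
  shows "independent_copies M m (\<lambda>j \<omega>. f j (X j \<omega>)) (\<lambda>i j \<omega>. f j (Q i j \<omega>))"
proof -
  let ?P = "PiM {1..m} (\<lambda>_. borel :: real measure)"
  define g where "g v = (\<lambda>j\<in>{1..m}. f j (v j))" for v :: "nat \<Rightarrow> real"
  have g: "g \<in> ?P \<rightarrow>\<^sub>M ?P"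
    unfolding g_def by (intro measurable_restrict measurable_PiM_borel_component f)
  have gX: "rand_vec m (\<lambda>j \<omega>. f j (Y j \<omega>)) = (\<lambda>\<omega>. g (rand_vec m Y \<omega>))" for Y :: "nat \<Rightarrow> 'a \<Rightarrow> real"
    by (auto simp: rand_vec_def g_def fun_eq_iff)
  have "indep_vars (\<lambda>_. ?P) (\<lambda>i \<omega>. g (rand_vec m (Q i) \<omega>)) {1..}"
    using copies unfolding independent_copies_def by (intro indep_vars_compose2[OF _ g]) auto
  moreover have "distr M ?P (\<lambda>\<omega>. g (rand_vec m (Q i) \<omega>)) = distr M ?P (\<lambda>\<omega>. g (rand_vec m X \<omega>))" if "1 \<le> i" for i
    using copies that distr_distr[OF g independent_copies_measurable(1)[OF copies that]] distr_distr[OF g measurable_rand_vec[OF X, of m]]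
    unfolding independent_copies_def comp_def by simp
  ultimately show ?thesis unfolding independent_copies_def gX by simp
qed

lemma independent_copies_transfer:
  fixes F :: "(nat \<Rightarrow> real) \<Rightarrow> real"
  assumes copies: "independent_copies M m X Q"
    and X: "\<And>j. j \<in> {1..m} \<Longrightarrow> X j \<in> borel_measurable M"
    and F: "F \<in> borel_measurable (PiM {1..m} (\<lambda>_. borel))" and "1 \<le> i"
  shows "expectation (\<lambda>\<omega>. F (rand_vec m (Q i) \<omega>)) = expectation (\<lambda>\<omega>. F (rand_vec m X \<omega>))"
    and "integrable M (\<lambda>\<omega>. F (rand_vec m (Q i) \<omega>)) \<longleftrightarrow> integrable M (\<lambda>\<omega>. F (rand_vec m X \<omega>))"
    and "distr M borel (\<lambda>\<omega>. F (rand_vec m (Q i) \<omega>)) = distr M borel (\<lambda>\<omega>. F (rand_vec m X \<omega>))"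
proof -
  let ?P = "PiM {1..m} (\<lambda>_. borel :: real measure)"
  have eq: "distr M ?P (rand_vec m (Q i)) = distr M ?P (rand_vec m X)"
    using copies \<open>1 \<le> i\<close> unfolding independent_copies_def by blast
  note rv = independent_copies_measurable(1)[OF copies \<open>1 \<le> i\<close>] measurable_rand_vec[OF X, of m]
  show "expectation (\<lambda>\<omega>. F (rand_vec m (Q i) \<omega>)) = expectation (\<lambda>\<omega>. F (rand_vec m X \<omega>))"
    using integral_distr[OF rv(1) F] integral_distr[OF rv(2) F] eq by simp
  show "integrable M (\<lambda>\<omega>. F (rand_vec m (Q i) \<omega>)) \<longleftrightarrow> integrable M (\<lambda>\<omega>. F (rand_vec m X \<omega>))"
    using integrable_distr_eq[OF rv(1) F] integrable_distr_eq[OF rv(2) F] eq by simp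
  show "distr M borel (\<lambda>\<omega>. F (rand_vec m (Q i) \<omega>)) = distr M borel (\<lambda>\<omega>. F (rand_vec m X \<omega>))"
    using distr_distr[OF F rv(1)] distr_distr[OF F rv(2)] eq by (simp add: comp_def)
qed

text \<open>The \<open>- 1\<close> is the mean of an exponential excess and is charged only on
  exceedances, so the score has mean 0 and vanishes below \<open>y\<close>.\<close>

definition excess_score :: "real \<Rightarrow> real \<Rightarrow> real" where
  "excess_score y x = indicat_real {y..} x * (x - y - 1)"

lemma borel_measurable_excess_score [measurable]: "excess_score y \<in> borel_measurable borel"
  unfolding excess_score_def by measurable

lemma excess_score_moments:
  assumes D: "distributed M lborel X (exponential_density 1)" and y: "0 \<le> y"
  shows "integrable M (\<lambda>\<omega>. excess_score y (X \<omega>))" "expectation (\<lambda>\<omega>. excess_score y (X \<omega>)) = 0"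
    "integrable M (\<lambda>\<omega>. (excess_score y (X \<omega>))\<^sup>2)" "expectation (\<lambda>\<omega>. (excess_score y (X \<omega>))\<^sup>2) = exp (- y)"
    "integrable M (\<lambda>\<omega>. \<bar>excess_score y (X \<omega>)\<bar> ^ 3)"
    "expectation (\<lambda>\<omega>. \<bar>excess_score y (X \<omega>)\<bar> ^ 3) = exp (- y) * (LINT x|std_exponential. \<bar>x - 1\<bar> ^ 3)"
proof -
  note ex = exponential_excess_integrable[OF D y] exponential_excess_expectation[OF D y]
  note c = std_exponential_centred
  have 2: "(excess_score y x)\<^sup>2 = indicat_real {y..} x * ((x - y) - 1)\<^sup>2"
    and 3: "\<bar>excess_score y x\<bar> ^ 3 = indicat_real {y..} x * \<bar>(x - y) - 1\<bar> ^ 3" for x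
    by (simp_all add: excess_score_def indicator_def)
  show "integrable M (\<lambda>\<omega>. excess_score y (X \<omega>))" "expectation (\<lambda>\<omega>. excess_score y (X \<omega>)) = 0"
    unfolding excess_score_def using ex[of "\<lambda>x. x - 1"] c by simp_all
  show "integrable M (\<lambda>\<omega>. (excess_score y (X \<omega>))\<^sup>2)" "expectation (\<lambda>\<omega>. (excess_score y (X \<omega>))\<^sup>2) = exp (- y)"
    unfolding 2 using ex[of "\<lambda>x. (x - 1)\<^sup>2"] c by simp_all
  show "integrable M (\<lambda>\<omega>. \<bar>excess_score y (X \<omega>)\<bar> ^ 3)"
    "expectation (\<lambda>\<omega>. \<bar>excess_score y (X \<omega>)\<bar> ^ 3) = exp (- y) * (LINT x|std_exponential. \<bar>x - 1\<bar> ^ 3)"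
    unfolding 3 using ex[of "\<lambda>x. \<bar>x - 1\<bar> ^ 3"] c by simp_all
qed

text \<open>The weights \<open>v\<close> reduce the joint limit to one dimension, as in the
  Cramer-Wold device. Row \<open>i\<close> collects the components of the \<open>i\<close>-th copy
  that are sampled, those with \<open>i \<le> N j n\<close>; rows are independent although
  components within a row are not, and \<open>min (N j n) (N l n)\<close> counts the rows shared by
  two samples. Setting \<open>S\<close> to 0 outside \<open>good\<close> makes the moment conditions
  hold at every index.\<close>

lemma exponential_copies_CLT_char:
  fixes X :: "nat \<Rightarrow> 'a \<Rightarrow> real" and Q :: "nat \<Rightarrow> nat \<Rightarrow> 'a \<Rightarrow> real"
    and N k :: "nat \<Rightarrow> nat \<Rightarrow> nat" and v :: "nat \<Rightarrow> real" and \<Gamma> :: "nat \<Rightarrow> nat \<Rightarrow> real"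
  assumes copies: "independent_copies M m X Q"
    and exponential: "\<And>j. j \<in> {1..m} \<Longrightarrow> distributed M lborel (X j) (exponential_density 1)"
    and N_top: "\<And>j. j \<in> {1..m} \<Longrightarrow> filterlim (N j) at_top sequentially"
    and k_top: "\<And>j. j \<in> {1..m} \<Longrightarrow> filterlim (k j) at_top sequentially"
    and cov: "\<And>j l. j \<in> {1..m} \<Longrightarrow> l \<in> {1..m} \<Longrightarrow>
      (\<lambda>n. real (min (N j n) (N l n)) / (sqrt (real (k j n)) * sqrt (real (k l n))) *
        expectation (\<lambda>\<omega>. excess_score (ln (real (N j n) / real (k j n))) (X j \<omega>) *
          excess_score (ln (real (N l n) / real (k l n))) (X l \<omega>))) \<longlonglongrightarrow> \<Gamma> j l"
    and good: "\<forall>\<^sub>F n in sequentially. good n"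
      "\<And>n j. good n \<Longrightarrow> j \<in> {1..m} \<Longrightarrow> 0 < k j n \<and> k j n < N j n"
  defines "S \<equiv> \<lambda>n \<omega>. if good n then \<Sum>j=1..m. v j *
      ((\<Sum>i=1..N j n. excess_score (ln (real (N j n) / real (k j n))) (Q i j \<omega>)) / sqrt (real (k j n))) else 0"
  shows "S n \<in> borel_measurable M"
    and "(\<lambda>n. char (distr M borel (S n)) t) \<longlonglongrightarrow> of_real (exp (- (t\<^sup>2 * (\<Sum>j=1..m. \<Sum>l=1..m. v j * v l * \<Gamma> j l) / 2)))"
proof -
  let ?P = "PiM {1..m} (\<lambda>_. borel :: real measure)"
  have X: "\<And>j. j \<in> {1..m} \<Longrightarrow> X j \<in> borel_measurable M"
    using distributed_measurable[OF exponential] by simp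
  define D where "D j n x = excess_score (ln (real (N j n) / real (k j n))) x" for j n x
  have D_m: "D j n \<in> borel_measurable borel" for j n unfolding D_def[abs_def] by measurable
  define a where "a j n = v j / sqrt (real (k j n))" for j n
  define \<Phi> where "\<Phi> n i x = (\<Sum>j=1..m. of_bool (i \<le> N j n) * (a j n * D j n (x j)))" for n i and x :: "nat \<Rightarrow> real"
  have \<Phi>_m: "\<Phi> n i \<in> borel_measurable ?P" for n i
    unfolding \<Phi>_def[abs_def]
    by (intro borel_measurable_sum borel_measurable_times borel_measurable_const measurable_PiM_borel_component D_m)
  \<comment> \<open>A common index range containing all samples; the factor \<open>of_bool\<close>
    in \<open>\<Phi>\<close> switches off the components not sampled. It is empty outside
    \<open>good\<close>.\<close>
  define I where "I n = (if good n then {1..\<Sum>j=1..m. N j n} else {})" for n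
  define \<xi> where "\<xi> n i \<omega> = \<Phi> n i (rand_vec m (Q i) \<omega>)" for n i \<omega>
  \<comment> \<open>The same function of the generic vector \<open>X\<close>: moments are computed
    for \<open>\<zeta>\<close> and carried over to \<open>\<xi>\<close> by equality in law.\<close>
  define \<zeta> where "\<zeta> n i \<omega> = \<Phi> n i (rand_vec m X \<omega>)" for n i \<omega>
  have \<zeta>: "\<zeta> n i \<omega> = (\<Sum>j=1..m. of_bool (i \<le> N j n) * (a j n * D j n (X j \<omega>)))" for n i \<omega>
    unfolding \<zeta>_def \<Phi>_def by (intro sum.cong) (simp_all add: rand_vec_apply)
  have N_le: "N j n \<le> (\<Sum>j=1..m. N j n)" if "j \<in> {1..m}" for j n
    using that by (intro member_le_sum) auto
  have S: "S n \<omega> = (\<Sum>i\<in>I n. \<xi> n i \<omega>)" for n \<omega>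
  proof (cases "good n")
    case True
    have "(\<Sum>i\<in>I n. \<xi> n i \<omega>) = (\<Sum>i=1..\<Sum>j=1..m. N j n. \<Sum>j=1..m. of_bool (i \<le> N j n) * (a j n * D j n (Q i j \<omega>)))"
      unfolding I_def \<xi>_def \<Phi>_def using True by (intro sum.cong) (simp_all add: rand_vec_apply)
    also have "\<dots> = (\<Sum>j=1..m. \<Sum>i=1..\<Sum>j=1..m. N j n. of_bool (i \<le> N j n) * (a j n * D j n (Q i j \<omega>)))"
      by (rule sum.swap)
    also have "\<dots> = (\<Sum>j=1..m. \<Sum>i=1..N j n. a j n * D j n (Q i j \<omega>))"
    proof (rule sum.cong[OF refl])
      fix j assume "j \<in> {1..m}"
      then show "(\<Sum>i=1..\<Sum>j=1..m. N j n. of_bool (i \<le> N j n) * (a j n * D j n (Q i j \<omega>))) = (\<Sum>i=1..N j n. a j n * D j n (Q i j \<omega>))"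
        using N_le[of j n] by (intro sum.mono_neutral_cong_right) auto
    qed
    also have "\<dots> = S n \<omega>"
      using True unfolding S_def a_def D_def by (simp add: sum_distrib_left sum_divide_distrib)
    finally show ?thesis ..
  qed (simp add: S_def I_def)
  have I1: "1 \<le> i" if "i \<in> I n" for i n using that by (auto simp: I_def split: if_splits)
  show "S n \<in> borel_measurable M"
    unfolding S[abs_def] \<xi>_def
    by (intro borel_measurable_sum measurable_compose[OF independent_copies_measurable(1)[OF copies I1] \<Phi>_m])
  have indep: "indep_vars (\<lambda>_. borel) (\<xi> n) (I n)" for n
  proof -
    have "indep_vars (\<lambda>_. ?P) (\<lambda>i. rand_vec m (Q i)) {1..}"
      using copies unfolding independent_copies_def by (rule conjunct1)
    then have "indep_vars (\<lambda>_. ?P) (\<lambda>i. rand_vec m (Q i)) (I n)"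
      by (rule indep_vars_subset) (auto dest: I1)
    then show ?thesis unfolding \<xi>_def[abs_def] by (rule indep_vars_compose2) (rule \<Phi>_m)
  qed
  have transfer: "expectation (\<lambda>\<omega>. h (\<xi> n i \<omega>)) = expectation (\<lambda>\<omega>. h (\<zeta> n i \<omega>))"
    "integrable M (\<lambda>\<omega>. h (\<xi> n i \<omega>)) \<longleftrightarrow> integrable M (\<lambda>\<omega>. h (\<zeta> n i \<omega>))"
    if "i \<in> I n" "h \<in> borel_measurable borel" for h :: "real \<Rightarrow> real" and n i
    unfolding \<xi>_def \<zeta>_def
    using independent_copies_transfer(1,2)[OF copies X measurable_compose[OF \<Phi>_m that(2)] I1[OF that(1)]] by simp_all
  have goodI: "good n" if "i \<in> I n" for i n using that by (auto simp: I_def split: if_splits)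
  have level: "0 \<le> ln (real (N j n) / real (k j n))" "exp (- ln (real (N j n) / real (k j n))) = real (k j n) / real (N j n)"
    if "good n" "j \<in> {1..m}" for j n
    using good(2)[OF that] by (simp_all add: exp_minus)
  have DX_m: "(\<lambda>\<omega>. D j n (X j \<omega>)) \<in> borel_measurable M" if "j \<in> {1..m}" for j n
    by (rule measurable_compose[OF X[OF that] D_m])
  have mom: "integrable M (\<lambda>\<omega>. D j n (X j \<omega>))" "expectation (\<lambda>\<omega>. D j n (X j \<omega>)) = 0"
    "integrable M (\<lambda>\<omega>. (D j n (X j \<omega>))\<^sup>2)" "expectation (\<lambda>\<omega>. (D j n (X j \<omega>))\<^sup>2) = real (k j n) / real (N j n)"
    "integrable M (\<lambda>\<omega>. \<bar>D j n (X j \<omega>)\<bar> ^ 3)"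
    "expectation (\<lambda>\<omega>. \<bar>D j n (X j \<omega>)\<bar> ^ 3) = real (k j n) / real (N j n) * (LINT x|std_exponential. \<bar>x - 1\<bar> ^ 3)"
    if "good n" "j \<in> {1..m}" for j n
    using excess_score_moments[OF exponential[OF that(2)] level(1)[OF that]] level(2)[OF that] unfolding D_def by simp_all
  define C where "C j l n = expectation (\<lambda>\<omega>. D j n (X j \<omega>) * D l n (X l \<omega>))" for j l n
  have prod_int: "integrable M (\<lambda>\<omega>. D j n (X j \<omega>) * D l n (X l \<omega>))" if "good n" "j \<in> {1..m}" "l \<in> {1..m}" for j l n
  proof (rule Bochner_Integration.integrable_bound)
    show "integrable M (\<lambda>\<omega>. (D j n (X j \<omega>))\<^sup>2 + (D l n (X l \<omega>))\<^sup>2)"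
      by (intro Bochner_Integration.integrable_add mom that)
    show "(\<lambda>\<omega>. D j n (X j \<omega>) * D l n (X l \<omega>)) \<in> borel_measurable M"
      by (intro borel_measurable_times DX_m that)
    show "AE \<omega> in M. norm (D j n (X j \<omega>) * D l n (X l \<omega>)) \<le> norm ((D j n (X j \<omega>))\<^sup>2 + (D l n (X l \<omega>))\<^sup>2)"
      using abs_mult_le_sum_squares by (intro AE_I2) (simp add: abs_of_nonneg)
  qed
  have sq: "(\<zeta> n i \<omega>)\<^sup>2 = (\<Sum>j=1..m. \<Sum>l=1..m. of_bool (i \<le> N j n) * of_bool (i \<le> N l n) * (a j n * a l n) * (D j n (X j \<omega>) * D l n (X l \<omega>)))" for n i \<omega>
    unfolding \<zeta> power2_eq_square sum_product by (intro sum.cong refl) (simp add: mult_ac)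
  have int2: "integrable M (\<lambda>\<omega>. (\<zeta> n i \<omega>)\<^sup>2)" and
    E2: "expectation (\<lambda>\<omega>. (\<zeta> n i \<omega>)\<^sup>2) = (\<Sum>j=1..m. \<Sum>l=1..m. of_bool (i \<le> N j n) * of_bool (i \<le> N l n) * (a j n * a l n) * C j l n)"
    if "good n" for n i
  proof -
    show "integrable M (\<lambda>\<omega>. (\<zeta> n i \<omega>)\<^sup>2)"
      unfolding sq by (intro Bochner_Integration.integrable_sum integrable_mult_right prod_int that)
    show "expectation (\<lambda>\<omega>. (\<zeta> n i \<omega>)\<^sup>2) = (\<Sum>j=1..m. \<Sum>l=1..m. of_bool (i \<le> N j n) * of_bool (i \<le> N l n) * (a j n * a l n) * C j l n)"
      unfolding sq C_def using prod_int[OF that]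
      by (subst Bochner_Integration.integral_sum, intro Bochner_Integration.integrable_sum integrable_mult_right prod_int that, simp, simp,
          intro sum.cong refl, subst Bochner_Integration.integral_sum, intro integrable_mult_right prod_int that, auto)
  qed
  have mean: "expectation (\<zeta> n i) = 0" if "good n" for n i
    unfolding \<zeta>[abs_def] using mom(1,2)[OF that] by (subst Bochner_Integration.integral_sum) auto
  have int3: "integrable M (\<lambda>\<omega>. \<bar>\<zeta> n i \<omega>\<bar> ^ 3)" and
    E3: "expectation (\<lambda>\<omega>. \<bar>\<zeta> n i \<omega>\<bar> ^ 3) \<le> real m ^ 3 * (\<Sum>j=1..m. of_bool (i \<le> N j n) * (\<bar>a j n\<bar> ^ 3 *
      (real (k j n) / real (N j n) * (LINT x|std_exponential. \<bar>x - 1\<bar> ^ 3))))"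
    if "good n" for n i
  proof -
    let ?w = "\<lambda>\<omega>. real m ^ 3 * (\<Sum>j=1..m. of_bool (i \<le> N j n) * (\<bar>a j n\<bar> ^ 3 * \<bar>D j n (X j \<omega>)\<bar> ^ 3))"
    have w: "integrable M ?w"
      by (intro integrable_mult_right Bochner_Integration.integrable_sum mom that)
    have cube: "\<bar>of_bool P * (x * y)\<bar> ^ 3 = of_bool P * (\<bar>x\<bar> ^ 3 * \<bar>y\<bar> ^ 3)" for P and x y :: real
      by (cases P) (simp_all add: abs_mult power_mult_distrib)
    have le: "\<bar>\<zeta> n i \<omega>\<bar> ^ 3 \<le> ?w \<omega>" for \<omega>
      using abs_sum_cubed_le[of "{1..m}" "\<lambda>j. of_bool (i \<le> N j n) * (a j n * D j n (X j \<omega>))"]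
      unfolding \<zeta> cube by simp
    show int: "integrable M (\<lambda>\<omega>. \<bar>\<zeta> n i \<omega>\<bar> ^ 3)"
    proof (rule Bochner_Integration.integrable_bound[OF w])
      have "\<zeta> n i \<in> borel_measurable M"
        unfolding \<zeta>[abs_def] by (intro borel_measurable_sum borel_measurable_times borel_measurable_const DX_m)
      then show "(\<lambda>\<omega>. \<bar>\<zeta> n i \<omega>\<bar> ^ 3) \<in> borel_measurable M" by measurable
      show "AE \<omega> in M. norm (\<bar>\<zeta> n i \<omega>\<bar> ^ 3) \<le> norm (?w \<omega>)"
        using le by (intro AE_I2) (simp add: order_trans[OF _ abs_ge_self])
    qed
    have "expectation (\<lambda>\<omega>. \<bar>\<zeta> n i \<omega>\<bar> ^ 3) \<le> expectation ?w" using int w le by (rule integral_mono)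
    also have "\<dots> = real m ^ 3 * (\<Sum>j=1..m. of_bool (i \<le> N j n) * (\<bar>a j n\<bar> ^ 3 *
      (real (k j n) / real (N j n) * (LINT x|std_exponential. \<bar>x - 1\<bar> ^ 3))))"
      using mom(5,6)[OF that] by (subst integral_mult_right_zero, subst Bochner_Integration.integral_sum) auto
    finally show "expectation (\<lambda>\<omega>. \<bar>\<zeta> n i \<omega>\<bar> ^ 3) \<le> \<dots>" .
  qed
  \<comment> \<open>A bound uniform in the row: \<open>(a j n)\<^sup>2 * (k / N)\<close> equals
    \<open>(v j)\<^sup>2 / N\<close>. It makes single rows negligible.\<close>
  have E2_le: "expectation (\<lambda>\<omega>. (\<zeta> n i \<omega>)\<^sup>2) \<le> real m * (\<Sum>j=1..m. (v j)\<^sup>2 / real (N j n))" if "good n" for n i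
  proof -
    let ?w = "\<lambda>\<omega>. (\<Sum>j=1..m. (a j n)\<^sup>2 * (D j n (X j \<omega>))\<^sup>2) * real m"
    have w: "integrable M ?w"
      by (intro integrable_mult_left integrable_mult_right Bochner_Integration.integrable_sum mom that)
    have "(\<zeta> n i \<omega>)\<^sup>2 \<le> ?w \<omega>" for \<omega>
    proof -
      have "(\<zeta> n i \<omega>)\<^sup>2 \<le> (\<Sum>j=1..m. (of_bool (i \<le> N j n) * (a j n * D j n (X j \<omega>)))\<^sup>2) * real (card {1..m})"
        unfolding \<zeta> by (rule sum_squared_le_sum_of_squares)
      also have "\<dots> \<le> ?w \<omega>"
        by (intro mult_mono sum_mono) (auto simp: power_mult_distrib intro: sum_nonneg)
      finally show ?thesis .
    qed
    then have "expectation (\<lambda>\<omega>. (\<zeta> n i \<omega>)\<^sup>2) \<le> expectation ?w" by (intro integral_mono int2 w that)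
    also have "\<dots> = (\<Sum>j=1..m. (a j n)\<^sup>2 * (real (k j n) / real (N j n))) * real m"
      using mom(3,4)[OF that] by (subst integral_mult_left_zero, subst Bochner_Integration.integral_sum) auto
    also have "(\<Sum>j=1..m. (a j n)\<^sup>2 * (real (k j n) / real (N j n))) = (\<Sum>j=1..m. (v j)\<^sup>2 / real (N j n))"
    proof (intro sum.cong refl)
      fix j assume "j \<in> {1..m}"
      with good(2)[OF that] show "(a j n)\<^sup>2 * (real (k j n) / real (N j n)) = (v j)\<^sup>2 / real (N j n)"
        by (simp add: a_def power_divide)
    qed
    finally show ?thesis by (simp add: mult.commute)
  qed
  have count: "(\<Sum>i\<in>I n. of_bool (i \<le> N j n) * of_bool (i \<le> N l n)) = real (min (N j n) (N l n))"
    if "good n" "j \<in> {1..m}" "l \<in> {1..m}" for j l n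
  proof -
    have "{1..\<Sum>j=1..m. N j n} \<inter> {i. i \<le> N j n \<and> i \<le> N l n} = {1..min (N j n) (N l n)}"
      using N_le[of j n] that by auto
    then show ?thesis using that unfolding I_def of_bool_conj[symmetric] by (simp add: sum_of_bool_eq)
  qed
  have var_eq: "(\<Sum>i\<in>I n. expectation (\<lambda>\<omega>. (\<xi> n i \<omega>)\<^sup>2)) =
      (\<Sum>j=1..m. \<Sum>l=1..m. v j * v l * (real (min (N j n) (N l n)) / (sqrt (real (k j n)) * sqrt (real (k l n))) * C j l n))"
    if "good n" for n
  proof -
    have "(\<Sum>i\<in>I n. expectation (\<lambda>\<omega>. (\<xi> n i \<omega>)\<^sup>2)) = (\<Sum>i\<in>I n. expectation (\<lambda>\<omega>. (\<zeta> n i \<omega>)\<^sup>2))"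
      by (rule sum.cong[OF refl]) (use transfer(1)[of _ _ "\<lambda>x. x\<^sup>2"] in simp)
    also have "\<dots> = (\<Sum>j=1..m. \<Sum>l=1..m. \<Sum>i\<in>I n. of_bool (i \<le> N j n) * of_bool (i \<le> N l n) * (a j n * a l n) * C j l n)"
      unfolding E2[OF that] by (rule trans[OF sum.swap sum.cong[OF refl sum.swap]])
    also have "\<dots> = (\<Sum>j=1..m. \<Sum>l=1..m. v j * v l * (real (min (N j n) (N l n)) / (sqrt (real (k j n)) * sqrt (real (k l n))) * C j l n))"
    proof (intro sum.cong refl)
      fix j l assume "j \<in> {1..m}" "l \<in> {1..m}"
      from count[OF that this] show "(\<Sum>i\<in>I n. of_bool (i \<le> N j n) * of_bool (i \<le> N l n) * (a j n * a l n) * C j l n) =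
          v j * v l * (real (min (N j n) (N l n)) / (sqrt (real (k j n)) * sqrt (real (k l n))) * C j l n)"
        unfolding sum_distrib_right[symmetric] by (simp add: a_def)
    qed
    finally show ?thesis .
  qed
  have var: "(\<lambda>n. \<Sum>i\<in>I n. expectation (\<lambda>\<omega>. (\<xi> n i \<omega>)\<^sup>2)) \<longlonglongrightarrow> (\<Sum>j=1..m. \<Sum>l=1..m. v j * v l * \<Gamma> j l)"
  proof (rule Lim_transform_eventually)
    show "(\<lambda>n. \<Sum>j=1..m. \<Sum>l=1..m. v j * v l * (real (min (N j n) (N l n)) / (sqrt (real (k j n)) * sqrt (real (k l n))) * C j l n))
        \<longlonglongrightarrow> (\<Sum>j=1..m. \<Sum>l=1..m. v j * v l * \<Gamma> j l)"
      unfolding C_def D_def by (intro tendsto_sum tendsto_mult tendsto_const cov)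
    show "\<forall>\<^sub>F n in sequentially. (\<Sum>j=1..m. \<Sum>l=1..m. v j * v l * (real (min (N j n) (N l n)) / (sqrt (real (k j n)) * sqrt (real (k l n))) * C j l n))
        = (\<Sum>i\<in>I n. expectation (\<lambda>\<omega>. (\<xi> n i \<omega>)\<^sup>2))"
      using good(1) by eventually_elim (simp only: var_eq)
  qed
  have Nr: "(\<lambda>n. c / real (N j n)) \<longlonglongrightarrow> 0" if "j \<in> {1..m}" for c j
    by (intro tendsto_divide_0[OF tendsto_const] filterlim_at_top_imp_at_infinity
        filterlim_compose[OF filterlim_real_sequentially N_top] that)
  have kr: "(\<lambda>n. c / sqrt (real (k j n))) \<longlonglongrightarrow> 0" if "j \<in> {1..m}" for c j
    by (intro tendsto_divide_0[OF tendsto_const] filterlim_at_top_imp_at_infinity filterlim_compose[OF sqrt_at_top]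
        filterlim_compose[OF filterlim_real_sequentially k_top] that)
  \<comment> \<open>The sum of the squared second moments is at most a uniform bound for them times
    their sum, and the latter converges.\<close>
  have "(\<lambda>n. (real m * (\<Sum>j=1..m. (v j)\<^sup>2 / real (N j n))) * (\<Sum>i\<in>I n. expectation (\<lambda>\<omega>. (\<xi> n i \<omega>)\<^sup>2))) \<longlonglongrightarrow>
      (real m * (\<Sum>j=1..m. 0)) * (\<Sum>j=1..m. \<Sum>l=1..m. v j * v l * \<Gamma> j l)"
    by (intro tendsto_mult tendsto_const tendsto_sum Nr var)
  then have negl0: "(\<lambda>n. (real m * (\<Sum>j=1..m. (v j)\<^sup>2 / real (N j n))) * (\<Sum>i\<in>I n. expectation (\<lambda>\<omega>. (\<xi> n i \<omega>)\<^sup>2))) \<longlonglongrightarrow> 0"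
    by simp
  have negl: "(\<lambda>n. \<Sum>i\<in>I n. (expectation (\<lambda>\<omega>. (\<xi> n i \<omega>)\<^sup>2))\<^sup>2) \<longlonglongrightarrow> 0"
  proof (rule Lim_null_comparison[OF always_eventually negl0], rule allI)
    fix n
    have "(expectation (\<lambda>\<omega>. (\<xi> n i \<omega>)\<^sup>2))\<^sup>2 \<le> real m * (\<Sum>j=1..m. (v j)\<^sup>2 / real (N j n)) * expectation (\<lambda>\<omega>. (\<xi> n i \<omega>)\<^sup>2)" if "i \<in> I n" for i
      using E2_le[OF goodI[OF that], of i] transfer(1)[OF that, of "\<lambda>x. x\<^sup>2"]
      unfolding power2_eq_square[of "expectation _"] by (intro mult_right_mono) auto
    then show "norm (\<Sum>i\<in>I n. (expectation (\<lambda>\<omega>. (\<xi> n i \<omega>)\<^sup>2))\<^sup>2) \<le> real m * (\<Sum>j=1..m. (v j)\<^sup>2 / real (N j n)) * (\<Sum>i\<in>I n. expectation (\<lambda>\<omega>. (\<xi> n i \<omega>)\<^sup>2))"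
      unfolding sum_distrib_left by (simp add: sum_nonneg sum_mono)
  qed
  let ?\<mu> = "LINT x|std_exponential. \<bar>x - 1\<bar> ^ 3"
  \<comment> \<open>In one sample the third moments add up to \<open>N * (\<bar>v\<bar> / sqrt k) ^
    3 * (k / N) * \<mu> = \<bar>v\<bar> ^ 3 * \<mu> / sqrt k\<close>.\<close>
  have "(\<lambda>n. real m ^ 3 * (\<Sum>j=1..m. \<bar>v j\<bar> ^ 3 * ?\<mu> / sqrt (real (k j n)))) \<longlonglongrightarrow> real m ^ 3 * (\<Sum>j=1..m. 0)"
    by (intro tendsto_mult tendsto_const tendsto_sum kr)
  then have lyap0: "(\<lambda>n. real m ^ 3 * (\<Sum>j=1..m. \<bar>v j\<bar> ^ 3 * ?\<mu> / sqrt (real (k j n)))) \<longlonglongrightarrow> 0" by simp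
  have lyap: "(\<lambda>n. \<Sum>i\<in>I n. expectation (\<lambda>\<omega>. \<bar>\<xi> n i \<omega>\<bar> ^ 3)) \<longlonglongrightarrow> 0"
  proof (rule Lim_null_comparison[OF _ lyap0])
    show "\<forall>\<^sub>F n in sequentially. norm (\<Sum>i\<in>I n. expectation (\<lambda>\<omega>. \<bar>\<xi> n i \<omega>\<bar> ^ 3)) \<le> real m ^ 3 * (\<Sum>j=1..m. \<bar>v j\<bar> ^ 3 * ?\<mu> / sqrt (real (k j n)))"
      using good(1)
    proof eventually_elim
      case (elim n)
      have "(\<Sum>i\<in>I n. expectation (\<lambda>\<omega>. \<bar>\<xi> n i \<omega>\<bar> ^ 3)) = (\<Sum>i\<in>I n. expectation (\<lambda>\<omega>. \<bar>\<zeta> n i \<omega>\<bar> ^ 3))"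
        by (rule sum.cong[OF refl]) (use transfer(1)[of _ _ "\<lambda>x. \<bar>x\<bar> ^ 3"] in simp)
      also have "\<dots> \<le> (\<Sum>i\<in>I n. real m ^ 3 * (\<Sum>j=1..m. of_bool (i \<le> N j n) * (\<bar>a j n\<bar> ^ 3 * (real (k j n) / real (N j n) * ?\<mu>))))"
        by (intro sum_mono E3 elim)
      also have "\<dots> = real m ^ 3 * (\<Sum>j=1..m. \<Sum>i\<in>I n. of_bool (i \<le> N j n) * (\<bar>a j n\<bar> ^ 3 * (real (k j n) / real (N j n) * ?\<mu>)))"
        unfolding sum_distrib_left[symmetric] by (rule arg_cong[OF sum.swap])
      also have "(\<Sum>j=1..m. \<Sum>i\<in>I n. of_bool (i \<le> N j n) * (\<bar>a j n\<bar> ^ 3 * (real (k j n) / real (N j n) * ?\<mu>))) = (\<Sum>j=1..m. \<bar>v j\<bar> ^ 3 * ?\<mu> / sqrt (real (k j n)))"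
      proof (intro sum.cong refl)
        fix j assume j: "j \<in> {1..m}"
        have "(\<Sum>i\<in>I n. of_bool (i \<le> N j n)) = real (N j n)" using count[OF elim j j] by (simp add: of_bool_conj[symmetric])
        moreover have "real (k j n) > 0" "real (N j n) > 0" using good(2)[OF elim j] by auto
        ultimately show "(\<Sum>i\<in>I n. of_bool (i \<le> N j n) * (\<bar>a j n\<bar> ^ 3 * (real (k j n) / real (N j n) * ?\<mu>))) = \<bar>v j\<bar> ^ 3 * ?\<mu> / sqrt (real (k j n))"
          unfolding sum_distrib_right[symmetric] by (simp add: a_def abs_divide power_divide power3_eq_cube)
      qed
      finally show ?case by (simp add: abs_of_nonneg[OF sum_nonneg])
    qed
  qed
  show "(\<lambda>n. char (distr M borel (S n)) t) \<longlonglongrightarrow> of_real (exp (- (t\<^sup>2 * (\<Sum>j=1..m. \<Sum>l=1..m. v j * v l * \<Gamma> j l) / 2)))"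
    unfolding S[abs_def]
  proof (rule Lyapunov_CLT_char[OF indep _ _ _ _ var negl lyap])
    show "finite (I n)" for n by (simp add: I_def)
    fix n i assume i: "i \<in> I n"
    show "integrable M (\<lambda>\<omega>. (\<xi> n i \<omega>)\<^sup>2)"
      using int2[OF goodI[OF i]] transfer(2)[OF i, of "\<lambda>x. x\<^sup>2"] by simp
    show "integrable M (\<lambda>\<omega>. \<bar>\<xi> n i \<omega>\<bar> ^ 3)"
      using int3[OF goodI[OF i]] transfer(2)[OF i, of "\<lambda>x. \<bar>x\<bar> ^ 3"] by simp
    show "expectation (\<xi> n i) = 0"
      using mean[OF goodI[OF i]] transfer(1)[OF i, of "\<lambda>x. x"] by simp
  qed
qed

end

section \<open>Residual-based pooled Hill estimators\<close>

context prob_space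
begin

text \<open>Gathers what a single sample contributes. The copies \<open>e i\<close> share the law of
  \<open>X\<close>, so the transform and the quantile function of \<open>X\<close> serve all of
  them, and the transformed errors form an exponential sample.\<close>

lemma residual_hill_component:
  fixes X :: "'a \<Rightarrow> real" and e :: "nat \<Rightarrow> 'a \<Rightarrow> real" and r :: "nat \<Rightarrow> nat \<Rightarrow> 'a \<Rightarrow> real"
    and N k :: "nat \<Rightarrow> nat" and A :: "real \<Rightarrow> real"
  assumes X: "X \<in> borel_measurable M" "continuous_on UNIV (dist_fun M X)"
    and indep: "indep_vars (\<lambda>_. borel) e {1..}"
    and law: "\<And>i. 1 \<le> i \<Longrightarrow> distr M borel (e i) = distr M borel X"
    and N_top: "filterlim N at_top sequentially" and k_top: "filterlim k at_top sequentially"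
    and k_small: "(\<lambda>n. real (k n) / real (N n)) \<longlonglongrightarrow> 0"
    and "0 < \<gamma>" "\<rho> \<le> 0" and sgn: "\<And>t. 0 < t \<Longrightarrow> sgn (A t) = c" and A0: "(A \<longlongrightarrow> 0) at_top"
    and lim: "\<And>x. 0 < x \<Longrightarrow> ((\<lambda>t. 1 / A t * (tail_quantile M X (t * x) / tail_quantile M X t - x powr \<gamma>)) \<longlongrightarrow>
      (if \<rho> = 0 then x powr \<gamma> * ln x else x powr \<gamma> * ((x powr \<rho> - 1) / \<rho>))) at_top"
    and lam: "(\<lambda>n. sqrt (real (k n)) * A (real (N n) / real (k n))) \<longlonglongrightarrow> lam"
    and res: "prob_lim M (\<lambda>n \<omega>. sqrt (real (k n)) * (MAX i\<in>{1..N n}. \<bar>r n i \<omega> - e i \<omega>\<bar> / (1 + \<bar>e i \<omega>\<bar>))) 0"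
  defines "F \<equiv> \<lambda>n \<omega>. (\<Sum>i=1..N n. excess_score (ln (real (N n) / real (k n))) (exp_transform M X (e i \<omega>))) / sqrt (real (k n))"
  shows "prob_lim M (\<lambda>n \<omega>. sqrt (real (k n)) * (hill (\<lambda>i. r n i \<omega>) (N n) (k n) - \<gamma>) - \<gamma> * F n \<omega>) (lam / (1 - \<rho>))"
    and "prob_bounded M F"
    and "\<forall>\<^sub>F n in sequentially. 0 < k n \<and> k n < N n"
    and "filterlim (\<lambda>n. ln (real (N n) / real (k n))) at_top sequentially"
proof -
  have e: "e i \<in> borel_measurable M" "dist_fun M (e i) = dist_fun M X" if "1 \<le> i" for i
    using indep law[OF that] that unfolding indep_vars_def2 dist_fun_def by auto
  have e_cont: "continuous_on UNIV (dist_fun M (e i))" if "1 \<le> i" for i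
    using X(2) e(2)[OF that] by simp
  have same: "exp_transform M (e i) = exp_transform M X" "tail_quantile M (e i) = tail_quantile M X" if "1 \<le> i" for i
    using e(2)[OF that] unfolding exp_transform_def tail_quantile_def survival_def by (simp_all add: fun_eq_iff)
  interpret S: exponential_sample M "\<lambda>i \<omega>. exp_transform M X (e i \<omega>)" N k
  proof
    show "indep_vars (\<lambda>_. borel) (\<lambda>i \<omega>. exp_transform M X (e i \<omega>)) {1..}"
      using indep by (rule indep_vars_compose2) (rule borel_measurable_exp_transform[OF X])
    show "distributed M lborel (\<lambda>\<omega>. exp_transform M X (e i \<omega>)) (exponential_density 1)" if "1 \<le> i" for i
      using exp_transform_distributed[OF e(1)[OF that] e_cont[OF that]] same[OF that] by simp
  qed fact+
  have F: "S.tail_fluct = F"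
    unfolding F_def S.tail_fluct_def[abs_def] S.level_def excess_score_def ..
  show "prob_bounded M F" using S.tail_fluct_bounded unfolding F .
  show "\<forall>\<^sub>F n in sequentially. 0 < k n \<and> k n < N n" by (rule S.eventually_k)
  show "filterlim (\<lambda>n. ln (real (N n) / real (k n))) at_top sequentially"
    using S.level_top unfolding S.level_def[abs_def] .
  obtain u s0 where u: "mono u"
    "\<And>s. s0 \<le> s \<Longrightarrow> 1 \<le> tail_quantile M X (exp s) \<and> u s = ln (tail_quantile M X (exp s))"
    "\<And>x. ((\<lambda>s. (u (s + x) - u s - \<gamma> * x) / A (exp s)) \<longlongrightarrow> second_order_limit \<rho> x) at_top"
    using quantile_second_order[OF X \<open>0 < \<gamma>\<close> A0 lim] by blast
  have "prob_lim M (\<lambda>n \<omega>. sqrt (real (k n)) * (hill (\<lambda>i. r n i \<omega>) (N n) (k n) - \<gamma>) - \<gamma> * S.tail_fluct n \<omega>) (lam / (1 - \<rho>))"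
  proof (rule S.residual_hill_expansion[OF _ u _ \<open>\<rho> \<le> 0\<close> _ _ _ res])
    show "mono_on {0<..} (\<lambda>s. tail_quantile M X (exp s))"
      by (intro mono_onI tail_quantile_mono[OF X]) auto
    show "\<forall>\<^sub>F s in at_top. sgn (A (exp s)) = c" using sgn by simp
    show "((\<lambda>s. A (exp s)) \<longlongrightarrow> 0) at_top" by (rule filterlim_compose[OF A0 exp_at_top])
    show "(\<lambda>n. sqrt (real (k n)) * A (exp (S.level n))) \<longlonglongrightarrow> lam"
      using lam
    proof (rule Lim_transform_eventually)
      show "\<forall>\<^sub>F n in sequentially. sqrt (real (k n)) * A (real (N n) / real (k n)) = sqrt (real (k n)) * A (exp (S.level n))"
        using S.eventually_k by eventually_elim (simp add: S.level_def)
    qed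
    show "AE \<omega> in M. 0 < exp_transform M X (e i \<omega>) \<and> e i \<omega> = tail_quantile M X (exp (exp_transform M X (e i \<omega>)))"
      if "1 \<le> i" for i
      using AE_exp_transform_pos[OF e(1)[OF that] e_cont[OF that]] AE_quantile_exp_transform[OF e(1)[OF that] e_cont[OF that]]
      unfolding same[OF that] by eventually_elim simp
  qed
  then show "prob_lim M (\<lambda>n \<omega>. sqrt (real (k n)) * (hill (\<lambda>i. r n i \<omega>) (N n) (k n) - \<gamma>) - \<gamma> * F n \<omega>) (lam / (1 - \<rho>))"
    unfolding F .
qed

text \<open>\<open>N\<close> is the smaller sample size, so the factor is
  \<open>N / sqrt (k * k') = sqrt (k / k') * exp y\<close>. The levels differ in the limit by
  \<open>ln (\<beta> / \<kappa>)\<close>, which leads to \<open>G\<close> at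
  \<open>(1, \<beta> / \<kappa>)\<close>; homogeneity rewrites this as \<open>G\<close> at
  \<open>(\<kappa>, \<beta>)\<close> divided by \<open>\<kappa>\<close>, and the limit
  \<open>sqrt \<kappa>\<close> of the first factor leaves \<open>1 / sqrt \<kappa>\<close>.\<close>

lemma excess_score_covariance_limit:
  fixes X Y :: "'a \<Rightarrow> real" and N N' k k' :: "nat \<Rightarrow> nat" and G :: "ennreal \<Rightarrow> ennreal \<Rightarrow> real"
  assumes X: "X \<in> borel_measurable M" "continuous_on UNIV (dist_fun M X)"
    and Y: "Y \<in> borel_measurable M" "continuous_on UNIV (dist_fun M Y)"
    and G: "\<And>x y. (x, y) \<noteq> (\<infinity>, \<infinity>) \<Longrightarrow>
      ((\<lambda>s. s * survival_copula M X Y (x / ennreal s) (y / ennreal s)) \<longlongrightarrow> G x y) at_top"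
    and ev: "\<forall>\<^sub>F n in sequentially. 0 < k n \<and> k n < N n \<and> 0 < k' n \<and> k' n < N' n \<and> N n \<le> N' n"
    and level_top: "filterlim (\<lambda>n. ln (real (N n) / real (k n))) at_top sequentially"
    and N_ratio: "(\<lambda>n. real (N n) / real (N' n)) \<longlonglongrightarrow> \<beta>" and k_ratio: "(\<lambda>n. real (k n) / real (k' n)) \<longlonglongrightarrow> \<kappa>"
    and pos: "0 < \<beta>" "0 < \<kappa>"
  shows "(\<lambda>n. real (min (N n) (N' n)) / (sqrt (real (k n)) * sqrt (real (k' n))) *
        expectation (\<lambda>\<omega>. excess_score (ln (real (N n) / real (k n))) (exp_transform M X (X \<omega>)) *
          excess_score (ln (real (N' n) / real (k' n))) (exp_transform M Y (Y \<omega>)))) \<longlonglongrightarrow> G (ennreal \<kappa>) (ennreal \<beta>) / sqrt \<kappa>"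
proof -
  let ?y = "\<lambda>n. ln (real (N n) / real (k n))" and ?t = "\<lambda>n. ln (real (N' n) / real (k' n))"
  let ?E = "\<lambda>n. expectation (\<lambda>\<omega>. excess_score (?y n) (exp_transform M X (X \<omega>)) * excess_score (?t n) (exp_transform M Y (Y \<omega>)))"
  define g where "g u v = G (ennreal u) (ennreal v)" for u v
  note DX = exp_transform_distributed[OF X] and DY = exp_transform_distributed[OF Y]
  have g: "((\<lambda>s. s * prob {\<omega> \<in> space M. ln s - ln u \<le> exp_transform M X (X \<omega>) \<and> ln s - ln v \<le> exp_transform M Y (Y \<omega>)}) \<longlongrightarrow> g u v) at_top"
    if "0 < u" "0 < v" for u v
    unfolding g_def using that by (intro survival_copula_limit[OF X Y G]) auto
  have "(\<lambda>n. real (N n) / real (N' n) / (real (k n) / real (k' n))) \<longlonglongrightarrow> \<beta> / \<kappa>"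
    using pos by (intro tendsto_divide N_ratio k_ratio) auto
  then have "(\<lambda>n. ln (real (N n) / real (N' n) / (real (k n) / real (k' n)))) \<longlonglongrightarrow> ln (\<beta> / \<kappa>)"
    using pos by (intro tendsto_ln) auto
  then have d: "(\<lambda>n. ?y n - ?t n) \<longlonglongrightarrow> ln (\<beta> / \<kappa>)"
  proof (rule Lim_transform_eventually)
    show "\<forall>\<^sub>F n in sequentially. ln (real (N n) / real (N' n) / (real (k n) / real (k' n))) = ?y n - ?t n"
      using ev by eventually_elim (simp add: ln_div ln_mult)
  qed
  have "(\<lambda>n. exp (?y n) * ?E n) \<longlonglongrightarrow> g 1 (exp (ln (\<beta> / \<kappa>)))"
    unfolding excess_score_def by (rule exponential_tail_covariance_of_copula(1)[OF DX DY g level_top d])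
  moreover have "g 1 (exp (ln (\<beta> / \<kappa>))) = inverse \<kappa> * g \<kappa> \<beta>"
    using exponential_tail_covariance_of_copula(2)[OF DX DY g level_top d, of "inverse \<kappa>" \<kappa> \<beta>] pos
    by (simp add: divide_inverse mult.commute)
  ultimately have "(\<lambda>n. exp (?y n) * ?E n) \<longlonglongrightarrow> inverse \<kappa> * g \<kappa> \<beta>" by simp
  from tendsto_mult[OF tendsto_real_sqrt[OF k_ratio] this]
  have "(\<lambda>n. sqrt (real (k n) / real (k' n)) * (exp (?y n) * ?E n)) \<longlonglongrightarrow> sqrt \<kappa> * (inverse \<kappa> * g \<kappa> \<beta>)" .
  moreover have "sqrt \<kappa> * (inverse \<kappa> * g \<kappa> \<beta>) = G (ennreal \<kappa>) (ennreal \<beta>) / sqrt \<kappa>"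
  proof -
    have "sqrt \<kappa> * inverse \<kappa> = 1 / sqrt \<kappa>" using pos by (simp add: field_simps)
    then show ?thesis by (simp add: g_def mult.assoc[symmetric])
  qed
  ultimately have "(\<lambda>n. sqrt (real (k n) / real (k' n)) * (exp (?y n) * ?E n)) \<longlonglongrightarrow> G (ennreal \<kappa>) (ennreal \<beta>) / sqrt \<kappa>"
    by simp
  then show ?thesis
  proof (rule Lim_transform_eventually)
    show "\<forall>\<^sub>F n in sequentially. sqrt (real (k n) / real (k' n)) * (exp (?y n) * ?E n) =
        real (min (N n) (N' n)) / (sqrt (real (k n)) * sqrt (real (k' n))) * ?E n"
      using ev
    proof eventually_elim
      case (elim n)
      have "sqrt (real (k n) / real (k' n)) * exp (?y n) = real (min (N n) (N' n)) / (sqrt (real (k n)) * sqrt (real (k' n)))"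
        using elim by (simp add: real_sqrt_divide min_absorb1 field_simps)
      then show ?case by (simp add: mult.assoc[symmetric])
    qed
  qed
qed

end

theorem theorem8:
  fixes M :: "'a measure"
    and m :: nat
    and \<epsilon> :: "nat \<Rightarrow> 'a \<Rightarrow> real"
    and e :: "nat \<Rightarrow> nat \<Rightarrow> 'a \<Rightarrow> real"
    and r :: "nat \<Rightarrow> nat \<Rightarrow> nat \<Rightarrow> 'a \<Rightarrow> real"
    and N k :: "nat \<Rightarrow> nat \<Rightarrow> nat"
    and \<gamma> :: real
    and \<rho> b c lam w :: "nat \<Rightarrow> real"
    and A :: "nat \<Rightarrow> real \<Rightarrow> real"
    and R :: "nat \<Rightarrow> nat \<Rightarrow> ennreal \<Rightarrow> ennreal \<Rightarrow> real"
  assumes "prob_space M"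
    and "m \<ge> 1"
    and "\<And>j. j \<in> {1..m} \<Longrightarrow> \<epsilon> j \<in> borel_measurable M"
    and "\<And>j. j \<in> {1..m} \<Longrightarrow> continuous_on UNIV (dist_fun M (\<epsilon> j))"
    and "independent_copies M m \<epsilon> e"
    and "second_order_cond M m \<epsilon> (\<lambda>_. \<gamma>) \<rho> A"
    and "tail_dependence_cond M m \<epsilon> R"
    and "\<And>n. n = (\<Sum>j=1..m. N j n)"
    and "\<And>n j l. 1 \<le> j \<Longrightarrow> j \<le> l \<Longrightarrow> l \<le> m \<Longrightarrow> N j n \<le> N l n"
    and "\<And>j. j \<in> {1..m} \<Longrightarrow> filterlim (N j) at_top sequentially"
    and "\<And>j. j \<in> {1..m} \<Longrightarrow> filterlim (k j) at_top sequentially"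
    and "\<And>j. j \<in> {1..m} \<Longrightarrow> (\<lambda>n. real (k j n) / real (N j n)) \<longlonglongrightarrow> 0"
    and "\<And>j. j \<in> {1..m} \<Longrightarrow> (\<lambda>n. real (N 1 n) / real (N j n)) \<longlonglongrightarrow> b j \<and> 0 < b j \<and> b j \<le> 1"
    and "\<And>j. j \<in> {1..m} \<Longrightarrow> (\<lambda>n. real (k 1 n) / real (k j n)) \<longlonglongrightarrow> c j \<and> 0 < c j"
    and "\<And>j. j \<in> {1..m} \<Longrightarrow>
           (\<lambda>n. sqrt (real (k j n)) * A j (real (N j n) / real (k j n))) \<longlonglongrightarrow> lam j"
    and "(\<Sum>j=1..m. w j) = 1"
    and "\<And>n i j. j \<in> {1..m} \<Longrightarrow> i \<in> {1..N j n} \<Longrightarrow> r n i j \<in> borel_measurable M"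
    and "small_o_prob M (\<lambda>n \<omega>. MAX j\<in>{1..m}. sqrt (real (k j n)) *
           (MAX i\<in>{1..N j n}. \<bar>r n i j \<omega> - e i j \<omega>\<bar> / (1 + \<bar>e i j \<omega>\<bar>)))"
  defines "K \<equiv> (\<lambda>n. real (\<Sum>j=1..m. k j n))"
    and "gam_hat \<equiv> (\<lambda>n v \<omega>. pooled_hill m (\<lambda>i j. r n i j \<omega>) (\<lambda>j. N j n) (\<lambda>j. k j n) v)"
    and "limit_law \<equiv> normal_law (\<Sum>j=1..m. w j * bias_vec m c lam \<rho> j)
                                (\<Sum>j=1..m. \<Sum>l=1..m. w j * var_mat m \<gamma> b c R j l * w l)"
  shows "conv_in_distr M (\<lambda>n \<omega>. sqrt (K n) * (gam_hat n w \<omega> - \<gamma>)) limit_law \<and>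
    (\<forall>W :: nat \<Rightarrow> nat \<Rightarrow> 'a \<Rightarrow> real.
       (\<forall>n. \<forall>j\<in>{1..m}. W n j \<in> borel_measurable M) \<longrightarrow>
       (\<forall>n. AE \<omega> in M. (\<Sum>j=1..m. W n j \<omega>) = 1) \<longrightarrow>
       vec_conv_in_prob M m W w \<longrightarrow>
         small_o_prob M (\<lambda>n \<omega>. sqrt (K n) * (gam_hat n (\<lambda>j. W n j \<omega>) \<omega> - gam_hat n w \<omega>)) \<and>
         conv_in_distr M (\<lambda>n \<omega>. sqrt (K n) * (gam_hat n (\<lambda>j. W n j \<omega>) \<omega> - \<gamma>)) limit_law)"
proof -
  interpret prob_space M by (rule assms(1))
  note \<epsilon>_m = assms(3) and \<epsilon>_c = assms(4) and copies = assms(5) and N_mono = assms(9) and N_top = assms(10)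
    and k_top = assms(11) and k_small = assms(12) and b = assms(13) and c = assms(14) and lam = assms(15)
    and w1 = assms(16) and r_m = assms(17) and res = assms(18)
  define \<Sigma> where "\<Sigma> = (\<Sum>i=1..m. inverse (c i))"
  define X where "X j \<omega> = exp_transform M (\<epsilon> j) (\<epsilon> j \<omega>)" for j \<omega>
  define Q where "Q i j \<omega> = exp_transform M (\<epsilon> j) (e i j \<omega>)" for i j \<omega>
  define F where "F j n \<omega> = (\<Sum>i=1..N j n. excess_score (ln (real (N j n) / real (k j n))) (Q i j \<omega>)) / sqrt (real (k j n))" for j n \<omega>
  define Y where "Y j n \<omega> = sqrt (real (k j n)) * (hill (\<lambda>i. r n i j \<omega>) (N j n) (k j n) - \<gamma>)" for j n \<omega>

  have copies_Q: "independent_copies M m X Q"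
    unfolding X_def[abs_def] Q_def[abs_def]
    by (rule independent_copies_map[OF copies \<epsilon>_m, where f = "\<lambda>j. exp_transform M (\<epsilon> j)"])
      (simp_all add: \<epsilon>_m \<epsilon>_c borel_measurable_exp_transform)
  have X_exp: "distributed M lborel (X j) (exponential_density 1)" if "j \<in> {1..m}" for j
    unfolding X_def[abs_def] using \<epsilon>_m[OF that] \<epsilon>_c[OF that] by (rule exp_transform_distributed)
  have e_m: "e i j \<in> borel_measurable M" if "1 \<le> i" "j \<in> {1..m}" for i j
    by (rule independent_copies_measurable(2)[OF copies that])
  have e_indep: "indep_vars (\<lambda>_. borel) (\<lambda>i. e i j) {1..}" if "j \<in> {1..m}" for j
  proof -
    have "indep_vars (\<lambda>_. PiM {1..m} (\<lambda>_. borel)) (\<lambda>i. rand_vec m (e i)) {1..}"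
      using copies unfolding independent_copies_def by (rule conjunct1)
    then have "indep_vars (\<lambda>_. borel) (\<lambda>i \<omega>. rand_vec m (e i) \<omega> j) {1..}"
      by (rule indep_vars_compose2) (rule measurable_component_singleton[OF that])
    then show ?thesis by (simp add: rand_vec_apply[OF that])
  qed
  have e_law: "distr M borel (e i j) = distr M borel (\<epsilon> j)" if "1 \<le> i" "j \<in> {1..m}" for i j
    using independent_copies_transfer(3)[OF copies \<epsilon>_m measurable_component_singleton[OF that(2)] that(1)]
    by (simp add: rand_vec_apply[OF that(2)])
  have N_pos: "\<forall>\<^sub>F n in sequentially. \<forall>j\<in>{1..m}. 1 \<le> N j n"
    using N_top by (intro eventually_ball_finite ballI) (auto simp: filterlim_at_top)

  \<comment> \<open>Expansion in each sample\<close>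
  have res_j: "prob_lim M (\<lambda>n \<omega>. sqrt (real (k j n)) * (MAX i\<in>{1..N j n}. \<bar>r n i j \<omega> - e i j \<omega>\<bar> / (1 + \<bar>e i j \<omega>\<bar>))) 0"
    if j: "j \<in> {1..m}" for j
  proof -
    let ?T = "\<lambda>j n \<omega>. sqrt (real (k j n)) * (MAX i\<in>{1..N j n}. \<bar>r n i j \<omega> - e i j \<omega>\<bar> / (1 + \<bar>e i j \<omega>\<bar>))"
    have "(\<lambda>\<omega>. MAX j\<in>{1..m}. ?T j n \<omega>) \<in> borel_measurable M" for n
      by (intro borel_measurable_Max borel_measurable_times borel_measurable_const borel_measurable_divide
          borel_measurable_abs borel_measurable_diff borel_measurable_add r_m e_m) auto
    then have lim: "prob_lim M (\<lambda>n \<omega>. MAX j\<in>{1..m}. ?T j n \<omega>) 0"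
      using res by (subst prob_lim_iff_small_o_prob) auto
    have "\<forall>\<^sub>F p in prob_filter M. norm (?T j (fst p) (snd p)) \<le> (MAX j\<in>{1..m}. ?T j (fst p) (snd p))"
      using eventually_prob_filter_sequentially[OF N_pos]
    proof eventually_elim
      case (elim p)
      obtain n \<omega> where p: "p = (n, \<omega>)" by (cases p)
      have "0 \<le> \<bar>r n 1 j \<omega> - e 1 j \<omega>\<bar> / (1 + \<bar>e 1 j \<omega>\<bar>)" by simp
      also have "\<dots> \<le> (MAX i\<in>{1..N j n}. \<bar>r n i j \<omega> - e i j \<omega>\<bar> / (1 + \<bar>e i j \<omega>\<bar>))"
        using elim j by (intro Max_ge) (auto simp: p)
      finally have "norm (?T j n \<omega>) = ?T j n \<omega>" by simp
      also have "\<dots> \<le> (MAX j\<in>{1..m}. ?T j n \<omega>)" using j by (intro Max_ge) auto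
      finally show ?case by (simp add: p)
    qed
    then show ?thesis using lim by (rule Lim_null_comparison)
  qed

  have comp: "prob_lim M (\<lambda>n \<omega>. Y j n \<omega> - \<gamma> * F j n \<omega>) (lam j / (1 - \<rho> j)) \<and> prob_bounded M (F j) \<and>
      (\<forall>\<^sub>F n in sequentially. 0 < k j n \<and> k j n < N j n) \<and>
      filterlim (\<lambda>n. ln (real (N j n) / real (k j n))) at_top sequentially"
    if j: "j \<in> {1..m}" for j
  proof -
    from assms(6) j obtain s where C2: "\<gamma> > 0" "\<rho> j \<le> 0" "\<And>t. 0 < t \<Longrightarrow> sgn (A j t) = s" "(A j \<longlongrightarrow> 0) at_top"
      "\<And>x. 0 < x \<Longrightarrow> ((\<lambda>t. 1 / A j t * (tail_quantile M (\<epsilon> j) (t * x) / tail_quantile M (\<epsilon> j) t - x powr \<gamma>)) \<longlongrightarrow>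
        (if \<rho> j = 0 then x powr \<gamma> * ln x else x powr \<gamma> * ((x powr \<rho> j - 1) / \<rho> j))) at_top"
      unfolding second_order_cond_def by blast
    note comp = residual_hill_component[OF \<epsilon>_m[OF j] \<epsilon>_c[OF j] e_indep[OF j] e_law[OF _ j] N_top[OF j] k_top[OF j]
        k_small[OF j] C2 lam[OF j] res_j[OF j]]
    show ?thesis unfolding Y_def F_def[abs_def] Q_def by (intro conjI comp) auto
  qed
  define good where "good n \<longleftrightarrow> (\<forall>j\<in>{1..m}. 0 < k j n \<and> k j n < N j n)" for n
  have ev_good: "\<forall>\<^sub>F n in sequentially. good n"
    unfolding good_def using comp by (intro eventually_ball_finite) auto
  have good: "0 < k j n \<and> k j n < N j n" if "good n" "j \<in> {1..m}" for n j
    using that by (simp add: good_def)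

  \<comment> \<open>Limiting covariances between samples\<close>
  have m1: "1 \<in> {1..m}" using assms(2) by simp
  have N_ratio: "(\<lambda>n. real (N j n) / real (N l n)) \<longlonglongrightarrow> b l / b j" if "j \<in> {1..m}" "l \<in> {1..m}" for j l
  proof (rule Lim_transform_eventually)
    show "(\<lambda>n. (real (N 1 n) / real (N l n)) / (real (N 1 n) / real (N j n))) \<longlonglongrightarrow> b l / b j"
      using b[OF that(1)] b[OF that(2)] by (intro tendsto_divide) auto
    show "\<forall>\<^sub>F n in sequentially. (real (N 1 n) / real (N l n)) / (real (N 1 n) / real (N j n)) = real (N j n) / real (N l n)"
      using ev_good by eventually_elim (use good[OF _ m1] in force)
  qed
  have k_ratio: "(\<lambda>n. real (k j n) / real (k l n)) \<longlonglongrightarrow> c l / c j" if "j \<in> {1..m}" "l \<in> {1..m}" for j l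
  proof (rule Lim_transform_eventually)
    show "(\<lambda>n. (real (k 1 n) / real (k l n)) / (real (k 1 n) / real (k j n))) \<longlonglongrightarrow> c l / c j"
      using c[OF that(1)] c[OF that(2)] by (intro tendsto_divide) auto
    show "\<forall>\<^sub>F n in sequentially. (real (k 1 n) / real (k l n)) / (real (k 1 n) / real (k j n)) = real (k j n) / real (k l n)"
      using ev_good by eventually_elim (use good[OF _ m1] in force)
  qed

  \<comment> \<open>The limit is computed for \<open>j < l\<close>, where
    \<open>N j n \<le> N l n\<close> identifies the smaller sample; \<open>\<Gamma>\<close> extends
    it by symmetry, with 1 on the diagonal because a score has second moment
    \<open>k / N\<close>.\<close>
  define \<Gamma>' where "\<Gamma>' j l = R j l (ennreal (c l / c j)) (ennreal (b l / b j)) / sqrt (c l / c j)" for j l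
  define \<Gamma> where "\<Gamma> j l = (if j = l then 1 else if j < l then \<Gamma>' j l else \<Gamma>' l j)" for j l
  let ?C = "\<lambda>j l n. real (min (N j n) (N l n)) / (sqrt (real (k j n)) * sqrt (real (k l n))) *
        expectation (\<lambda>\<omega>. excess_score (ln (real (N j n) / real (k j n))) (X j \<omega>) *
          excess_score (ln (real (N l n) / real (k l n))) (X l \<omega>))"
  have cov_less: "?C j l \<longlonglongrightarrow> \<Gamma>' j l" if "j \<in> {1..m}" "l \<in> {1..m}" "j < l" for j l
    unfolding X_def \<Gamma>'_def
  proof (rule excess_score_covariance_limit[OF \<epsilon>_m[OF that(1)] \<epsilon>_c[OF that(1)] \<epsilon>_m[OF that(2)] \<epsilon>_c[OF that(2)]])
    show "((\<lambda>s. s * survival_copula M (\<epsilon> j) (\<epsilon> l) (x / ennreal s) (y / ennreal s)) \<longlongrightarrow> R j l x y) at_top"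
      if "(x, y) \<noteq> (\<infinity>, \<infinity>)" for x y
      using assms(7) \<open>j \<in> {1..m}\<close> \<open>l \<in> {1..m}\<close> \<open>j < l\<close> that unfolding tail_dependence_cond_def by auto
    show "\<forall>\<^sub>F n in sequentially. 0 < k j n \<and> k j n < N j n \<and> 0 < k l n \<and> k l n < N l n \<and> N j n \<le> N l n"
      using ev_good by eventually_elim (use good N_mono that in auto)
  qed (use comp N_ratio k_ratio b c that in auto)
  have cov: "?C j l \<longlonglongrightarrow> \<Gamma> j l" if j: "j \<in> {1..m}" and l: "l \<in> {1..m}" for j l
  proof (cases j l rule: linorder_cases)
    case less
    then show ?thesis using cov_less[OF j l] by (simp add: \<Gamma>_def)
  next
    case greater
    then show ?thesis using cov_less[OF l j] by (simp add: \<Gamma>_def mult.commute min.commute)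
  next
    case equal
    have "?C j j n = 1" if "good n" for n
    proof -
      have "0 \<le> ln (real (N j n) / real (k j n))" using good[OF that j] by simp
      from excess_score_moments(4)[OF X_exp[OF j] this] good[OF that j]
      show ?thesis by (simp add: power2_eq_square[symmetric] exp_minus)
    qed
    then have "\<forall>\<^sub>F n in sequentially. 1 = ?C j j n" using ev_good by (auto elim: eventually_mono)
    then show ?thesis unfolding \<Gamma>_def equal[symmetric] by (simp add: Lim_transform_eventually[OF tendsto_const])
  qed

  have c_pos: "0 < c j" if "j \<in> {1..m}" for j using c[OF that] by simp
  have "0 < \<Sigma>" unfolding \<Sigma>_def using m1 c_pos by (intro sum_pos) auto
  \<comment> \<open>\<open>c j * \<Sigma>\<close> is the limit of \<open>K / k j\<close>: the pooled
    estimator is scaled by \<open>sqrt K\<close>, each component by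
    \<open>sqrt (k j)\<close>.\<close>
  define v where "v j = w j * \<gamma> * sqrt (c j * \<Sigma>)" for j
  define S where "S n \<omega> = (if good n then \<Sum>j=1..m. v j * F j n \<omega> else 0)" for n \<omega>
  define V where "V = (\<Sum>j=1..m. \<Sum>l=1..m. w j * var_mat m \<gamma> b c R j l * w l)"
  define \<mu> where "\<mu> = (\<Sum>j=1..m. w j * bias_vec m c lam \<rho> j)"
  have V: "V = (\<Sum>j=1..m. \<Sum>l=1..m. v j * v l * \<Gamma> j l)"
    unfolding V_def
  proof (intro sum.cong refl)
    fix j l assume j: "j \<in> {1..m}" and l: "l \<in> {1..m}"
    \<comment> \<open>\<open>sqrt (c p) * sqrt (c q)\<close> divided by
      \<open>sqrt (c q / c p)\<close> is \<open>c p\<close>, the factor in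
      \<open>var_mat\<close>.\<close>
    have off: "sqrt (c p) * sqrt (c q) * \<Gamma>' p q = c p * R p q (ennreal (c q / c p)) (ennreal (b q / b p))"
      if "p \<in> {1..m}" "q \<in> {1..m}" for p q
      using c_pos[OF that(1)] c_pos[OF that(2)] by (simp add: \<Gamma>'_def real_sqrt_divide)
    have "sqrt (c j) * sqrt (c l) * \<Gamma> j l * (\<Sigma> * \<gamma>\<^sup>2) = var_mat m \<gamma> b c R j l"
      using off[OF j l] off[OF l j] c_pos[OF j]
      unfolding \<Gamma>_def var_mat_def \<Sigma>_def[symmetric] Let_def
      by (cases j l rule: linorder_cases) (simp_all add: mult_ac)
    moreover have "v j * v l * \<Gamma> j l = w j * (sqrt (c j) * sqrt (c l) * \<Gamma> j l * (\<Sigma> * \<gamma>\<^sup>2)) * w l"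
      using \<open>0 < \<Sigma>\<close> by (simp add: v_def real_sqrt_mult power2_eq_square mult_ac)
    ultimately show "w j * var_mat m \<gamma> b c R j l * w l = v j * v l * \<Gamma> j l" by simp
  qed
  note CLT = exponential_copies_CLT_char[where v = v and k = k and N = N and good = good, OF copies_Q X_exp N_top k_top cov ev_good good,
      folded F_def S_def V]
  have S_m: "S n \<in> borel_measurable M" for n using CLT(1) by (simp add: S_def[abs_def])
  have S_char: "(\<lambda>n. char (distr M borel (S n)) t) \<longlonglongrightarrow> of_real (exp (- (t\<^sup>2 * V / 2)))" for t
    using CLT(2)[of t] by (simp add: S_def[abs_def])
  \<comment> \<open>Characteristic functions are bounded by 1 and so is their limit; this forces the
    limiting variance to be nonnegative.\<close>
  have "exp (- (1\<^sup>2 * V / 2)) \<le> 1"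
  proof (rule LIMSEQ_le_const2)
    show "(\<lambda>n. norm (char (distr M borel (S n)) 1)) \<longlonglongrightarrow> exp (- (1\<^sup>2 * V / 2))"
      using tendsto_norm[OF S_char[of 1]] by (simp del: of_real_exp)
    show "\<exists>n0. \<forall>n\<ge>n0. norm (char (distr M borel (S n)) 1) \<le> 1"
      using S_m by (intro exI allI impI real_distribution.cmod_char_le_1 real_distribution_distr)
  qed
  then have "V \<ge> 0" by simp

  \<comment> \<open>Pooling with fixed weights\<close>
  define h where "h j n \<omega> = hill (\<lambda>i. r n i j \<omega>) (N j n) (k j n)" for j n \<omega>
  have h_m: "h j n \<in> borel_measurable M" if "j \<in> {1..m}" for j n
    unfolding h_def[abs_def] using r_m[OF that] by (intro borel_measurable_hill)
  have gam: "gam_hat n u \<omega> = (\<Sum>j=1..m. u j * h j n \<omega>)" for n u \<omega>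
    by (simp add: gam_hat_def pooled_hill_def h_def)
  define s where "s j = sqrt (c j * \<Sigma>)" for j
  define U where "U j n \<omega> = sqrt (K n) * (h j n \<omega> - \<gamma>)" for j n \<omega>
  \<comment> \<open>\<open>K / k j\<close> is the sum of the ratios \<open>k i / k j\<close>, whose
    limits are \<open>c j / c i\<close>.\<close>
  have K_ratio: "(\<lambda>n. sqrt (K n / real (k j n))) \<longlonglongrightarrow> s j" if "j \<in> {1..m}" for j
  proof -
    have "(\<lambda>n. \<Sum>i=1..m. real (k i n) / real (k j n)) \<longlonglongrightarrow> (\<Sum>i=1..m. c j / c i)"
      using that by (intro tendsto_sum k_ratio)
    moreover have "(\<Sum>i=1..m. real (k i n) / real (k j n)) = K n / real (k j n)" for n
      by (simp add: K_def sum_divide_distrib)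
    moreover have "(\<Sum>i=1..m. c j / c i) = c j * \<Sigma>"
      by (simp add: \<Sigma>_def sum_distrib_left divide_inverse)
    ultimately show ?thesis unfolding s_def by (simp add: tendsto_real_sqrt)
  qed
  \<comment> \<open>Replacing \<open>sqrt (K / k j)\<close> by its limit costs a null sequence times
    the tight \<open>F j\<close>.\<close>
  have U_lim: "prob_lim M (\<lambda>n \<omega>. U j n \<omega> - s j * \<gamma> * F j n \<omega>) (s j * (lam j / (1 - \<rho> j)))" if j: "j \<in> {1..m}" for j
  proof (rule Lim_transform_eventually)
    have "prob_lim M (\<lambda>n \<omega>. (sqrt (K n / real (k j n)) - s j) * F j n \<omega>) 0"
      using comp[OF j] K_ratio[OF j] by (intro prob_lim_zero_mult_bounded prob_lim_sequence) (auto simp: LIM_zero)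
    from tendsto_add[OF tendsto_mult[OF prob_lim_sequence[OF K_ratio[OF j]] conjunct1[OF comp[OF j]]] tendsto_mult[OF tendsto_const[of \<gamma>] this]]
    show "prob_lim M (\<lambda>n \<omega>. sqrt (K n / real (k j n)) * (Y j n \<omega> - \<gamma> * F j n \<omega>) + \<gamma> * ((sqrt (K n / real (k j n)) - s j) * F j n \<omega>)) (s j * (lam j / (1 - \<rho> j)))"
      by simp
    show "\<forall>\<^sub>F p in prob_filter M. sqrt (K (fst p) / real (k j (fst p))) * (Y j (fst p) (snd p) - \<gamma> * F j (fst p) (snd p))
        + \<gamma> * ((sqrt (K (fst p) / real (k j (fst p))) - s j) * F j (fst p) (snd p)) = U j (fst p) (snd p) - s j * \<gamma> * F j (fst p) (snd p)"
      using eventually_prob_filter_sequentially[OF ev_good]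
    proof eventually_elim
      case (elim p)
      have "sqrt (K (fst p) / real (k j (fst p))) * Y j (fst p) (snd p) = U j (fst p) (snd p)"
        using good[OF elim j] by (simp add: Y_def U_def h_def real_sqrt_divide)
      then show ?case by (simp add: algebra_simps)
    qed
  qed
  have U_bounded: "prob_bounded M (U j)" if j: "j \<in> {1..m}" for j
    using prob_bounded_add[OF prob_lim_imp_bounded[OF U_lim[OF j]] prob_bounded_cmult[of "F j" "s j * \<gamma>"]] comp[OF j] by simp

  define T where "T n \<omega> = sqrt (K n) * (gam_hat n w \<omega> - \<gamma>)" for n \<omega>
  have T_m: "T n \<in> borel_measurable M" for n
    unfolding T_def[abs_def] gam by (intro borel_measurable_times borel_measurable_const borel_measurable_diff borel_measurable_sum h_m)
  \<comment> \<open>The weights sum to 1, so \<open>\<gamma>\<close> can be distributed over the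
    components.\<close>
  have T: "T n \<omega> = (\<Sum>j=1..m. w j * U j n \<omega>)" for n \<omega>
  proof -
    have "gam_hat n w \<omega> - \<gamma> = (\<Sum>j=1..m. w j * h j n \<omega>) - (\<Sum>j=1..m. w j) * \<gamma>" unfolding gam w1 by simp
    also have "\<dots> = (\<Sum>j=1..m. w j * (h j n \<omega> - \<gamma>))" by (simp add: sum_distrib_right sum_subtractf right_diff_distrib)
    finally show ?thesis by (simp add: T_def U_def sum_distrib_left mult_ac)
  qed
  have TS: "prob_lim M (\<lambda>n \<omega>. T n \<omega> - S n \<omega>) \<mu>"
  proof (rule Lim_transform_eventually)
    have "prob_lim M (\<lambda>n \<omega>. \<Sum>j=1..m. w j * (U j n \<omega> - s j * \<gamma> * F j n \<omega>)) (\<Sum>j=1..m. w j * (s j * (lam j / (1 - \<rho> j))))"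
      by (intro tendsto_sum tendsto_mult tendsto_const U_lim)
    also have "(\<Sum>j=1..m. w j * (s j * (lam j / (1 - \<rho> j)))) = \<mu>"
      unfolding \<mu>_def s_def bias_vec_def \<Sigma>_def[symmetric] real_sqrt_mult by (simp add: mult_ac)
    finally show "prob_lim M (\<lambda>n \<omega>. \<Sum>j=1..m. w j * (U j n \<omega> - s j * \<gamma> * F j n \<omega>)) \<mu>" .
    have eq: "(\<Sum>j=1..m. w j * (U j n \<omega> - s j * \<gamma> * F j n \<omega>)) = T n \<omega> - S n \<omega>" if "good n" for n \<omega>
      using that unfolding T S_def v_def s_def by (simp add: sum_subtractf right_diff_distrib mult_ac)
    show "\<forall>\<^sub>F p in prob_filter M. (\<Sum>j=1..m. w j * (U j (fst p) (snd p) - s j * \<gamma> * F j (fst p) (snd p))) = T (fst p) (snd p) - S (fst p) (snd p)"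
      using eventually_prob_filter_sequentially[OF ev_good] by eventually_elim (rule eq)
  qed
  have law: "limit_law = normal_law \<mu> V" unfolding limit_law_def \<mu>_def V_def ..

  show ?thesis
  proof (intro conjI allI impI)
    show "conv_in_distr M (\<lambda>n \<omega>. sqrt (K n) * (gam_hat n w \<omega> - \<gamma>)) limit_law"
      unfolding law T_def[symmetric] using T_m S_m S_char TS \<open>V \<ge> 0\<close> by (rule weak_conv_normal_lawI)

    \<comment> \<open>Random weights\<close>
    fix W :: "nat \<Rightarrow> nat \<Rightarrow> 'a \<Rightarrow> real"
    assume W_m: "\<forall>n. \<forall>j\<in>{1..m}. W n j \<in> borel_measurable M"
      and W1: "\<forall>n. AE \<omega> in M. (\<Sum>j=1..m. W n j \<omega>) = 1"
      and W_lim: "vec_conv_in_prob M m W w"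
    define D where "D n \<omega> = sqrt (K n) * (gam_hat n (\<lambda>j. W n j \<omega>) \<omega> - gam_hat n w \<omega>)" for n \<omega>
    have D_m: "D n \<in> borel_measurable M" for n
      unfolding D_def[abs_def] gam using W_m
      by (intro borel_measurable_times borel_measurable_const borel_measurable_diff borel_measurable_sum h_m) auto
    have L2_m: "(\<lambda>\<omega>. L2_set (\<lambda>j. W n j \<omega> - w j) {1..m}) \<in> borel_measurable M" for n
      unfolding L2_set_def using W_m
      by (intro measurable_compose[OF _ borel_measurable_sqrt] borel_measurable_sum borel_measurable_power borel_measurable_diff borel_measurable_const) auto
    have L2: "prob_lim M (\<lambda>n \<omega>. L2_set (\<lambda>j. W n j \<omega> - w j) {1..m}) 0"
      using W_lim L2_m unfolding vec_conv_in_prob_def by (subst prob_lim_iff_small_o_prob) auto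
    have Wj: "prob_lim M (\<lambda>n \<omega>. W n j \<omega> - w j) 0" if j: "j \<in> {1..m}" for j
    proof (rule Lim_null_comparison[OF always_eventually L2], rule allI)
      fix p :: "nat \<times> 'a"
      have "(W (fst p) j (snd p) - w j)\<^sup>2 \<le> (\<Sum>j=1..m. (W (fst p) j (snd p) - w j)\<^sup>2)"
        using j by (intro member_le_sum) auto
      then have "sqrt ((W (fst p) j (snd p) - w j)\<^sup>2) \<le> L2_set (\<lambda>j. W (fst p) j (snd p) - w j) {1..m}"
        unfolding L2_set_def by (rule real_sqrt_le_mono)
      then show "norm (W (fst p) j (snd p) - w j) \<le> L2_set (\<lambda>j. W (fst p) j (snd p) - w j) {1..m}" by simp
    qed
    have D0: "prob_lim M D 0"
    proof (rule Lim_transform_eventually)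
      have "prob_lim M (\<lambda>n \<omega>. \<Sum>j=1..m. (W n j \<omega> - w j) * U j n \<omega>) (\<Sum>j=1..m. 0)"
        by (intro tendsto_sum prob_lim_zero_mult_bounded Wj U_bounded)
      then show "prob_lim M (\<lambda>n \<omega>. \<Sum>j=1..m. (W n j \<omega> - w j) * U j n \<omega>) 0" by simp
      \<comment> \<open>Both weight vectors sum to 1, so \<open>\<gamma>\<close> may be subtracted
        from every estimator: the difference becomes a sum of weight errors tending to 0 times tight
        components.\<close>
      have eq: "(\<Sum>j=1..m. (W n j \<omega> - w j) * U j n \<omega>) = D n \<omega>" if "(\<Sum>j=1..m. W n j \<omega>) = 1" for n \<omega>
      proof -
        have "(\<Sum>j=1..m. (W n j \<omega> - w j) * (h j n \<omega> - \<gamma>)) =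
            (\<Sum>j=1..m. W n j \<omega> * h j n \<omega>) - (\<Sum>j=1..m. w j * h j n \<omega>) - ((\<Sum>j=1..m. W n j \<omega>) - (\<Sum>j=1..m. w j)) * \<gamma>"
          by (simp add: sum_subtractf sum_distrib_right left_diff_distrib right_diff_distrib)
        also have "\<dots> = gam_hat n (\<lambda>j. W n j \<omega>) \<omega> - gam_hat n w \<omega>" unfolding gam that w1 by simp
        finally have "sqrt (K n) * (\<Sum>j=1..m. (W n j \<omega> - w j) * (h j n \<omega> - \<gamma>)) = D n \<omega>" unfolding D_def by (rule arg_cong)
        then show ?thesis by (simp add: U_def sum_distrib_left mult_ac)
      qed
      show "\<forall>\<^sub>F p in prob_filter M. (\<Sum>j=1..m. (W (fst p) j (snd p) - w j) * U j (fst p) (snd p)) = D (fst p) (snd p)"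
      \<comment> \<open>The random weights sum to 1 only almost surely, and the exceptional null set
        may vary with \<open>n\<close>.\<close>
      proof (rule eventually_prob_filter_AE, rule always_eventually, rule allI)
        fix n
        show "AE \<omega> in M. (\<Sum>j=1..m. (W n j \<omega> - w j) * U j n \<omega>) = D n \<omega>"
          using W1[rule_format, of n] by eventually_elim (rule eq)
      qed
    qed
    show "small_o_prob M (\<lambda>n \<omega>. sqrt (K n) * (gam_hat n (\<lambda>j. W n j \<omega>) \<omega> - gam_hat n w \<omega>))"
      using D0 D_m unfolding D_def[symmetric] by (subst prob_lim_iff_small_o_prob[symmetric]) auto
    have sum: "sqrt (K n) * (gam_hat n (\<lambda>j. W n j \<omega>) \<omega> - \<gamma>) = D n \<omega> + T n \<omega>" for n \<omega>
      by (simp add: D_def T_def algebra_simps)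
    \<comment> \<open>The comparison with the sums \<open>S\<close> survives the change of weights,
      so the limit law is obtained by the same continuity argument.\<close>
    have "prob_lim M (\<lambda>n \<omega>. D n \<omega> + (T n \<omega> - S n \<omega>)) (0 + \<mu>)" by (rule tendsto_add[OF D0 TS])
    then have DTS: "prob_lim M (\<lambda>n \<omega>. D n \<omega> + T n \<omega> - S n \<omega>) \<mu>" by (simp add: add_diff_eq)
    have DT_m: "(\<lambda>\<omega>. D n \<omega> + T n \<omega>) \<in> borel_measurable M" for n by (intro borel_measurable_add D_m T_m)
    show "conv_in_distr M (\<lambda>n \<omega>. sqrt (K n) * (gam_hat n (\<lambda>j. W n j \<omega>) \<omega> - \<gamma>)) limit_law"
      unfolding law sum using DT_m S_m S_char DTS \<open>V \<ge> 0\<close> by (rule weak_conv_normal_lawI)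
  qed
qed

end
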